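(* Let $d\ge 2$ and let $G$ be a probability distribution on $[0,+\infty)$ such that there exists $M>0$ with $G([M,+\infty))=0$. Let $\vec v\in\mathbb S^{d-1}$ (the Euclidean unit sphere of $\mathbb R^d$) and $s>0$. Then $$-\lim_{\varepsilon\to0}\limsup_{n\to\infty}\frac1{n^d}\log\mathbb P\Big(\exists f_n\in\mathcal S_n(\mathfrak C):\ \mathfrak d\big(\vec\mu_n(f_n)\mathbf 1_{\mathfrak C},\,s\vec v\,\mathbf 1_{\mathfrak C}\mathcal L^d\big)\le\varepsilon\Big)$$ $$=-\lim_{\varepsilon\to0}\liminf_{n\to\infty}\frac1{n^d}\log\mathbb P\Big(\exists f_n\in\mathcal S_n(\mathfrak C):\ \mathfrak d\big(\vec\mu_n(f_n)\mathbf 1_{\mathfrak C},\,s\vec v\,\mathbf 1_{\mathfrak C}\mathcal L^d\big)\le\varepsilon\Big).$$ (The common value, in $[0,+\infty]$, is denoted $I(s\vec v)$.)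
   Context: Convention: $\log 0=-\infty$. $\mathcal L^d$ is Lebesgue measure. Lattice and capacities. For $n\ge1$, $\mathbb Z^d_n=\mathbb Z^d/n$ and $\mathbb E^d_n$ is the set of (unordered) pairs $\langle x,y\rangle$ of points of $\mathbb Z_n^d$ at Euclidean distance $1/n$. The capacities $(t(e))_{e\in\mathbb E_n^d}$ are i.i.d. with law $G$. $(\vec e_1,\dots,\vec e_d)$ is the canonical basis. Streams. A stream is a function $f_n:\mathbb E_n^d\to\mathbb R^d$ such that $f_n(e)$ is collinear with the segment $e$. It satisfies the node law at $x\in\mathbb Z_n^d$ if $\sum_{y:\,e=\langle x,y\rangle\in\mathbb E_n^d}f_n(e)\cdot\vec{xy}=0$. The associated vector measure is $\vec\mu_n(f_n)=\frac1{n^d}\sum_{e\in\mathbb E_n^d}f_n(e)\delta_{c(e)}$, where $c(e)$ is the center of $e$. Admissible streams through $C\subset\mathbb R^d$. $\mathcal S_n(C)$ is the (random) set of streams $f_n$ such that: (1) for each edge $e=\langle x,y\rangle$ with $x\in C$ and $\vec{xy}=\vec e_i/n$ for some $i$, $\|f_n(e)\|_2\le t(e)$; (2) the node law holds at every $x\in\mathbb Z_n^d\cap C$ such that $x-\vec e_i/n\in C$ for all $i\in\{1,\dots,d\}$. $\mathfrak C=[-\frac12,\frac12)^d$. Distance. For $k\in\mathbb N$ and $\lambda\in[1,2]$, $\Delta^k_\lambda=\{2^{-k}\lambda([-\frac12,\frac12)^d+x):x\in\mathbb Z^d\}$. For $\mathbb R^d$-valued measures $\mu,\nu$, $$\mathfrak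 d(\nu,\mu)=\sup_{x\in[-1,1)^d}\ \sup_{\lambda\in[1,2]}\ \sum_{k=0}^\infty\frac1{2^k}\sum_{Q\in\Delta^k_\lambda}\|\mu(Q+x)-\nu(Q+x)\|_2 .$$ *)

theory Defs
  imports "HOL-Probability.Probability"
begin

definition int_vectors :: "(real ^ 'd) set" where
  "int_vectors = {z. \<forall>i. z $ i \<in> \<int>}"

definition lattice :: "nat \<Rightarrow> (real ^ 'd) set" where
  "lattice n = (\<lambda>z. z /\<^sub>R real n) ` int_vectors"

text \<open>Unordered pairs are represented as two-element sets of points.\<close>

definition edges :: "nat \<Rightarrow> (real ^ 'd) set set" where
  "edges n = {{x, y} |x y. x \<in> lattice n \<and> y \<in> lattice n \<and> dist x y = 1 / real n}"

definition center :: "(real ^ 'd) set \<Rightarrow> real ^ 'd" where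
  "center e = (1 / 2) *\<^sub>R (\<Sum>x\<in>e. x)"

text \<open>A stream is a total function on sets of points; only its values on \<^term>\<open>edges n\<close> matter.\<close>

definition is_stream :: "nat \<Rightarrow> ((real ^ 'd) set \<Rightarrow> real ^ 'd) \<Rightarrow> bool" where
  "is_stream n f \<longleftrightarrow> (\<forall>x y. {x, y} \<in> edges n \<longrightarrow> (\<exists>c. f {x, y} = c *\<^sub>R (y - x)))"

definition node_law :: "nat \<Rightarrow> ((real ^ 'd) set \<Rightarrow> real ^ 'd) \<Rightarrow> real ^ 'd \<Rightarrow> bool" where
  "node_law n f x \<longleftrightarrow> (\<Sum>y | {x, y} \<in> edges n. f {x, y} \<bullet> (y - x)) = 0"

definition admissible_streams ::
    "nat \<Rightarrow> (real ^ 'd) set \<Rightarrow> ((real ^ 'd) set \<Rightarrow> real) \<Rightarrow> ((real ^ 'd) set \<Rightarrow> real ^ 'd) set" where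
  "admissible_streams n C t = {f. is_stream n f \<and>
     (\<forall>x y i. {x, y} \<in> edges n \<and> x \<in> C \<and> y - x = (1 / real n) *\<^sub>R axis i 1
        \<longrightarrow> norm (f {x, y}) \<le> t {x, y}) \<and>
     (\<forall>x \<in> lattice n \<inter> C. (\<forall>i. x - (1 / real n) *\<^sub>R axis i 1 \<in> C) \<longrightarrow> node_law n f x)}"

definition unit_cube :: "(real ^ 'd) set" where
  "unit_cube = {x. \<forall>i. - 1 / 2 \<le> x $ i \<and> x $ i < 1 / 2}"

text \<open>
  Vector measures are represented by their set functions. The measure of a stream is infinite
  in general, so its value is meaningful on bounded sets only; on those the sum below has
  finitely many nonzero terms.
\<close>

definition stream_measure ::
    "nat \<Rightarrow> ((real ^ 'd) set \<Rightarrow> real ^ 'd) \<Rightarrow> (real ^ 'd) set \<Rightarrow> real ^ 'd" where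
  "stream_measure n f A =
     (1 / real n ^ CARD('d)) *\<^sub>R (\<Sum>\<^sub>\<infinity>e\<in>edges n. indicator A (center e) *\<^sub>R f e)"

definition restrict_vmeasure ::
    "((real ^ 'd) set \<Rightarrow> real ^ 'd) \<Rightarrow> (real ^ 'd) set \<Rightarrow> (real ^ 'd) set \<Rightarrow> real ^ 'd" where
  "restrict_vmeasure \<mu> C A = \<mu> (A \<inter> C)"

definition density_vmeasure :: "(real ^ 'd \<Rightarrow> real ^ 'd) \<Rightarrow> (real ^ 'd) set \<Rightarrow> real ^ 'd" where
  "density_vmeasure h A = (LINT x:A|lborel. h x)"

definition dyadic_cubes :: "nat \<Rightarrow> real \<Rightarrow> (real ^ 'd) set set" where
  "dyadic_cubes k l = {(\<lambda>y. (l / 2 ^ k) *\<^sub>R (y + z)) ` unit_cube |z. z \<in> int_vectors}"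

definition vdist ::
    "((real ^ 'd) set \<Rightarrow> real ^ 'd) \<Rightarrow> ((real ^ 'd) set \<Rightarrow> real ^ 'd) \<Rightarrow> ennreal" where
  "vdist \<nu> \<mu> =
     (SUP x \<in> {x. \<forall>i. - 1 \<le> x $ i \<and> x $ i < 1}. SUP l \<in> {1..2}.
        \<Sum>k. ennreal (1 / 2 ^ k) *
          (\<Sum>\<^sub>\<infinity>Q\<in>dyadic_cubes k l. ennreal (norm (\<mu> ((\<lambda>y. y + x) ` Q) - \<nu> ((\<lambda>y. y + x) ` Q)))))"

definition elog :: "real \<Rightarrow> ereal" where
  "elog p = (if p = 0 then - \<infinity> else ereal (ln p))"

definition stream_prob ::
    "'w measure \<Rightarrow> ((real ^ 'd) set \<Rightarrow> 'w \<Rightarrow> real) \<Rightarrow> real ^ 'd \<Rightarrow> real \<Rightarrow> nat \<Rightarrow> real" where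
  "stream_prob P t w \<epsilon> n =
     measure P {\<omega> \<in> space P. \<exists>f \<in> admissible_streams n unit_cube (\<lambda>e. t e \<omega>).
       vdist (restrict_vmeasure (stream_measure n f) unit_cube)
             (density_vmeasure (\<lambda>x. indicator unit_cube x *\<^sub>R w)) \<le> ennreal \<epsilon>}"

end

theory Submission
  imports Defs
begin

text \<open>Let \<open>M\<close> be the essential supremum of the capacities and suppose that at scale \<open>n\<close> some stream is
  very close to \<open>s v\<close>. Restricted to a cube and multiplied by \<open>1 - \<eta>\<close>, it is the core of a tile;
  the core is surrounded by a thin shell of edges, all of whose capacities are forced to be almost
  \<open>M\<close>, at a cost of small order compared with \<open>n\<^sup>d\<close>. The spare capacity of order \<open>\<eta> M\<close> in the shell
  allows one to extend the stream so that it equals \<open>(1 - \<eta>) s v\<close> on the outer boundary of the tile,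
  because the stream has almost the right flux through every patch of the faces of the core. Tiles
  of this kind match each other, so independent copies of one tile fill the unit cube at any larger
  scale. Hence the exponential rate is almost supermultiplicative: the lower limit at precision
  \<open>\<epsilon>\<close> is at least the upper limit at a much smaller precision, up to an arbitrarily small error.
  The smaller precision is chosen after the geometry of the tile, so crude constants suffice.\<close>

text \<open>The distance sees averages of a stream over cubes, not its flux through a surface. The
  node law closes this gap: the mean flux through a patch of side \<open>a\<close> changes by order
  \<open>M\<close>/\<open>m\<close> over a depth \<open>a\<close>/\<open>m\<close>, so one layer of
  subcubes of that side determines it up to this error. The shell needs two transports because the
  defect of the interpolation has density of order \<open>M\<close>/\<open>l\<close>: carried across
  a whole tile it could load an edge with order \<open>M\<close>, while inside patches of side
  \<open>l\<close>/\<open>b\<close> it costs order \<open>M\<close>/\<open>b\<close>. What remains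
  has density \<gamma>/\<open>l\<close>, where \<gamma> is the error of the fluxes and may be small
  compared with all proportions of the tile. These come in a forced order: \<open>b\<close> from the
  spare capacity, \<open>k\<close> so large that the shell stays cheap at the price of one forced
  edge, then \<open>m\<close>, \<gamma> and the precision. Only the subcube side \<open>D\<close>
  grows with \<open>n\<close>, so the estimates are uniform in \<open>n\<close>. A target with a
  component above \<open>M\<close> is ruled out when the limit \<open>J\<close> of the upper rates
  is finite; if it is -\<infinity>, the lower bound is trivial.\<close>

section \<open>Integer boxes and interval grids\<close>

text \<open>The pair \<open>(p, i)\<close> stands for the edge from \<open>p\<close> to its neighbour in the positive direction \<open>i\<close>.\<close>

definition flow_div :: "(('d::finite \<Rightarrow> int) \<times> 'd \<Rightarrow> real) \<Rightarrow> ('d \<Rightarrow> int) \<Rightarrow> real" where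
  "flow_div f p = (\<Sum>i\<in>UNIV. f (p, i) - f (p(i := p i - 1), i))"

definition ibox :: "('d \<Rightarrow> int) \<Rightarrow> ('d \<Rightarrow> int) \<Rightarrow> ('d \<Rightarrow> int) set" where
  "ibox a b = {p. \<forall>i. a i \<le> p i \<and> p i < b i}"

lemma ibox_eq_PiE: "ibox a b = (\<Pi>\<^sub>E i\<in>UNIV. {a i..<b i})"
  by (auto simp: ibox_def PiE_def)

lemma finite_ibox [simp]: "finite (ibox a (b :: 'd::finite \<Rightarrow> int))"
  unfolding ibox_eq_PiE by (rule finite_PiE) auto

lemma card_ibox: "card (ibox a (b :: 'd::finite \<Rightarrow> int)) = (\<Prod>i\<in>UNIV. nat (b i - a i))"
  unfolding ibox_eq_PiE by (simp add: card_PiE)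

lemma flow_div_add: "flow_div (\<lambda>e. f e + g e) p = flow_div f p + flow_div g p"
  by (simp add: flow_div_def sum.distrib[symmetric] algebra_simps)

lemma flow_div_scale: "flow_div (\<lambda>e. c * f e) p = c * flow_div f p"
  by (simp add: flow_div_def sum_distrib_left right_diff_distrib)

lemma flow_div_const: "flow_div (\<lambda>(p, i). u i) p = 0"
  by (simp add: flow_div_def)

text \<open>Telescoping in direction \<open>i\<close>: one step backwards maps the box without its
  lower face bijectively onto the box without its upper face, so only these two faces
  survive.\<close>

lemma sum_ibox_diff:
  fixes g :: "('d::finite \<Rightarrow> int) \<Rightarrow> real"
  shows "(\<Sum>p\<in>ibox a b. g p - g (p(i := p i - 1))) =
     (\<Sum>p\<in>ibox a b \<inter> {p. p i = b i - 1}. g p) - (\<Sum>p\<in>ibox a b \<inter> {p. p i = a i}. g (p(i := p i - 1)))"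
proof -
  let ?B = "ibox a b"
  have 1: "(\<Sum>p\<in>?B. g p) = (\<Sum>p\<in>?B \<inter> {p. p i = b i - 1}. g p) + (\<Sum>p\<in>?B - {p. p i = b i - 1}. g p)"
    by (subst sum.union_disjoint[symmetric]) (auto intro!: sum.cong)
  have 2: "(\<Sum>p\<in>?B. g (p(i := p i - 1))) =
      (\<Sum>p\<in>?B \<inter> {p. p i = a i}. g (p(i := p i - 1))) + (\<Sum>p\<in>?B - {p. p i = a i}. g (p(i := p i - 1)))"
    by (subst sum.union_disjoint[symmetric]) (auto intro!: sum.cong)
  have 3: "(\<Sum>p\<in>?B - {p. p i = a i}. g (p(i := p i - 1))) = (\<Sum>p\<in>?B - {p. p i = b i - 1}. g p)"
  proof (rule sum.reindex_bij_witness[of _ "\<lambda>p. p(i := p i + 1)" "\<lambda>p. p(i := p i - 1)"])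
    fix p assume p: "p \<in> ?B - {p. p i = a i}"
    have *: "a j \<le> p j" "p j < b j" for j using p by (simp_all add: ibox_def)
    have "a i \<noteq> p i" using p by simp
    with *[of i] have "a i \<le> p i - 1" "p i - 1 < b i" by linarith+
    with * have "p(i := p i - 1) \<in> ?B" unfolding ibox_def mem_Collect_eq by (metis fun_upd_apply)
    then show "p(i := p i - 1) \<in> ?B - {p. p i = b i - 1}" using *(2)[of i] by simp
  next
    fix p assume p: "p \<in> ?B - {p. p i = b i - 1}"
    have *: "a j \<le> p j" "p j < b j" for j using p by (simp_all add: ibox_def)
    have "p i \<noteq> b i - 1" using p by simp
    with *[of i] have "p i + 1 < b i" "a i \<le> p i + 1" by linarith+
    with * have "p(i := p i + 1) \<in> ?B" unfolding ibox_def mem_Collect_eq by (metis fun_upd_apply)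
    then show "p(i := p i + 1) \<in> ?B - {p. p i = a i}" using *(1)[of i] by simp
  qed simp_all
  show ?thesis
    using 1 2 3 by (simp add: sum_subtractf)
qed

text \<open>Discrete divergence theorem. The conservation arguments below reduce to it: for cells,
  for the box between two depths of a patch, and for a whole tile.\<close>

lemma sum_ibox_flow_div:
  "(\<Sum>p\<in>ibox a b. flow_div f p) =
     (\<Sum>i\<in>UNIV. (\<Sum>p\<in>ibox a b \<inter> {p. p i = b i - 1}. f (p, i)) -
        (\<Sum>p\<in>ibox a b \<inter> {p. p i = a i}. f (p(i := p i - 1), i)))"
  unfolding flow_div_def
  by (subst sum.swap) (intro sum.cong refl sum_ibox_diff)

text \<open>An interval grid partitions each coordinate axis into half-open integer intervals:
  \<open>{lo j x..<hi j x}\<close> is the part of the \<open>j\<close>-th axis that contains \<open>x\<close>.\<close>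

definition interval_grid :: "('d \<Rightarrow> int \<Rightarrow> int) \<Rightarrow> ('d \<Rightarrow> int \<Rightarrow> int) \<Rightarrow> bool" where
  "interval_grid lo hi \<longleftrightarrow> (\<forall>j x. lo j x \<le> x \<and> x < hi j x \<and>
     (\<forall>y. lo j x \<le> y \<and> y < hi j x \<longrightarrow> lo j y = lo j x \<and> hi j y = hi j x))"

definition cell :: "('d \<Rightarrow> int \<Rightarrow> int) \<Rightarrow> ('d \<Rightarrow> int \<Rightarrow> int) \<Rightarrow> ('d \<Rightarrow> int) \<Rightarrow> ('d \<Rightarrow> int) set" where
  "cell lo hi p = ibox (\<lambda>j. lo j (p j)) (\<lambda>j. hi j (p j))"

lemma interval_gridD:
  assumes "interval_grid lo hi"
  shows "lo j x \<le> x" "x < hi j x"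
    "lo j x \<le> y \<Longrightarrow> y < hi j x \<Longrightarrow> lo j y = lo j x"
    "lo j x \<le> y \<Longrightarrow> y < hi j x \<Longrightarrow> hi j y = hi j x"
  using assms unfolding interval_grid_def by blast+

lemma interval_grid_hi_prev:
  assumes "interval_grid lo hi" "lo j x = x"
  shows "hi j (x - 1) = x"
proof (rule ccontr)
  assume "hi j (x - 1) \<noteq> x"
  with interval_gridD(2)[OF assms(1), of "x - 1" j] have "x < hi j (x - 1)" by auto
  then have "lo j x = lo j (x - 1)"
    using interval_gridD(1)[OF assms(1), of j "x - 1"] by (intro interval_gridD(3)[OF assms(1)]) auto
  with interval_gridD(1)[OF assms(1), of j "x - 1"] assms(2) show False by simp
qed

lemma interval_grid_prev:
  assumes "interval_grid lo hi" "lo j x \<noteq> x"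
  shows "lo j (x - 1) = lo j x" "hi j (x - 1) = hi j x"
proof -
  have "lo j x \<le> x - 1" "x - 1 < hi j x"
    using interval_gridD(1,2)[OF assms(1), where j=j and x=x] assms(2) by linarith+
  then show "lo j (x - 1) = lo j x" "hi j (x - 1) = hi j x"
    by (rule interval_gridD(3,4)[OF assms(1)])+
qed

lemma cell_self: "interval_grid lo hi \<Longrightarrow> p \<in> cell lo hi p"
  by (auto simp: cell_def ibox_def interval_gridD)

lemma cell_eq:
  assumes "interval_grid lo hi" "q \<in> cell lo hi p"
  shows "cell lo hi q = cell lo hi p"
proof -
  have "lo j (p j) \<le> q j" "q j < hi j (p j)" for j
    using assms(2) by (simp_all add: cell_def ibox_def)
  then have "lo j (q j) = lo j (p j)" "hi j (q j) = hi j (p j)" for j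
    by (blast intro: interval_gridD(3,4)[OF assms(1)])+
  then show ?thesis by (simp add: cell_def)
qed

lemma finite_cell [simp]: "finite (cell lo hi (p :: 'd::finite \<Rightarrow> int))"
  by (simp add: cell_def)

text \<open>An edge that enters a cell through a lower face starts at the last point of the
  preceding interval. The hypothesis, stated for upper faces, therefore stops the flux through all
  faces.\<close>

lemma sum_cell_flow_div_internal:
  assumes "interval_grid lo hi"
    and "\<And>p j. \<psi> (p, j) \<noteq> 0 \<Longrightarrow> p j + 1 < hi j (p j)"
  shows "(\<Sum>q\<in>cell lo hi p. flow_div \<psi> q) = 0"
proof -
  have A: "\<psi> (q, i) = 0" if "q i = hi i (p i) - 1" for q i
  proof -
    have "hi i (q i) = hi i (p i)"
      using interval_gridD(1,2)[OF assms(1), where j=i and x="p i"] that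
      by (intro interval_gridD(4)[OF assms(1)]) auto
    then show ?thesis using assms(2)[of q i] that by force
  qed
  have B: "\<psi> (q(i := q i - 1), i) = 0" if "q i = lo i (p i)" for q i
  proof (rule ccontr)
    assume nz: "\<psi> (q(i := q i - 1), i) \<noteq> 0"
    have "lo i (lo i (p i)) = lo i (p i)"
      using interval_gridD(1,2)[OF assms(1), where j=i and x="p i"]
      by (intro interval_gridD(3)[OF assms(1)]) auto
    then have "hi i (q i - 1) = q i"
      using interval_grid_hi_prev[OF assms(1), of i "q i"] that by simp
    with assms(2)[OF nz] show False by simp
  qed
  show ?thesis
    unfolding cell_def sum_ibox_flow_div
  proof (intro sum.neutral ballI)
    fix i
    have "(\<Sum>q\<in>ibox (\<lambda>j. lo j (p j)) (\<lambda>j. hi j (p j)) \<inter> {q. q i = hi i (p i) - 1}. \<psi> (q, i)) = 0"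
      by (intro sum.neutral ballI A) simp
    moreover have "(\<Sum>q\<in>ibox (\<lambda>j. lo j (p j)) (\<lambda>j. hi j (p j)) \<inter> {q. q i = lo i (p i)}. \<psi> (q(i := q i - 1), i)) = 0"
      by (intro sum.neutral ballI B) simp
    ultimately show "(\<Sum>q\<in>ibox (\<lambda>j. lo j (p j)) (\<lambda>j. hi j (p j)) \<inter> {q. q i = hi i (p i) - 1}. \<psi> (q, i)) -
      (\<Sum>q\<in>ibox (\<lambda>j. lo j (p j)) (\<lambda>j. hi j (p j)) \<inter> {q. q i = lo i (p i)}. \<psi> (q(i := q i - 1), i)) = 0"
      by simp
  qed
qed

section \<open>Averaging and collecting charge by a flow\<close>

text \<open>The flow is the running sum of \<open>\<rho> - \<rho>'\<close> along each interval.
  Since \<open>\<rho>'\<close> is the mean, the sum returns to 0 at the last point and nothing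
  crosses into the next interval; the load is at most the number of terms times
  \<open>2 * r\<close>.\<close>

lemma average_along_axis:
  fixes \<rho> :: "('d::finite \<Rightarrow> int) \<Rightarrow> real"
  assumes grid: "interval_grid lo hi"
    and bound: "\<And>p. \<bar>\<rho> p\<bar> \<le> r"
    and width: "\<And>x. real_of_int (hi i x - lo i x) \<le> wd"
  obtains \<psi> \<rho>' where
    "\<And>p. flow_div \<psi> p = \<rho> p - \<rho>' p"
    "\<And>p. \<bar>\<rho>' p\<bar> \<le> r"
    "\<And>p. \<bar>\<psi> (p, i)\<bar> \<le> 2 * r * wd"
    "\<And>p j. \<psi> (p, j) \<noteq> 0 \<Longrightarrow> j = i \<and> p i + 1 < hi i (p i) \<and> (\<exists>k. lo i (p i) \<le> k \<and> k < hi i (p i) \<and> \<rho> (p(i := k)) \<noteq> 0)"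
    "\<And>p. \<rho>' p \<noteq> 0 \<Longrightarrow> \<exists>k. lo i (p i) \<le> k \<and> k < hi i (p i) \<and> \<rho> (p(i := k)) \<noteq> 0"
    "\<And>p. \<rho>' p = (\<Sum>k\<in>{lo i (p i)..<hi i (p i)}. \<rho> (p(i := k))) / real_of_int (hi i (p i) - lo i (p i))"
proof -
  note G = interval_gridD[OF grid, where j=i]
  define len where "len p = real_of_int (hi i (p i) - lo i (p i))" for p :: "'d \<Rightarrow> int"
  define \<rho>' where "\<rho>' p = (\<Sum>k\<in>{lo i (p i)..<hi i (p i)}. \<rho> (p(i := k))) / len p" for p
  define \<psi> where "\<psi> e = (case e of (p, j) \<Rightarrow>
     if j = i then \<Sum>k\<in>{lo i (p i)..p i}. \<rho> (p(i := k)) - \<rho>' p else 0)" for e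
  have len_pos: "len p > 0" for p
    unfolding len_def using G(1,2)[of "p i"] by simp
  have r0: "r \<ge> 0" using bound[of undefined] by simp
  have card: "real (card {lo i (p i)..<hi i (p i)}) = len p" for p
    unfolding len_def using G(1,2)[of "p i"] by simp
  have rho': "\<bar>\<rho>' p\<bar> \<le> r" for p
  proof -
    have "\<bar>\<Sum>k\<in>{lo i (p i)..<hi i (p i)}. \<rho> (p(i := k))\<bar> \<le> (\<Sum>k\<in>{lo i (p i)..<hi i (p i)}. r)"
      by (rule order_trans[OF sum_abs]) (intro sum_mono bound)
    also have "\<dots> = len p * r" by (simp add: card del: card_atLeastLessThan_int)
    finally show ?thesis using len_pos[of p] by (simp add: \<rho>'_def field_simps)
  qed
  have psi_bound: "\<bar>\<psi> (p, i)\<bar> \<le> 2 * r * wd" for p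
  proof -
    have "\<bar>\<psi> (p, i)\<bar> \<le> (\<Sum>k\<in>{lo i (p i)..p i}. \<bar>\<rho> (p(i := k)) - \<rho>' p\<bar>)"
      by (simp add: \<psi>_def)
    also have "\<dots> \<le> (\<Sum>k\<in>{lo i (p i)..p i}. 2 * r)"
    proof (intro sum_mono)
      fix k show "\<bar>\<rho> (p(i := k)) - \<rho>' p\<bar> \<le> 2 * r"
        using bound[of "p(i := k)"] rho'[of p] by linarith
    qed
    also have "\<dots> = real (card {lo i (p i)..p i}) * (2 * r)" by simp
    also have "\<dots> \<le> wd * (2 * r)"
    proof (intro mult_right_mono)
      show "real (card {lo i (p i)..p i}) \<le> wd"
        using width[of "p i"] G(1,2)[of "p i"] by simp
    qed (use r0 in auto)
    finally show ?thesis by (simp add: mult_ac)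
  qed
  have upd: "\<rho>' (p(i := k)) = \<rho>' p" if "lo i (p i) \<le> k" "k < hi i (p i)" for p k
    using G(3,4)[OF that] by (simp add: \<rho>'_def len_def)
  have top: "\<psi> (p, i) = 0" if "hi i (p i) = p i + 1" for p
  proof -
    have eq: "{lo i (p i)..p i} = {lo i (p i)..<hi i (p i)}" using that by auto
    have "\<psi> (p, i) = (\<Sum>k\<in>{lo i (p i)..<hi i (p i)}. \<rho> (p(i := k))) - real (card {lo i (p i)..<hi i (p i)}) * \<rho>' p"
      by (simp add: \<psi>_def eq sum_subtractf del: card_atLeastLessThan_int)
    also have "\<dots> = 0" unfolding card using len_pos[of p] by (simp add: \<rho>'_def)
    finally show ?thesis .
  qed
  have div: "flow_div \<psi> p = \<rho> p - \<rho>' p" for p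
  proof -
    have "flow_div \<psi> p = (\<Sum>j\<in>UNIV. if j = i then \<psi> (p, i) - \<psi> (p(i := p i - 1), i) else 0)"
      unfolding flow_div_def by (intro sum.cong) (auto simp: \<psi>_def)
    also have "\<dots> = \<psi> (p, i) - \<psi> (p(i := p i - 1), i)" by simp
    also have "\<dots> = \<rho> p - \<rho>' p"
    proof (cases "lo i (p i) = p i")
      case True
      have "\<psi> (p(i := p i - 1), i) = 0"
        by (rule top) (simp add: interval_grid_hi_prev[OF grid True])
      moreover have "\<psi> (p, i) = \<rho> p - \<rho>' p" by (simp add: \<psi>_def True)
      ultimately show ?thesis by simp
    next
      case False
      note prev = interval_grid_prev[OF grid False]
      have "\<rho>' (p(i := p i - 1)) = \<rho>' p" using upd[of p "p i - 1"] G(1,2)[of "p i"] False by simp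
      moreover have "{lo i (p i)..p i} = insert (p i) {lo i (p i)..p i - 1}"
        using G(1)[of "p i"] by auto
      ultimately show ?thesis by (simp add: \<psi>_def prev)
    qed
    finally show ?thesis .
  qed
  have supp': "\<exists>k. lo i (p i) \<le> k \<and> k < hi i (p i) \<and> \<rho> (p(i := k)) \<noteq> 0" if "\<rho>' p \<noteq> 0" for p
  proof (rule ccontr)
    assume "\<not> ?thesis"
    then have "(\<Sum>k\<in>{lo i (p i)..<hi i (p i)}. \<rho> (p(i := k))) = 0" by (intro sum.neutral) auto
    with that show False by (simp add: \<rho>'_def)
  qed
  have supp: "j = i \<and> p i + 1 < hi i (p i) \<and> (\<exists>k. lo i (p i) \<le> k \<and> k < hi i (p i) \<and> \<rho> (p(i := k)) \<noteq> 0)"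
    if nz: "\<psi> (p, j) \<noteq> 0" for p j
  proof -
    have j: "j = i" using nz by (auto simp: \<psi>_def split: if_splits)
    moreover have "hi i (p i) \<noteq> p i + 1" using top[of p] nz j by auto
    with G(2)[of "p i"] have "p i + 1 < hi i (p i)" by linarith
    moreover have "\<exists>k. lo i (p i) \<le> k \<and> k < hi i (p i) \<and> \<rho> (p(i := k)) \<noteq> 0"
    proof (rule ccontr)
      assume n: "\<not> ?thesis"
      then have "\<rho>' p = 0" using supp' by blast
      then have "\<psi> (p, i) = 0"
        using n G(2)[of "p i"] by (auto simp: \<psi>_def intro!: sum.neutral)
      with nz j show False by simp
    qed
    ultimately show ?thesis by blast
  qed
  show ?thesis
  proof (rule that[of \<psi> \<rho>'])
    fix p
    show "flow_div \<psi> p = \<rho> p - \<rho>' p" by (rule div)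
    show "\<bar>\<rho>' p\<bar> \<le> r" by (rule rho')
    show "\<bar>\<psi> (p, i)\<bar> \<le> 2 * r * wd" by (rule psi_bound)
    show "\<exists>k. lo i (p i) \<le> k \<and> k < hi i (p i) \<and> \<rho> (p(i := k)) \<noteq> 0" if "\<rho>' p \<noteq> 0"
      using that by (rule supp')
    show "\<rho>' p = (\<Sum>k\<in>{lo i (p i)..<hi i (p i)}. \<rho> (p(i := k))) / real_of_int (hi i (p i) - lo i (p i))"
      by (simp add: \<rho>'_def len_def)
    show "j = i \<and> p i + 1 < hi i (p i) \<and> (\<exists>k. lo i (p i) \<le> k \<and> k < hi i (p i) \<and> \<rho> (p(i := k)) \<noteq> 0)"
      if "\<psi> (p, j) \<noteq> 0" for j
      using that by (rule supp)
  qed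
qed

text \<open>The coordinates are averaged one after another. Stage \<open>i\<close> uses only edges
  in direction \<open>i\<close>, so an edge is loaded in one stage and the bound does not grow with
  the dimension. Directions treated earlier stay averaged, since averaging along another axis
  commutes with a change of their coordinate.\<close>

lemma grid_averaging:
  fixes \<rho> :: "('d::finite \<Rightarrow> int) \<Rightarrow> real"
  assumes grid: "interval_grid lo hi"
    and bound: "\<And>p. \<bar>\<rho> p\<bar> \<le> r"
    and width: "\<And>j x. real_of_int (hi j x - lo j x) \<le> wd"
  obtains \<psi> where
    "\<And>p. flow_div \<psi> p = \<rho> p - (\<Sum>q\<in>cell lo hi p. \<rho> q) / card (cell lo hi p)"
    "\<And>e. \<bar>\<psi> e\<bar> \<le> 2 * r * wd"
    "\<And>p j. \<psi> (p, j) \<noteq> 0 \<Longrightarrow> p j + 1 < hi j (p j) \<and> (\<exists>q\<in>cell lo hi p. \<rho> q \<noteq> 0)"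
proof -
  let ?c = "cell lo hi"
  have cell_upd: "p(i := k) \<in> ?c p" if "lo i (p i) \<le> k" "k < hi i (p i)" for p i k
    using that interval_gridD(1,2)[OF grid] by (simp add: cell_def ibox_def)
  have r0: "r \<ge> 0" using bound[of undefined] by simp
  have wd0: "wd \<ge> 0" using width[of undefined 0] interval_gridD(1,2)[OF grid, where j=undefined and x=0] by linarith
  \<comment> \<open>Invariant after the directions in \<open>S\<close>: the flow lives on edges in
    these directions, and the remaining charge \<open>\<rho>'\<close> is constant along them within
    each interval.\<close>
  define Q where "Q S \<psi> \<rho>' \<longleftrightarrow> (\<forall>p. flow_div \<psi> p = \<rho> p - \<rho>' p) \<and> (\<forall>p j. \<bar>\<psi> (p, j)\<bar> \<le> 2 * r * wd)
     \<and> (\<forall>p j. \<psi> (p, j) \<noteq> 0 \<longrightarrow> j \<in> S \<and> p j + 1 < hi j (p j) \<and> (\<exists>q\<in>?c p. \<rho> q \<noteq> 0))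
     \<and> (\<forall>p. \<bar>\<rho>' p\<bar> \<le> r) \<and> (\<forall>p. \<rho>' p \<noteq> 0 \<longrightarrow> (\<exists>q\<in>?c p. \<rho> q \<noteq> 0))
     \<and> (\<forall>p. \<forall>j\<in>S. \<forall>k. lo j (p j) \<le> k \<and> k < hi j (p j) \<longrightarrow> \<rho>' (p(j := k)) = \<rho>' p)" for S :: "'d set" and \<psi> \<rho>'
  have "\<exists>\<psi> \<rho>'. Q S \<psi> \<rho>'" for S :: "'d set"
  proof (induction S rule: infinite_finite_induct)
    case (infinite A)
    then show ?case by (simp add: finite_class.finite)
  next
    case empty
    show ?case
      using bound r0 wd0 cell_self[OF grid]
      by (intro exI[of _ "\<lambda>_. 0"] exI[of _ \<rho>]) (auto simp: flow_div_def Q_def)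
  next
    case (insert i S)
    then obtain \<psi>1 \<rho>1 where Q1: "Q S \<psi>1 \<rho>1" by blast
    have d1: "\<And>p. flow_div \<psi>1 p = \<rho> p - \<rho>1 p" and b1: "\<And>p j. \<bar>\<psi>1 (p, j)\<bar> \<le> 2 * r * wd"
      and s1: "\<And>p j. \<psi>1 (p, j) \<noteq> 0 \<Longrightarrow> j \<in> S \<and> p j + 1 < hi j (p j) \<and> (\<exists>q\<in>?c p. \<rho> q \<noteq> 0)"
      and r1: "\<And>p. \<bar>\<rho>1 p\<bar> \<le> r" and t1: "\<And>p. \<rho>1 p \<noteq> 0 \<Longrightarrow> \<exists>q\<in>?c p. \<rho> q \<noteq> 0"
      and c1: "\<And>p j k. j \<in> S \<Longrightarrow> lo j (p j) \<le> k \<Longrightarrow> k < hi j (p j) \<Longrightarrow> \<rho>1 (p(j := k)) = \<rho>1 p"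
      using Q1 unfolding Q_def by blast+
    obtain \<psi>2 \<rho>2 where
      d2: "\<And>p. flow_div \<psi>2 p = \<rho>1 p - \<rho>2 p" and r2: "\<And>p. \<bar>\<rho>2 p\<bar> \<le> r"
      and b2: "\<And>p. \<bar>\<psi>2 (p, i)\<bar> \<le> 2 * r * wd"
      and s2: "\<And>p j. \<psi>2 (p, j) \<noteq> 0 \<Longrightarrow> j = i \<and> p i + 1 < hi i (p i) \<and>
          (\<exists>k. lo i (p i) \<le> k \<and> k < hi i (p i) \<and> \<rho>1 (p(i := k)) \<noteq> 0)"
      and t2: "\<And>p. \<rho>2 p \<noteq> 0 \<Longrightarrow> \<exists>k. lo i (p i) \<le> k \<and> k < hi i (p i) \<and> \<rho>1 (p(i := k)) \<noteq> 0"
      and e2: "\<And>p. \<rho>2 p = (\<Sum>k\<in>{lo i (p i)..<hi i (p i)}. \<rho>1 (p(i := k))) / real_of_int (hi i (p i) - lo i (p i))"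
      by (rule average_along_axis[where i=i and \<rho>=\<rho>1 and r=r and wd=wd, OF grid r1 width]) (rule that)
    have t: "\<exists>q\<in>?c p. \<rho> q \<noteq> 0" if ex: "\<exists>k. lo i (p i) \<le> k \<and> k < hi i (p i) \<and> \<rho>1 (p(i := k)) \<noteq> 0" for p
    proof -
      obtain k where k: "lo i (p i) \<le> k" "k < hi i (p i)" "\<rho>1 (p(i := k)) \<noteq> 0" using ex by blast
      have "?c (p(i := k)) = ?c p" by (rule cell_eq[OF grid cell_upd]) (rule k(1,2))+
      with t1[OF k(3)] show ?thesis by simp
    qed
    have sup: "j \<in> insert i S \<and> p j + 1 < hi j (p j) \<and> (\<exists>q\<in>?c p. \<rho> q \<noteq> 0)"
      if "\<psi>1 (p, j) + \<psi>2 (p, j) \<noteq> 0" for p j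
    proof (cases "\<psi>1 (p, j) = 0")
      case True
      then have "\<psi>2 (p, j) \<noteq> 0" using that by simp
      from s2[OF this] show ?thesis using t[of p] by auto
    next
      case False
      from s1[OF this] show ?thesis by auto
    qed
    have bd: "\<bar>\<psi>1 (p, j) + \<psi>2 (p, j)\<bar> \<le> 2 * r * wd" for p j
    proof (cases "j = i")
      case True
      then have "\<psi>1 (p, j) = 0" using s1[of p j] insert by blast
      then show ?thesis using b2 True by simp
    next
      case False
      then have "\<psi>2 (p, j) = 0" using s2[of p j] by blast
      then show ?thesis using b1 by simp
    qed
    have const: "\<rho>2 (p(j := k)) = \<rho>2 p" if "j \<in> insert i S" "lo j (p j) \<le> k" "k < hi j (p j)" for p j k
    proof (cases "j = i")
      case True
      then show ?thesis using that interval_gridD(3,4)[OF grid that(2,3)] by (simp add: e2)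
    next
      case False
      then have "j \<in> S" using that by simp
      have "\<rho>1 ((p(j := k))(i := k')) = \<rho>1 (p(i := k'))" for k'
        using c1[OF \<open>j \<in> S\<close>, of "p(i := k')" k] that(2,3) False by (simp add: fun_upd_twist)
      then show ?thesis using False by (simp add: e2)
    qed
    show ?case
      by (rule exI[of _ "\<lambda>e. \<psi>1 e + \<psi>2 e"], rule exI[of _ \<rho>2])
         (unfold Q_def flow_div_add d1 d2, use sup bd const r2 t t2 in \<open>simp; blast\<close>)
  qed
  from this[of UNIV] obtain \<psi> \<rho>' where Q: "Q UNIV \<psi> \<rho>'" by blast
  have d: "\<And>p. flow_div \<psi> p = \<rho> p - \<rho>' p" and b: "\<And>p j. \<bar>\<psi> (p, j)\<bar> \<le> 2 * r * wd"
    and s: "\<And>p j. \<psi> (p, j) \<noteq> 0 \<Longrightarrow> p j + 1 < hi j (p j) \<and> (\<exists>q\<in>?c p. \<rho> q \<noteq> 0)"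
    and c: "\<And>p j k. lo j (p j) \<le> k \<Longrightarrow> k < hi j (p j) \<Longrightarrow> \<rho>' (p(j := k)) = \<rho>' p"
    using Q unfolding Q_def by blast+
  have const: "\<rho>' q = \<rho>' p" if q: "q \<in> ?c p" for p q
  proof -
    \<comment> \<open>Pass from \<open>p\<close> to \<open>q\<close> one coordinate at a time; each
      change stays within one interval.\<close>
    have "\<rho>' (\<lambda>j. if j \<in> S then q j else p j) = \<rho>' p" for S :: "'d set"
    proof (induction S rule: infinite_finite_induct)
      case (infinite A)
      then show ?case by (simp add: finite_class.finite)
    next
      case (insert i S)
      have "(\<lambda>j. if j \<in> insert i S then q j else p j) = (\<lambda>j. if j \<in> S then q j else p j)(i := q i)"
        by auto
      moreover have "lo i (p i) \<le> q i" "q i < hi i (p i)" using q by (auto simp: cell_def ibox_def)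
      ultimately show ?case using insert c[of i "\<lambda>j. if j \<in> S then q j else p j" "q i"] by simp
    qed auto
    from this[of UNIV] show ?thesis by simp
  qed
  \<comment> \<open>The flow does not leave the cell, so the total charge of the cell is unchanged;
    the constant with that total is the mean.\<close>
  have avg: "\<rho>' p = (\<Sum>q\<in>?c p. \<rho> q) / card (?c p)" for p
  proof -
    have "(\<Sum>q\<in>?c p. flow_div \<psi> q) = 0"
      using sum_cell_flow_div_internal[OF grid] s by blast
    then have "(\<Sum>q\<in>?c p. \<rho> q) = (\<Sum>q\<in>?c p. \<rho>' q)" by (simp add: d sum_subtractf)
    also have "\<dots> = (\<Sum>q\<in>?c p. \<rho>' p)" by (intro sum.cong refl const)
    finally show ?thesis using cell_self[OF grid, of p] by (auto simp: card_eq_0_iff)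
  qed
  show ?thesis
    by (rule that[of \<psi>]) (use s b in \<open>auto simp: d avg\<close>)
qed

lemma ibox_mono: "(\<And>j. a' j \<le> a j) \<Longrightarrow> (\<And>j. b j \<le> b' j) \<Longrightarrow> ibox a b \<subseteq> ibox a' b'"
  unfolding ibox_def by (blast intro: order.trans order.strict_trans2)

text \<open>To spread the charge of a box evenly over \<open>Z\<close> is to remove the neutral
  charge \<open>\<rho> - c * indicator Z\<close>, whose average over the box is 0.\<close>

lemma box_dump:
  fixes \<rho> :: "('d::finite \<Rightarrow> int) \<Rightarrow> real"
  assumes supp: "\<And>p. \<rho> p \<noteq> 0 \<Longrightarrow> p \<in> ibox A B"
    and bound: "\<And>p. \<bar>\<rho> p\<bar> \<le> r"
    and Z: "Z \<subseteq> ibox A B" "Z \<noteq> {}"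
    and width: "\<And>j. real_of_int (B j - A j) \<le> wd" and "wd \<ge> 1"
    and c: "c = (\<Sum>p\<in>ibox A B. \<rho> p) / card Z"
  obtains \<psi> where
    "\<And>p. flow_div \<psi> p = \<rho> p - c * indicator Z p"
    "\<And>e. \<bar>\<psi> e\<bar> \<le> 2 * (r + \<bar>c\<bar>) * wd"
    "\<And>p j. \<psi> (p, j) \<noteq> 0 \<Longrightarrow> p \<in> ibox A B \<and> p j + 1 < B j"
proof -
  \<comment> \<open>One long interval per axis and unit intervals elsewhere. The box is a single
    cell; any other cell has a coordinate outside the box, hence carries no charge.\<close>
  define lo where "lo j x = (if A j \<le> x \<and> x < B j then A j else x)" for j x
  define hi where "hi j x = (if A j \<le> x \<and> x < B j then B j else x + 1)" for j x
  have grid: "interval_grid lo hi"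
    by (auto simp: interval_grid_def lo_def hi_def)
  define \<sigma> where "\<sigma> p = \<rho> p - c * indicator Z p" for p
  have fZ: "finite Z" by (rule finite_subset[OF Z(1)]) simp
  have in_box: "p \<in> ibox A B" if "q \<in> cell lo hi p" "q \<in> ibox A B" for p q
  proof -
    have "A j \<le> p j \<and> p j < B j" for j
    proof -
      have "lo j (p j) \<le> q j" "q j < hi j (p j)" "A j \<le> q j" "q j < B j"
        using that by (simp_all add: cell_def ibox_def)
      then show ?thesis by (auto simp: lo_def hi_def split: if_splits)
    qed
    then show ?thesis by (simp add: ibox_def)
  qed
  have s: "q \<in> ibox A B" if "\<sigma> q \<noteq> 0" for q
    using that supp[of q] Z(1) by (cases "q \<in> Z") (auto simp: \<sigma>_def)
  have bd: "\<bar>\<sigma> p\<bar> \<le> r + \<bar>c\<bar>" for p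
    using bound[of p] by (auto simp: \<sigma>_def indicator_def)
  have zero: "(\<Sum>q\<in>cell lo hi p. \<sigma> q) = 0" for p
  proof (cases "p \<in> ibox A B")
    case True
    then have eq: "cell lo hi p = ibox A B"
      by (auto simp: cell_def ibox_def lo_def hi_def)
    have "(\<Sum>q\<in>ibox A B. \<sigma> q) = (\<Sum>q\<in>ibox A B. \<rho> q) - c * (\<Sum>q\<in>ibox A B. indicator Z q)"
      by (simp add: \<sigma>_def sum_subtractf sum_distrib_left)
    also have "(\<Sum>q\<in>ibox A B. indicator Z q :: real) = card Z"
      using Z(1) by (simp add: indicator_def sum.If_cases inf.absorb2)
    finally show ?thesis using Z(2) fZ by (simp add: eq c)
  next
    case False
    then show ?thesis using in_box s by (metis (no_types, lifting) sum.neutral)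
  qed
  obtain \<psi> where \<psi>: "\<And>p. flow_div \<psi> p = \<sigma> p - (\<Sum>q\<in>cell lo hi p. \<sigma> q) / card (cell lo hi p)"
    "\<And>e. \<bar>\<psi> e\<bar> \<le> 2 * (r + \<bar>c\<bar>) * wd"
    "\<And>p j. \<psi> (p, j) \<noteq> 0 \<Longrightarrow> p j + 1 < hi j (p j) \<and> (\<exists>q\<in>cell lo hi p. \<sigma> q \<noteq> 0)"
    by (rule grid_averaging[where \<rho>=\<sigma> and r="r + \<bar>c\<bar>" and wd=wd, OF grid bd]) (use width \<open>wd \<ge> 1\<close> in \<open>auto simp: lo_def hi_def\<close>)
  show ?thesis
  proof (rule that[of \<psi>])
    show "flow_div \<psi> p = \<rho> p - c * indicator Z p" for p by (simp add: \<psi>(1) zero) (simp add: \<sigma>_def)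
    show "\<bar>\<psi> e\<bar> \<le> 2 * (r + \<bar>c\<bar>) * wd" for e by (rule \<psi>)
    show "p \<in> ibox A B \<and> p j + 1 < B j" if "\<psi> (p, j) \<noteq> 0" for p j
      using \<psi>(3)[OF that] s in_box[of _ p] by (auto simp: hi_def ibox_def split: if_splits)
  qed
qed

section \<open>Transport inside the shell of a tile\<close>

text \<open>The edges with at least one end in \<open>cube w\<close>; the level -1 admits those that
  enter through a lower face. The node law on the cube involves exactly these edges.\<close>

definition core_edges :: "int \<Rightarrow> (('d \<Rightarrow> int) \<times> 'd) set" where
  "core_edges w = {(p, i). - 1 \<le> p i \<and> p i < w \<and> (\<forall>j. j \<noteq> i \<longrightarrow> 0 \<le> p j \<and> p j < w)}"

definition cube :: "int \<Rightarrow> ('d \<Rightarrow> int) set" where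
  "cube w = ibox (\<lambda>_. 0) (\<lambda>_. w)"

definition tile :: "int \<Rightarrow> int \<Rightarrow> ('d \<Rightarrow> int) set" where
  "tile w l = ibox (\<lambda>_. - l) (\<lambda>_. w + l)"

text \<open>Both ends lie in the tile and neither lies in the core. Transport along these edges
  changes neither the given flow in the core nor the prescribed values across the boundary of the
  tile.\<close>

definition shell_edges :: "int \<Rightarrow> int \<Rightarrow> (('d \<Rightarrow> int) \<times> 'd) set" where
  "shell_edges w l = {(p, i). p \<in> tile w l \<and> p i + 1 < w + l} - core_edges w"

text \<open>Hiding the flow behind an existence statement lets transports of separate charges be
  added together with their bounds, however they overlap.\<close>

definition shell_transport :: "int \<Rightarrow> int \<Rightarrow> (('d::finite \<Rightarrow> int) \<Rightarrow> real) \<Rightarrow> real \<Rightarrow> bool" where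
  "shell_transport w l \<rho> b \<longleftrightarrow> (\<exists>\<psi>. (\<forall>p. flow_div \<psi> p = \<rho> p) \<and> (\<forall>e. \<bar>\<psi> e\<bar> \<le> b) \<and>
     (\<forall>e. \<psi> e \<noteq> 0 \<longrightarrow> e \<in> shell_edges w l))"

lemma shell_transport_add:
  assumes "shell_transport w l \<rho> b" "shell_transport w l \<rho>' b'"
  shows "shell_transport w l (\<lambda>p. \<rho> p + \<rho>' p) (b + b')"
proof -
  obtain \<psi> \<psi>' where *: "\<forall>p. flow_div \<psi> p = \<rho> p" "\<forall>e. \<bar>\<psi> e\<bar> \<le> b" "\<forall>e. \<psi> e \<noteq> 0 \<longrightarrow> e \<in> shell_edges w l"
    "\<forall>p. flow_div \<psi>' p = \<rho>' p" "\<forall>e. \<bar>\<psi>' e\<bar> \<le> b'" "\<forall>e. \<psi>' e \<noteq> 0 \<longrightarrow> e \<in> shell_edges w l"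
    using assms unfolding shell_transport_def by metis
  have "\<bar>\<psi> e + \<psi>' e\<bar> \<le> b + b'" for e
    using *(2,5)[rule_format, of e] by linarith
  moreover have "e \<in> shell_edges w l" if "\<psi> e + \<psi>' e \<noteq> 0" for e
    using *(3,6)[rule_format, of e] that by (cases "\<psi> e = 0") auto
  ultimately show ?thesis
    unfolding shell_transport_def
    by (intro exI[of _ "\<lambda>e. \<psi> e + \<psi>' e"]) (simp add: flow_div_add *(1,4))
qed

lemma shell_transport_sum:
  assumes "finite S" "\<And>x. x \<in> S \<Longrightarrow> shell_transport w l (\<rho> x) (b x)"
  shows "shell_transport w l (\<lambda>p. \<Sum>x\<in>S. \<rho> x p) (\<Sum>x\<in>S. b x)"
  using assms
proof (induction S)
  case empty
  show ?case unfolding shell_transport_def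
    by (intro exI[of _ "\<lambda>_. 0"]) (simp add: flow_div_def)
next
  case (insert x S)
  then show ?case by (simp add: shell_transport_add)
qed

lemma shell_transport_mono:
  "shell_transport w l \<rho> b \<Longrightarrow> b \<le> b' \<Longrightarrow> shell_transport w l \<rho> b'"
  unfolding shell_transport_def by (meson order.trans)

text \<open>The part of the tile beyond the upper (\<open>s\<close>) or lower face of the core in
  direction \<open>i\<close>. It is a full box without core points, so \<open>box_dump\<close> may
  move charge inside it.\<close>

definition slab :: "int \<Rightarrow> int \<Rightarrow> 'd \<Rightarrow> bool \<Rightarrow> ('d \<Rightarrow> int) set" where
  "slab w l i s = ibox (\<lambda>j. if j = i \<and> s then w else - l) (\<lambda>j. if j = i \<and> \<not> s then 0 else w + l)"

text \<open>For \<open>s\<close> the corner does not depend on \<open>i\<close>. For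
  \<open>\<not> s\<close> it is the mirror image in direction \<open>i\<close>: a stopover that lies
  in the lower slab of \<open>i\<close> and also in the upper slab of every other direction.\<close>

definition corner :: "int \<Rightarrow> int \<Rightarrow> 'd \<Rightarrow> bool \<Rightarrow> ('d \<Rightarrow> int) set" where
  "corner w l i s = ibox (\<lambda>j. if j = i \<and> \<not> s then - l else w) (\<lambda>j. if j = i \<and> \<not> s then 0 else w + l)"

text \<open>\<open>\<kappa>\<close> bounds the volume of a slab divided by that of a corner, hence
  the growth of the density under collection: a slab lies in a cube of side
  \<open>w + 2 * l\<close>, and a corner has side \<open>l\<close>.\<close>

lemma slab_dump:
  fixes \<rho> :: "('d::finite \<Rightarrow> int) \<Rightarrow> real"
  assumes "w \<ge> 1" "l \<ge> 1"
    and supp: "\<And>p. \<rho> p \<noteq> 0 \<Longrightarrow> p \<in> slab w l i s"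
    and bound: "\<And>p. \<bar>\<rho> p\<bar> \<le> r"
    and sub: "corner w l j s' \<subseteq> slab w l i s"
    and kappa: "\<kappa> = (real_of_int (w + 2 * l) / l) ^ CARD('d)"
  obtains c where "\<bar>c\<bar> \<le> r * \<kappa>"
    "shell_transport w l (\<lambda>p. \<rho> p - c * indicator (corner w l j s') p) (2 * (r + r * \<kappa>) * (w + 2 * l))"
proof -
  define c where "c = (\<Sum>p\<in>slab w l i s. \<rho> p) / card (corner w l j s')"
  have cc: "card (corner w l j s') = nat l ^ CARD('d)"
    unfolding corner_def card_ibox by (subst prod.cong[OF refl, of _ _ "\<lambda>_. nat l"]) auto
  have cs: "card (slab w l i s) \<le> nat (w + 2 * l) ^ CARD('d)"
  proof -
    have "card (slab w l i s) \<le> (\<Prod>i\<in>(UNIV::'d set). nat (w + 2 * l))"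
      unfolding slab_def card_ibox using \<open>w \<ge> 1\<close> \<open>l \<ge> 1\<close> by (intro prod_mono) auto
    then show ?thesis by simp
  qed
  have r0: "r \<ge> 0" using bound[of undefined] by simp
  have fs: "finite (slab w l i s)" by (simp add: slab_def)
  have ne: "corner w l j s' \<noteq> {}"
  proof -
    have "(\<lambda>k. if k = j \<and> \<not> s' then - l else w) \<in> corner w l j s'"
      using \<open>w \<ge> 1\<close> \<open>l \<ge> 1\<close> by (auto simp: corner_def ibox_def)
    then show ?thesis by blast
  qed
  have "\<bar>\<Sum>p\<in>slab w l i s. \<rho> p\<bar> \<le> (\<Sum>p\<in>slab w l i s. r)"
    by (rule order_trans[OF sum_abs]) (intro sum_mono bound)
  also have "\<dots> = card (slab w l i s) * r" by simp
  also have "\<dots> \<le> real (nat (w + 2 * l) ^ CARD('d)) * r"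
    using cs r0 by (intro mult_right_mono) (simp_all only: of_nat_le_iff)
  also have "\<dots> = real_of_int (w + 2 * l) ^ CARD('d) * r" using \<open>w \<ge> 1\<close> \<open>l \<ge> 1\<close> by simp
  finally have "\<bar>\<Sum>p\<in>slab w l i s. \<rho> p\<bar> \<le> real_of_int (w + 2 * l) ^ CARD('d) * r" .
  then have c_le: "\<bar>c\<bar> \<le> r * \<kappa>"
    using \<open>l \<ge> 1\<close> by (simp add: c_def cc kappa power_divide divide_right_mono mult.commute)
  have wd: "real_of_int ((if k = i \<and> \<not> s then 0 else w + l) - (if k = i \<and> s then w else - l)) \<le> real_of_int (w + 2 * l)" for k
    using \<open>w \<ge> 1\<close> \<open>l \<ge> 1\<close> by auto
  obtain \<psi> where \<psi>: "\<And>p. flow_div \<psi> p = \<rho> p - c * indicator (corner w l j s') p"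
    "\<And>e. \<bar>\<psi> e\<bar> \<le> 2 * (r + \<bar>c\<bar>) * real_of_int (w + 2 * l)"
    "\<And>p k. \<psi> (p, k) \<noteq> 0 \<Longrightarrow> p \<in> slab w l i s \<and> p k + 1 < (if k = i \<and> \<not> s then 0 else w + l)"
    by (rule box_dump[where \<rho>=\<rho> and r=r, OF supp[unfolded slab_def] bound sub[unfolded slab_def] ne wd _ c_def[unfolded slab_def]])
       (use \<open>w \<ge> 1\<close> \<open>l \<ge> 1\<close> in \<open>auto simp: slab_def\<close>)
  have shell: "e \<in> shell_edges w l" if nz: "\<psi> e \<noteq> 0" for e
  proof -
    obtain p k where e: "e = (p, k)" by force
    have p: "p \<in> slab w l i s" and k: "p k + 1 < (if k = i \<and> \<not> s then 0 else w + l)"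
      using \<psi>(3)[of p k] nz e by auto
    have "p \<in> tile w l"
    proof -
      have "slab w l i s \<subseteq> tile w l"
        using \<open>w \<ge> 1\<close> \<open>l \<ge> 1\<close> unfolding slab_def tile_def by (intro ibox_mono) auto
      with p show ?thesis by blast
    qed
    moreover have "p k + 1 < w + l" using k \<open>w \<ge> 1\<close> \<open>l \<ge> 1\<close> by (auto split: if_splits)
    moreover have "(p, k) \<notin> core_edges w"
    proof
      assume core: "(p, k) \<in> core_edges w"
      show False
      proof (cases s)
        case True
        with p[unfolded slab_def ibox_def mem_Collect_eq, rule_format, of i] have "p i \<ge> w" by simp
        with core show False by (cases "i = k") (auto simp: core_edges_def)
      next
        case False
        with p[unfolded slab_def ibox_def mem_Collect_eq, rule_format, of i] have "p i < 0" by simp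
        with core k False show False by (cases "i = k") (auto simp: core_edges_def)
      qed
    qed
    ultimately show ?thesis by (simp add: shell_edges_def e)
  qed
  have "2 * (r + \<bar>c\<bar>) * real_of_int (w + 2 * l) \<le> 2 * (r + r * \<kappa>) * real_of_int (w + 2 * l)"
    using c_le \<open>w \<ge> 1\<close> \<open>l \<ge> 1\<close> by (intro mult_right_mono) auto
  with order.trans[OF \<psi>(2) this] \<psi>(1) shell
  have "shell_transport w l (\<lambda>p. \<rho> p - c * indicator (corner w l j s') p) (2 * (r + r * \<kappa>) * (w + 2 * l))"
    unfolding shell_transport_def by (intro exI[of _ \<psi>]) simp
  with c_le show ?thesis by (rule that)
qed

text \<open>An upper slab contains the upper corner. A lower slab does not; its charge goes through
  the stopover corner and then an upper slab of another direction, which is where dimension at least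
  2 enters. The two costs add up to the square.\<close>

lemma slab_to_corner:
  fixes \<rho> :: "('d::finite \<Rightarrow> int) \<Rightarrow> real"
  assumes d: "CARD('d) \<ge> 2" and "w \<ge> 1" "l \<ge> 1"
    and supp: "\<And>p. \<rho> p \<noteq> 0 \<Longrightarrow> p \<in> slab w l i s"
    and bound: "\<And>p. \<bar>\<rho> p\<bar> \<le> r"
    and kappa: "\<kappa> = (real_of_int (w + 2 * l) / l) ^ CARD('d)"
  obtains c where
    "shell_transport w l (\<lambda>p. \<rho> p - c * indicator (corner w l i True) p) (2 * r * (1 + \<kappa>)\<^sup>2 * (w + 2 * l))"
proof -
  have k0: "\<kappa> \<ge> 0" using \<open>w \<ge> 1\<close> \<open>l \<ge> 1\<close> by (simp add: kappa)
  have r0: "r \<ge> 0" using bound[of undefined] by simp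
  show ?thesis
  proof (cases s)
    case True
    have "corner w l i True \<subseteq> slab w l i s"
      using \<open>w \<ge> 1\<close> \<open>l \<ge> 1\<close> True unfolding corner_def slab_def
      by (intro ibox_mono) auto
    from slab_dump[where \<rho>=\<rho> and r=r, OF \<open>w \<ge> 1\<close> \<open>l \<ge> 1\<close> supp bound this kappa]
    obtain c where c: "shell_transport w l (\<lambda>p. \<rho> p - c * indicator (corner w l i True) p) (2 * (r + r * \<kappa>) * (w + 2 * l))"
      by blast
    have "2 * (r + r * \<kappa>) \<le> 2 * r * (1 + \<kappa>)\<^sup>2"
      using k0 r0 by (simp add: power2_eq_square algebra_simps)
    then show ?thesis using \<open>w \<ge> 1\<close> \<open>l \<ge> 1\<close>
      by (intro that[of c] shell_transport_mono[OF c] mult_right_mono) auto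
  next
    case False
    have "UNIV \<noteq> {i}"
      using d by (metis card.empty card_insert_disjoint empty_iff finite.emptyI One_nat_def not_less_eq_eq numeral_2_eq_2 order_refl)
    then obtain k where k: "k \<noteq> i" by auto
    have sub1: "corner w l i False \<subseteq> slab w l i s"
      using \<open>w \<ge> 1\<close> \<open>l \<ge> 1\<close> False unfolding corner_def slab_def
      by (intro ibox_mono) auto
    obtain c' where c': "\<bar>c'\<bar> \<le> r * \<kappa>"
        "shell_transport w l (\<lambda>p. \<rho> p - c' * indicator (corner w l i False) p) (2 * (r + r * \<kappa>) * (w + 2 * l))"
      by (rule slab_dump[where \<rho>=\<rho> and r=r, OF \<open>w \<ge> 1\<close> \<open>l \<ge> 1\<close> supp bound sub1 kappa])
    have sub2: "corner w l i True \<subseteq> slab w l k True"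
      using \<open>w \<ge> 1\<close> \<open>l \<ge> 1\<close> unfolding corner_def slab_def
      by (intro ibox_mono) auto
    have supp2: "p \<in> slab w l k True" if "c' * indicator (corner w l i False) p \<noteq> 0" for p
    proof -
      have "p \<in> corner w l i False" using that by (auto simp: indicator_def split: if_splits)
      moreover have "corner w l i False \<subseteq> slab w l k True"
        using \<open>w \<ge> 1\<close> \<open>l \<ge> 1\<close> k unfolding corner_def slab_def by (intro ibox_mono) auto
      ultimately show ?thesis by blast
    qed
    have bound2: "\<bar>c' * indicator (corner w l i False) p\<bar> \<le> r * \<kappa>" for p
      using c'(1) r0 k0 by (auto simp: indicator_def)
    obtain c where c: "shell_transport w l (\<lambda>p. c' * indicator (corner w l i False) p - c * indicator (corner w l i True) p)
         (2 * (r * \<kappa> + r * \<kappa> * \<kappa>) * (w + 2 * l))"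
      by (rule slab_dump[where \<rho>="\<lambda>p. c' * indicator (corner w l i False) p" and r="r * \<kappa>", OF \<open>w \<ge> 1\<close> \<open>l \<ge> 1\<close> supp2 bound2 sub2 kappa])
    have eq: "2 * (r + r * \<kappa>) * (w + 2 * l) + 2 * (r * \<kappa> + r * \<kappa> * \<kappa>) * (w + 2 * l) = 2 * r * (1 + \<kappa>)\<^sup>2 * (w + 2 * l)"
      by (simp add: power2_eq_square algebra_simps)
    show ?thesis
      by (rule that[of c]) (use shell_transport_add[OF c'(2) c] in \<open>unfold eq, simp\<close>)
  qed
qed

section \<open>Extension of a flow through the shell\<close>

text \<open>Only the directions across \<open>i\<close> are cut into blocks, and only within the
  range of the core. Over the core a cell of this grid is a flat plate, one layer thick in direction
  \<open>i\<close>: the unit on which fluxes are measured.\<close>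

definition patch_lo :: "int \<Rightarrow> int \<Rightarrow> 'd \<Rightarrow> 'd \<Rightarrow> int \<Rightarrow> int" where
  "patch_lo a w i j x = (if j \<noteq> i \<and> 0 \<le> x \<and> x < w then a * (x div a) else x)"

definition patch_hi :: "int \<Rightarrow> int \<Rightarrow> 'd \<Rightarrow> 'd \<Rightarrow> int \<Rightarrow> int" where
  "patch_hi a w i j x = (if j \<noteq> i \<and> 0 \<le> x \<and> x < w then a * (x div a) + a else x + 1)"

definition patch :: "int \<Rightarrow> int \<Rightarrow> 'd \<Rightarrow> ('d \<Rightarrow> int) \<Rightarrow> ('d \<Rightarrow> int) set" where
  "patch a w i p = cell (patch_lo a w i) (patch_hi a w i) p"

lemma block_inside:
  fixes a k x :: int
  assumes "a \<ge> 1" "0 \<le> x" "x < k * a"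
  shows "0 \<le> a * (x div a)" "a * (x div a) + a \<le> k * a"
    "a * (x div a) \<le> x" "x < a * (x div a) + a"
proof -
  show "0 \<le> a * (x div a)" using assms by (simp add: pos_imp_zdiv_nonneg_iff)
  show lb: "a * (x div a) \<le> x" and "x < a * (x div a) + a"
    using assms pos_mod_bound[of a x] pos_mod_sign[of a x] mult_div_mod_eq[of a x] by linarith+
  have "x div a < k"
  proof (rule ccontr)
    assume "\<not> x div a < k"
    then have "a * k \<le> a * (x div a)" using assms by (intro mult_left_mono) auto
    with lb assms show False by (simp add: mult.commute)
  qed
  then have "a * (x div a + 1) \<le> a * k" using assms by (intro mult_left_mono) auto
  then show "a * (x div a) + a \<le> k * a" by (simp add: algebra_simps)
qed

lemma block_eq:
  fixes a x y :: int
  assumes "a \<ge> 1" "a * (x div a) \<le> y" "y < a * (x div a) + a"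
  shows "y div a = x div a"
proof (rule int_div_pos_eq)
  show "y = a * (x div a) + (y - a * (x div a))" by simp
qed (use assms in auto)

lemma interval_grid_patch:
  assumes "a \<ge> 1" "w = k * a"
  shows "interval_grid (patch_lo a w i) (patch_hi a w i)"
  unfolding interval_grid_def
proof (intro allI conjI impI)
  fix j x y
  show "patch_lo a w i j x \<le> x" "x < patch_hi a w i j x"
    using block_inside(3,4)[of a x k] assms by (auto simp: patch_lo_def patch_hi_def)
  assume y: "patch_lo a w i j x \<le> y \<and> y < patch_hi a w i j x"
  have "patch_lo a w i j y = patch_lo a w i j x \<and> patch_hi a w i j y = patch_hi a w i j x"
  proof (cases "j \<noteq> i \<and> 0 \<le> x \<and> x < w")
    case True
    then have "a * (x div a) \<le> y" "y < a * (x div a) + a"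
      using y by (simp_all add: patch_lo_def patch_hi_def)
    moreover from this have "0 \<le> y" "y < w"
      using block_inside(1,2)[of a x k] True assms by auto
    ultimately show ?thesis
      using True block_eq[OF assms(1), of x y] by (simp add: patch_lo_def patch_hi_def)
  next
    case False
    then have "y = x" using y by (auto simp: patch_lo_def patch_hi_def)
    then show ?thesis by simp
  qed
  then show "patch_lo a w i j y = patch_lo a w i j x" "patch_hi a w i j y = patch_hi a w i j x"
    by blast+
qed

lemma mem_patch:
  assumes "a \<ge> 1" "w = k * a" "q \<in> patch a w i p"
  shows "q i = p i" and "0 \<le> q j \<and> q j < w \<longleftrightarrow> 0 \<le> p j \<and> p j < w"
proof -
  have *: "patch_lo a w i j (p j) \<le> q j \<and> q j < patch_hi a w i j (p j)" for j
    using assms(3) by (simp add: patch_def cell_def ibox_def)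
  show i: "q i = p i" using *[of i] by (simp add: patch_lo_def patch_hi_def)
  show "0 \<le> q j \<and> q j < w \<longleftrightarrow> 0 \<le> p j \<and> p j < w"
  proof (cases "j \<noteq> i \<and> 0 \<le> p j \<and> p j < w")
    case True
    then show ?thesis
      using *[of j] block_inside(1,2)[of a "p j" k] assms by (auto simp: patch_lo_def patch_hi_def)
  next
    case False
    then have "q j = p j" using *[of j] by (auto simp: patch_lo_def patch_hi_def)
    then show ?thesis by simp
  qed
qed

text \<open>Patches over the same block at different depths are translates of each other. This
  transfers an estimate at a face of the core to every level of the shell.\<close>

lemma patch_upd:
  assumes "a \<ge> 1" "w = k * a"
  shows "patch a w i (p(i := x)) = (\<lambda>q. q(i := x)) ` patch a w i p"
    and "inj_on (\<lambda>q. q(i := x)) (patch a w i p)"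
proof -
  have *: "q \<in> patch a w i p' \<longleftrightarrow> q i = p' i \<and> (\<forall>j. j \<noteq> i \<longrightarrow> patch_lo a w i j (p' j) \<le> q j \<and> q j < patch_hi a w i j (p' j))"
    for q p'
  proof -
    have i: "patch_lo a w i i x = x" "patch_hi a w i i x = x + 1" for x
      by (simp_all add: patch_lo_def patch_hi_def)
    have "(\<forall>j. patch_lo a w i j (p' j) \<le> q j \<and> q j < patch_hi a w i j (p' j)) \<longleftrightarrow>
       (patch_lo a w i i (p' i) \<le> q i \<and> q i < patch_hi a w i i (p' i)) \<and>
       (\<forall>j. j \<noteq> i \<longrightarrow> patch_lo a w i j (p' j) \<le> q j \<and> q j < patch_hi a w i j (p' j))"
      by metis
    also have "(patch_lo a w i i (p' i) \<le> q i \<and> q i < patch_hi a w i i (p' i)) \<longleftrightarrow> q i = p' i"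
      unfolding i by auto
    finally show ?thesis unfolding patch_def cell_def ibox_def mem_Collect_eq .
  qed
  show "patch a w i (p(i := x)) = (\<lambda>q. q(i := x)) ` patch a w i p"
  proof (intro equalityI subsetI)
    fix q assume q: "q \<in> patch a w i (p(i := x))"
    then have "q(i := p i) \<in> patch a w i p" "q = (q(i := p i))(i := x)" unfolding * by auto
    then show "q \<in> (\<lambda>q. q(i := x)) ` patch a w i p" by blast
  next
    fix q assume "q \<in> (\<lambda>q. q(i := x)) ` patch a w i p"
    then obtain q' where q': "q' \<in> patch a w i p" "q = q'(i := x)" by blast
    from q'(1) show "q \<in> patch a w i (p(i := x))" unfolding q'(2) * by simp
  qed
  show "inj_on (\<lambda>q. q(i := x)) (patch a w i p)"
  proof (rule inj_onI)
    fix q q' assume "q \<in> patch a w i p" "q' \<in> patch a w i p" "q(i := x) = q'(i := x)"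
    then have "q j = q' j" for j unfolding * by (cases "j = i") (simp, metis fun_upd_other)
    then show "q = q'" by auto
  qed
qed

lemma card_patch:
  assumes "a \<ge> 1" "w = k * a" "\<And>j. j \<noteq> i \<Longrightarrow> 0 \<le> p j \<and> p j < w"
  shows "card (patch a w i (p :: 'd::finite \<Rightarrow> int)) = nat a ^ (CARD('d) - 1)"
proof -
  have "card (patch a w i p) = (\<Prod>j\<in>UNIV. if j = i then 1 else nat a)"
    unfolding patch_def cell_def card_ibox
    by (intro prod.cong) (auto simp: patch_lo_def patch_hi_def assms(3))
  also have "\<dots> = nat a ^ (CARD('d) - 1)"
    by (subst prod.remove[of _ i]) (simp_all add: card_Diff_singleton)
  finally show ?thesis .
qed

text \<open>A flow that is given on the edges at the core and equals \<open>u\<close> far away can be interpolated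
  through the shell. The linear interpolation along the axes violates the node law; the defect is
  first averaged over patches of the columns, which needs only short transports, and the remaining
  small density is then collected at a corner of the tile, where it cancels.\<close>

lemma tile_extension:
  fixes f :: "('d::finite \<Rightarrow> int) \<times> 'd \<Rightarrow> real" and u :: "'d \<Rightarrow> real" and a k c w l :: int
    and A \<gamma> \<kappa> :: real
  assumes d: "CARD('d) \<ge> 2" and a: "a \<ge> 1" and "k \<ge> 1" "c \<ge> 1"
    and w: "w = k * a" and l: "l = c * a"
    and f_bound: "\<And>e. e \<in> core_edges w \<Longrightarrow> \<bar>f e\<bar> \<le> A"
    and u_bound: "\<And>i. \<bar>u i\<bar> \<le> A"
    and node: "\<And>p. p \<in> cube w \<Longrightarrow> flow_div f p = 0"
    and flux: "\<And>p i. p i = -1 \<or> p i = w - 1 \<Longrightarrow> (\<And>j. j \<noteq> i \<Longrightarrow> 0 \<le> p j \<and> p j < w) \<Longrightarrow>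
       \<bar>\<Sum>q\<in>patch a w i p. f (q, i) - u i\<bar> \<le> \<gamma> * card (patch a w i p)"
    and "\<gamma> \<ge> 0"
    and kappa: "\<kappa> = (real_of_int (w + 2 * l) / l) ^ CARD('d)"
  obtains h where
    "\<And>e. e \<in> core_edges w \<Longrightarrow> h e = f e"
    "\<And>p i. p \<notin> tile w l \<or> p i + 1 \<ge> w + l \<Longrightarrow> h (p, i) = u i"
    "\<And>p. flow_div h p = 0"
    "\<And>e. e \<notin> core_edges w \<Longrightarrow>
       \<bar>h e\<bar> \<le> A + CARD('d) * (4 * A / c) + 4 * CARD('d) * \<gamma> * (1 + \<kappa>)\<^sup>2 * (real_of_int (w + 2 * l) / l)"
proof -
  have w1: "w \<ge> 1" and l1: "l \<ge> 1"
    using mult_mono[of 1 k 1 a] mult_mono[of 1 c 1 a] \<open>k \<ge> 1\<close> \<open>c \<ge> 1\<close> a by (simp_all add: w l)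
  have A0: "A \<ge> 0" using u_bound[of undefined] by linarith
  \<comment> \<open>Weight of the core flow by level of the edge: 1 on the levels -1 to w - 1 of
    core edges, 0 from the levels -l - 1 and w + l - 1 of the edges across the boundary of the tile,
    linear in between.\<close>
  define \<theta> where "\<theta> x = max 0 (1 - real_of_int (max 0 (max (x - w + 1) (- 1 - x))) / l)" for x
  \<comment> \<open>The level of the nearest core edge in the same column.\<close>
  define cl where "cl x = max (- 1) (min (w - 1) x)" for x
  define across where "across i p \<longleftrightarrow> (\<forall>j. j \<noteq> i \<longrightarrow> 0 \<le> p j \<and> p j < w)" for i and p :: "'d \<Rightarrow> int"
  define h0 where "h0 e = (case e of (p, i) \<Rightarrow>
     if across i p then u i + (f (p(i := cl (p i)), i) - u i) * \<theta> (p i) else u i)" for e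
  define shell where "shell x \<longleftrightarrow> - l \<le> x \<and> x < 0 \<or> w \<le> x \<and> x < w + l" for x
  \<comment> \<open>Minus the contribution of direction \<open>i\<close> to the divergence of
    \<open>h0\<close>, at points off the core.\<close>
  define \<rho> where "\<rho> i p = (if across i p then (f (p(i := cl (p i)), i) - u i) * (\<theta> (p i - 1) - \<theta> (p i)) else 0)" for i p
  have \<theta>_in: "\<theta> x = 1" if "- 1 \<le> x" "x \<le> w - 1" for x using that by (simp add: \<theta>_def)
  have \<theta>_01: "0 \<le> \<theta> x" "\<theta> x \<le> 1" for x using l1 by (auto simp: \<theta>_def)
  have \<theta>_out: "\<theta> x = 0" if "x < - l \<or> x \<ge> w + l - 1" for x
    using that w1 l1 by (auto simp: \<theta>_def max_def)
  have \<theta>_diff1: "\<theta> (x - 1) - \<theta> x = 1 / l" if "w \<le> x" "x < w + l" for x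
    using that w1 l1 by (auto simp: \<theta>_def max_def field_simps)
  have \<theta>_diff2: "\<theta> (x - 1) - \<theta> x = - 1 / l" if "- l \<le> x" "x < 0" for x
    using that w1 l1 by (auto simp: \<theta>_def max_def field_simps)
  have \<theta>_diff0: "\<theta> (x - 1) - \<theta> x = 0" if "\<not> shell x" for x
  proof -
    have "x < - l \<or> x \<ge> w + l \<or> 0 \<le> x \<and> x < w" using that w1 l1 by (auto simp: shell_def)
    then show ?thesis using \<theta>_in[of x] \<theta>_in[of "x - 1"] \<theta>_out[of x] \<theta>_out[of "x - 1"] by auto
  qed
  have \<theta>_diff: "\<bar>\<theta> (x - 1) - \<theta> x\<bar> \<le> 1 / l" for x
  proof -
    consider "\<not> shell x" | "w \<le> x" "x < w + l" | "- l \<le> x" "x < 0" by (auto simp: shell_def)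
    then show ?thesis using l1 by cases (simp_all add: \<theta>_diff0 \<theta>_diff1 \<theta>_diff2)
  qed
  have core_cl: "(p(i := cl (p i)), i) \<in> core_edges w" if "across i p" for i p
    using that w1 by (auto simp: core_edges_def across_def cl_def)
  have h0_bound: "\<bar>h0 e\<bar> \<le> A" for e
  proof -
    obtain p i where e: "e = (p, i)" by force
    show ?thesis
    proof (cases "across i p")
      case True
      let ?F = "f (p(i := cl (p i)), i)" and ?t = "\<theta> (p i)"
      have "h0 e = (1 - ?t) * u i + ?t * ?F" by (simp add: h0_def e True algebra_simps)
      also have "\<bar>\<dots>\<bar> \<le> (1 - ?t) * \<bar>u i\<bar> + ?t * \<bar>?F\<bar>"
        using \<theta>_01[of "p i"] by (intro order_trans[OF abs_triangle_ineq]) (simp add: abs_mult)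
      also have "\<dots> \<le> (1 - ?t) * A + ?t * A"
        using \<theta>_01[of "p i"] u_bound[of i] f_bound[OF core_cl[OF True]]
        by (intro add_mono mult_left_mono) auto
      finally show ?thesis by (simp add: algebra_simps)
    qed (simp add: h0_def e u_bound)
  qed
  have h0_core: "h0 e = f e" if "e \<in> core_edges w" for e
  proof -
    obtain p i where e: "e = (p, i)" by force
    have "across i p" "cl (p i) = p i" "\<theta> (p i) = 1"
      using that \<theta>_in[of "p i"] by (auto simp: e core_edges_def across_def cl_def)
    then show ?thesis by (simp add: h0_def e)
  qed
  have h0_out: "h0 (p, i) = u i" if "p \<notin> tile w l \<or> p i + 1 \<ge> w + l" for p i
  proof (cases "across i p")
    case True
    have "p i < - l \<or> p i \<ge> w + l - 1"
    proof (rule ccontr)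
      assume n: "\<not> ?thesis"
      have "- l \<le> p j \<and> p j < w + l" for j
        using n True[unfolded across_def, rule_format, of j] l1 w1 by (cases "j = i") auto
      then have "p \<in> tile w l" by (simp add: tile_def ibox_def)
      with that n show False by auto
    qed
    then show ?thesis using \<theta>_out by (simp add: h0_def)
  qed (simp add: h0_def)
  have across_upd: "across i (p(i := x)) = across i p" for i p x by (auto simp: across_def)
  have \<rho>_cube: "\<rho> i p = 0" if "p \<in> cube w" for i p
  proof -
    have "0 \<le> p i" "p i < w" using that by (simp_all add: cube_def ibox_def)
    then have "\<not> shell (p i)" by (auto simp: shell_def)
    then show ?thesis by (simp add: \<rho>_def \<theta>_diff0)
  qed
  have h0_div: "flow_div h0 p = - (\<Sum>i\<in>UNIV. \<rho> i p)" for p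
  proof (cases "p \<in> cube w")
    case True
    have "(p, i) \<in> core_edges w" "(p(i := p i - 1), i) \<in> core_edges w" for i
    proof -
      have *: "0 \<le> p j" "p j < w" for j using True by (simp_all add: cube_def ibox_def)
      have "- 1 \<le> p i" "- 1 \<le> p i - 1" "p i - 1 < w" using *[of i] by linarith+
      then show "(p, i) \<in> core_edges w" "(p(i := p i - 1), i) \<in> core_edges w"
        unfolding core_edges_def using * by simp_all
    qed
    then have "flow_div h0 p = flow_div f p" by (simp add: flow_div_def h0_core)
    then show ?thesis using node[OF True] \<rho>_cube[OF True] by simp
  next
    case False
    have "h0 (p, i) - h0 (p(i := p i - 1), i) = - \<rho> i p" for i
    proof (cases "across i p")
      case True
      have "p i < 0 \<or> p i \<ge> w"
      proof (rule ccontr)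
        assume n: "\<not> (p i < 0 \<or> p i \<ge> w)"
        have "0 \<le> p j \<and> p j < w" for j
          using n True[unfolded across_def, rule_format, of j] by (cases "j = i") auto
        with False show False by (simp add: cube_def ibox_def)
      qed
      \<comment> \<open>Off the core both edges at \<open>p\<close> in direction \<open>i\<close>
        copy the same core edge, so only their weights differ.\<close>
      then have "cl (p i - 1) = cl (p i)" using w1 by (auto simp: cl_def)
      then show ?thesis by (simp add: h0_def \<rho>_def across_upd algebra_simps)
    qed (simp add: h0_def \<rho>_def across_upd)
    then show ?thesis by (simp add: flow_div_def sum_negf)
  qed
  have \<rho>_bound: "\<bar>\<rho> i p\<bar> \<le> 2 * A / l" for i p
  proof (cases "across i p")
    case True
    have "\<bar>f (p(i := cl (p i)), i) - u i\<bar> \<le> 2 * A"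
      using u_bound[of i] f_bound[OF core_cl[OF True]] by linarith
    then have "\<bar>\<rho> i p\<bar> \<le> 2 * A * (1 / l)"
      unfolding \<rho>_def using True \<theta>_diff[of "p i"] A0 by (simp only: if_True abs_mult) (intro mult_mono, auto)
    then show ?thesis by simp
  qed (use A0 l1 in \<open>simp add: \<rho>_def\<close>)
  have \<rho>_supp: "across i p \<and> shell (p i)" if "\<rho> i p \<noteq> 0" for i p
    using that \<theta>_diff0[of "p i"] by (auto simp: \<rho>_def split: if_splits)

  define avg where "avg i p = (\<Sum>q\<in>patch a w i p. \<rho> i q) / card (patch a w i p)" for i p
  note grid = interval_grid_patch[OF a w]
  have self: "p \<in> patch a w i p" for i p
    unfolding patch_def by (rule cell_self[OF grid])
  have patch_across: "across i q = across i p" if "q \<in> patch a w i p" for i p q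
    using mem_patch(2)[OF a w that] by (simp add: across_def)
  \<comment> \<open>Density \<open>2 * A / l\<close> is moved within blocks of side \<open>a\<close>
    = \<open>l / c\<close>.\<close>
  have step1: "shell_transport w l (\<lambda>p. \<rho> i p - avg i p) (4 * A / c)" for i
  proof -
    have wd: "real_of_int (patch_hi a w i j x - patch_lo a w i j x) \<le> a" for j x
      using a by (auto simp: patch_lo_def patch_hi_def)
    obtain \<psi> where \<psi>': "\<And>p. flow_div \<psi> p = \<rho> i p - (\<Sum>q\<in>patch a w i p. \<rho> i q) / card (patch a w i p)"
      "\<And>e. \<bar>\<psi> e\<bar> \<le> 2 * (2 * A / l) * a"
      "\<And>p j. \<psi> (p, j) \<noteq> 0 \<Longrightarrow> p j + 1 < patch_hi a w i j (p j) \<and> (\<exists>q\<in>patch a w i p. \<rho> i q \<noteq> 0)"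
      by (rule grid_averaging[where \<rho>="\<rho> i" and r="2 * A / l" and wd=a, OF grid \<rho>_bound wd, folded patch_def])
         (rule that)
    note \<psi> = \<psi>'(1)[folded avg_def] \<psi>'(2,3)
    have "2 * (2 * A / l) * a = 4 * A / c" using a \<open>c \<ge> 1\<close> by (simp add: l)
    moreover have "e \<in> shell_edges w l" if nz: "\<psi> e \<noteq> 0" for e
    proof -
      obtain p j where e: "e = (p, j)" by force
      obtain q where q: "q \<in> patch a w i p" "\<rho> i q \<noteq> 0" and hi: "p j + 1 < patch_hi a w i j (p j)"
        using \<psi>(3)[of p j] nz e by auto
      have ac: "across i p" "shell (p i)"
        using \<rho>_supp[OF q(2)] patch_across[OF q(1)] mem_patch(1)[OF a w q(1)] by auto
      have ji: "j \<noteq> i" "0 \<le> p j" "p j < w" using hi by (auto simp: patch_hi_def split: if_splits)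
      then have "p j + 1 < w"
        using hi block_inside(2)[of a "p j" k] a by (auto simp: patch_hi_def w)
      moreover have "p \<in> tile w l"
      proof -
        have "- l \<le> p j \<and> p j < w + l" for j
          using ac(1)[unfolded across_def, rule_format, of j] ac(2) w1 l1
          by (cases "j = i") (auto simp: shell_def)
        then show ?thesis by (simp add: tile_def ibox_def)
      qed
      \<comment> \<open>The move is across direction \<open>i\<close> while the level
        \<open>p i\<close> lies in the shell, so no core edge is used.\<close>
      moreover have "(p, j) \<notin> core_edges w"
        using ac ji w1 l1 by (auto simp: core_edges_def shell_def)
      ultimately show ?thesis using l1 by (simp add: e shell_edges_def)
    qed
    ultimately show ?thesis unfolding shell_transport_def using \<psi>(1,2) by metis
  qed

  have avg_supp: "across i p \<and> shell (p i)" if nz: "avg i p \<noteq> 0" for i p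
  proof -
    obtain q where "q \<in> patch a w i p" "\<rho> i q \<noteq> 0"
      using nz unfolding avg_def by (metis div_0 sum.neutral)
    then show ?thesis using \<rho>_supp[of i q] patch_across[of q i p] mem_patch(1)[OF a w, of q i p] by auto
  qed
  \<comment> \<open>The interpolation repeats the values at the face. So the charge of a patch in
    the shell is the weight step, 1/l in absolute value, times the error of the flux through the
    patch at the face of the core.\<close>
  have avg_bound: "\<bar>avg i p\<bar> \<le> \<gamma> / l" for i p
  proof (cases "across i p \<and> shell (p i)")
    case True
    let ?x = "cl (p i)" and ?\<delta> = "\<theta> (p i - 1) - \<theta> (p i)"
    have "(\<Sum>q\<in>patch a w i p. \<rho> i q) = (\<Sum>q\<in>patch a w i p. (f (q(i := ?x), i) - u i) * ?\<delta>)"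
    proof (rule sum.cong[OF refl])
      fix q assume q: "q \<in> patch a w i p"
      have "across i q" using patch_across[OF q] True by simp
      then show "\<rho> i q = (f (q(i := ?x), i) - u i) * ?\<delta>"
        using mem_patch(1)[OF a w q] by (simp add: \<rho>_def)
    qed
    also have "\<dots> = (\<Sum>q\<in>patch a w i (p(i := ?x)). f (q, i) - u i) * ?\<delta>"
      unfolding patch_upd(1)[OF a w] sum.reindex[OF patch_upd(2)[OF a w]] by (simp add: sum_distrib_right)
    finally have "\<bar>\<Sum>q\<in>patch a w i p. \<rho> i q\<bar> = \<bar>\<Sum>q\<in>patch a w i (p(i := ?x)). f (q, i) - u i\<bar> * \<bar>?\<delta>\<bar>"
      by (simp add: abs_mult)
    also have "\<dots> \<le> (\<gamma> * card (patch a w i (p(i := ?x)))) * (1 / l)"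
    proof (intro mult_mono flux \<theta>_diff)
      show "(p(i := ?x)) i = - 1 \<or> (p(i := ?x)) i = w - 1"
        using True w1 by (auto simp: shell_def cl_def)
    qed (use True \<open>\<gamma> \<ge> 0\<close> in \<open>auto simp: across_def\<close>)
    also have "card (patch a w i (p(i := ?x))) = card (patch a w i p)"
      unfolding patch_upd(1)[OF a w] by (rule card_image[OF patch_upd(2)[OF a w]])
    finally have "\<bar>\<Sum>q\<in>patch a w i p. \<rho> i q\<bar> \<le> \<gamma> / l * card (patch a w i p)" by simp
    moreover have "card (patch a w i p) > 0"
      using self[of p i] by (auto simp: card_gt_0_iff patch_def)
    ultimately show ?thesis by (simp add: avg_def pos_divide_le_eq)
  next
    case False
    then show ?thesis using avg_supp[of i p] \<open>\<gamma> \<ge> 0\<close> l1 by (cases "avg i p = 0") auto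
  qed

  \<comment> \<open>The upper corner is common to all directions, so all leftover charges meet on
    one set.\<close>
  define O' where "O' = corner w l (undefined :: 'd) True"
  have corner_eq: "corner w l i True = O'" for i :: 'd by (simp add: O'_def corner_def)
  define R where "R = 2 * (\<gamma> / l) * (1 + \<kappa>)\<^sup>2 * (w + 2 * l)"
  have step2: "\<exists>c. shell_transport w l (\<lambda>p. avg i p - c * indicator O' p) (2 * R)" for i
  proof -
    \<comment> \<open>On the support of \<open>avg i\<close> the sign of \<open>p i\<close> tells
      the upper slab from the lower one.\<close>
    define part where "part s p = (if (p i \<ge> 0) = s then avg i p else 0)" for s p
    have "\<exists>c. shell_transport w l (\<lambda>p. part s p - c * indicator O' p) R" for s
    proof -
      have supp: "p \<in> slab w l i s" if "part s p \<noteq> 0" for p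
      proof -
        have "avg i p \<noteq> 0" and "(p i \<ge> 0) = s" using that by (auto simp: part_def split: if_splits)
        then have "across i p" "shell (p i)" using avg_supp by blast+
        have "(if j = i \<and> s then w else - l) \<le> p j \<and> p j < (if j = i \<and> \<not> s then 0 else w + l)" for j
          using \<open>across i p\<close>[unfolded across_def, rule_format, of j] \<open>shell (p i)\<close> \<open>(p i \<ge> 0) = s\<close> w1 l1
          by (cases "j = i"; cases s) (auto simp: shell_def)
        then show ?thesis by (simp add: slab_def ibox_def)
      qed
      have bd: "\<bar>part s p\<bar> \<le> \<gamma> / l" for p
        using avg_bound[of i p] \<open>\<gamma> \<ge> 0\<close> l1 by (auto simp: part_def)
      obtain c where "shell_transport w l (\<lambda>p. part s p - c * indicator (corner w l i True) p)
          (2 * (\<gamma> / l) * (1 + \<kappa>)\<^sup>2 * (w + 2 * l))"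
        by (rule slab_to_corner[where \<rho>="part s" and r="\<gamma> / l", OF d w1 l1 supp bd kappa])
      then show ?thesis unfolding corner_eq R_def by blast
    qed
    then obtain c1 c2 where
      "shell_transport w l (\<lambda>p. part True p - c1 * indicator O' p) R"
      "shell_transport w l (\<lambda>p. part False p - c2 * indicator O' p) R"
      by blast
    note sum = shell_transport_add[OF this]
    have eq: "(\<lambda>p. part True p - c1 * indicator O' p + (part False p - c2 * indicator O' p)) =
        (\<lambda>p. avg i p - (c1 + c2) * indicator O' p)"
      by (auto simp: part_def fun_eq_iff algebra_simps)
    have "shell_transport w l (\<lambda>p. avg i p - (c1 + c2) * indicator O' p) (2 * R)"
      using sum unfolding eq mult_2 .
    then show ?thesis by blast
  qed
  then obtain cc where cc: "shell_transport w l (\<lambda>p. avg i p - cc i * indicator O' p) (2 * R)" for i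
    by metis
  have "shell_transport w l (\<lambda>p. \<Sum>i\<in>UNIV. (\<rho> i p - avg i p) + (avg i p - cc i * indicator O' p))
      (\<Sum>i\<in>(UNIV::'d set). 4 * A / c + 2 * R)"
    by (intro shell_transport_sum shell_transport_add step1 cc) simp
  then obtain \<psi> where \<psi>: "\<And>p. flow_div \<psi> p = (\<Sum>i\<in>UNIV. \<rho> i p - cc i * indicator O' p)"
    "\<And>e. \<bar>\<psi> e\<bar> \<le> CARD('d) * (4 * A / c + 2 * R)" "\<And>e. \<psi> e \<noteq> 0 \<Longrightarrow> e \<in> shell_edges w l"
    unfolding shell_transport_def by auto
  define C where "C = (\<Sum>i\<in>UNIV. cc i)"
  define h where "h e = h0 e + \<psi> e" for e
  have div_h: "flow_div h p = - C * indicator O' p" for p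
    unfolding h_def flow_div_add h0_div \<psi>(1) C_def by (simp add: sum_subtractf sum_distrib_right)
  have h_out: "h (p, i) = u i" if "p \<notin> tile w l \<or> p i + 1 \<ge> w + l" for p i
  proof -
    have "\<psi> (p, i) = 0" using \<psi>(3)[of "(p, i)"] that by (force simp: shell_edges_def)
    then show ?thesis using h0_out[OF that] by (simp add: h_def)
  qed
  \<comment> \<open>After subtraction of the divergence-free constant flow \<open>u\<close>, nothing
    crosses the boundary of the tile, so the total divergence is 0. On the other hand it is -C times
    the number of points of the corner.\<close>
  have "C = 0"
  proof -
    have "(\<Sum>p\<in>tile w l. flow_div (\<lambda>e. h e + (case e of (p, i) \<Rightarrow> - u i)) p) = 0"
      unfolding tile_def sum_ibox_flow_div
    proof (intro sum.neutral ballI)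
      fix i
      have "(\<Sum>p\<in>ibox (\<lambda>_. - l) (\<lambda>_. w + l) \<inter> {p. p i = w + l - 1}. h (p, i) + (case (p, i) of (p, i) \<Rightarrow> - u i)) = 0"
        using h_out by (intro sum.neutral) auto
      moreover have "(\<Sum>p\<in>ibox (\<lambda>_. - l) (\<lambda>_. w + l) \<inter> {p. p i = - l}.
          h (p(i := p i - 1), i) + (case (p(i := p i - 1), i) of (p, i) \<Rightarrow> - u i)) = 0"
      proof (intro sum.neutral ballI)
        fix p assume "p \<in> ibox (\<lambda>_. - l) (\<lambda>_. w + l) \<inter> {p. p i = - l}"
        then have "p(i := p i - 1) \<notin> tile w l" by (auto simp: tile_def ibox_def intro!: exI[of _ i])
        then show "h (p(i := p i - 1), i) + (case (p(i := p i - 1), i) of (p, i) \<Rightarrow> - u i) = 0"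
          using h_out by simp
      qed
      ultimately show "(\<Sum>p\<in>ibox (\<lambda>_. - l) (\<lambda>_. w + l) \<inter> {p. p i = w + l - 1}. h (p, i) + (case (p, i) of (p, i) \<Rightarrow> - u i))
         - (\<Sum>p\<in>ibox (\<lambda>_. - l) (\<lambda>_. w + l) \<inter> {p. p i = - l}.
          h (p(i := p i - 1), i) + (case (p(i := p i - 1), i) of (p, i) \<Rightarrow> - u i)) = 0"
        by simp
    qed
    also have "(\<Sum>p\<in>tile w l. flow_div (\<lambda>e. h e + (case e of (p, i) \<Rightarrow> - u i)) p) = (\<Sum>p\<in>tile w l. - C * indicator O' p)"
      by (intro sum.cong refl) (simp only: flow_div_add div_h flow_div_const)
    also have "\<dots> = - C * (\<Sum>p\<in>tile w l. indicator O' p)" by (rule sum_distrib_left[symmetric])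
    finally have "C * (\<Sum>p\<in>tile w l. indicator O' p) = 0" by simp
    moreover have "(\<Sum>p\<in>tile w l. indicator O' p) \<noteq> (0::real)"
    proof
      assume "(\<Sum>p\<in>tile w l. indicator O' p) = (0::real)"
      moreover have "finite (tile w l :: ('d \<Rightarrow> int) set)" by (simp add: tile_def)
      ultimately have "\<forall>p\<in>tile w l. indicator O' p = (0::real)"
        by (subst (asm) sum_nonneg_eq_0_iff) auto
      moreover have "(\<lambda>_. w) \<in> tile w l" "(\<lambda>_. w) \<in> O'"
        using w1 l1 by (auto simp: tile_def ibox_def O'_def corner_def)
      ultimately show False by auto
    qed
    ultimately show ?thesis by simp
  qed
  show ?thesis
  proof (rule that[of h])
    show "h e = f e" if "e \<in> core_edges w" for e
      using that \<psi>(3)[of e] by (auto simp: h_def h0_core shell_edges_def)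
    show "flow_div h p = 0" for p by (simp add: div_h \<open>C = 0\<close>)
    show "\<bar>h e\<bar> \<le> A + CARD('d) * (4 * A / c) + 4 * CARD('d) * \<gamma> * (1 + \<kappa>)\<^sup>2 * (real_of_int (w + 2 * l) / l)" for e
    proof -
      have "\<bar>h e\<bar> \<le> A + CARD('d) * (4 * A / c + 2 * R)"
        unfolding h_def using h0_bound[of e] \<psi>(2)[of e] by linarith
      also have "\<dots> = A + CARD('d) * (4 * A / c) + 4 * CARD('d) * \<gamma> * (1 + \<kappa>)\<^sup>2 * (real_of_int (w + 2 * l) / l)"
        by (simp add: R_def algebra_simps)
      finally show ?thesis .
    qed
  qed (rule h_out)
qed

section \<open>Fluxes through patches\<close>

lemma div_eq_iff_bounds:
  fixes x z D :: int
  assumes "D \<ge> 1"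
  shows "x div D = z \<longleftrightarrow> D * z \<le> x \<and> x < D * z + D"
proof
  assume z: "x div D = z"
  have "D * z + x mod D = x" using mult_div_mod_eq[of D x] by (simp add: z)
  then show "D * z \<le> x \<and> x < D * z + D"
    using assms pos_mod_bound[of D x] pos_mod_sign[of D x] by linarith
next
  assume "D * z \<le> x \<and> x < D * z + D"
  then show "x div D = z"
    using assms by (intro int_div_pos_eq[of x D z "x - D * z"]) auto
qed

definition subcube :: "int \<Rightarrow> ('d \<Rightarrow> int) \<Rightarrow> ('d \<Rightarrow> int) set" where
  "subcube D z = ibox (\<lambda>j. D * z j) (\<lambda>j. D * z j + D)"

lemma card_subcube:
  assumes "D \<ge> 1"
  shows "card (subcube D (z :: 'd::finite \<Rightarrow> int)) = nat D ^ CARD('d)"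
  by (simp add: subcube_def card_ibox)

lemma mem_subcube: "D \<ge> 1 \<Longrightarrow> q \<in> subcube D z \<longleftrightarrow> (\<forall>j. q j div D = z j)"
  by (simp add: subcube_def ibox_def div_eq_iff_bounds)

lemma sum_ibox_subcubes:
  fixes g :: "('d::finite \<Rightarrow> int) \<Rightarrow> 'b::comm_monoid_add"
  assumes "D \<ge> 1"
  shows "(\<Sum>q\<in>ibox (\<lambda>j. D * \<alpha> j) (\<lambda>j. D * \<beta> j). g q) = (\<Sum>z\<in>ibox \<alpha> \<beta>. \<Sum>q\<in>subcube D z. g q)"
proof -
  have iff: "D * \<alpha> j \<le> x \<and> x < D * \<beta> j \<longleftrightarrow> \<alpha> j \<le> x div D \<and> x div D < \<beta> j" for j and x :: int
  proof -
    have x: "D * (x div D) \<le> x" "x < D * (x div D) + D"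
      using div_eq_iff_bounds[OF assms, of x "x div D"] by simp_all
    have le: "D * y \<le> x \<longleftrightarrow> y \<le> x div D" for y
    proof
      assume y: "D * y \<le> x"
      show "y \<le> x div D"
      proof (rule ccontr)
        assume "\<not> y \<le> x div D"
        then have "D * (x div D + 1) \<le> D * y" using assms by (intro mult_left_mono) auto
        with x y show False by (simp add: algebra_simps)
      qed
    next
      assume "y \<le> x div D"
      then have "D * y \<le> D * (x div D)" using assms by (intro mult_left_mono) auto
      with x show "D * y \<le> x" by linarith
    qed
    show ?thesis using le[of "\<alpha> j"] le[of "\<beta> j"] by (meson not_less)
  qed
  let ?B = "ibox (\<lambda>j. D * \<alpha> j) (\<lambda>j. D * \<beta> j)"
  have "(\<Sum>q\<in>?B. g q) = (\<Sum>z\<in>ibox \<alpha> \<beta>. \<Sum>q\<in>{q \<in> ?B. (\<lambda>j. q j div D) = z}. g q)"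
  proof (rule sum.group[symmetric])
    show "(\<lambda>q j. q j div D) ` ?B \<subseteq> ibox \<alpha> \<beta>"
      unfolding ibox_def by (auto simp: iff)
  qed simp_all
  also have "\<dots> = (\<Sum>z\<in>ibox \<alpha> \<beta>. \<Sum>q\<in>subcube D z. g q)"
  proof (rule sum.cong[OF refl])
    fix z assume "z \<in> ibox \<alpha> \<beta>"
    then have "{q \<in> ?B. (\<lambda>j. q j div D) = z} = subcube D z"
      unfolding set_eq_iff mem_subcube[OF assms] by (auto simp: ibox_def iff fun_eq_iff)
    then show "(\<Sum>q\<in>{q \<in> ?B. (\<lambda>j. q j div D) = z}. g q) = (\<Sum>q\<in>subcube D z. g q)"
      by simp
  qed
  finally show ?thesis .
qed

lemma sum_ibox_deviation:
  fixes g :: "('d::finite \<Rightarrow> int) \<Rightarrow> real" and u \<gamma> :: real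
  assumes "D \<ge> 1"
    and "\<And>z. z \<in> ibox \<alpha> \<beta> \<Longrightarrow> \<bar>(\<Sum>q\<in>subcube D z. g q) - u * real_of_int D ^ CARD('d)\<bar> \<le> \<gamma> * real_of_int D ^ CARD('d)"
  shows "\<bar>(\<Sum>q\<in>ibox (\<lambda>j. D * \<alpha> j) (\<lambda>j. D * \<beta> j). g q) - u * card (ibox (\<lambda>j. D * \<alpha> j) (\<lambda>j. D * \<beta> j))\<bar>
     \<le> \<gamma> * card (ibox (\<lambda>j. D * \<alpha> j) (\<lambda>j. D * \<beta> j))"
proof -
  let ?B = "ibox (\<lambda>j. D * \<alpha> j) (\<lambda>j. D * \<beta> j)"
  have c: "real (card ?B) = (\<Sum>z\<in>ibox \<alpha> \<beta>. real_of_int D ^ CARD('d))"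
    using sum_ibox_subcubes[OF assms(1), of "\<lambda>_. 1 :: real" \<alpha> \<beta>] assms(1)
    by (simp add: card_subcube)
  have "(\<Sum>q\<in>?B. g q) - u * card ?B = (\<Sum>z\<in>ibox \<alpha> \<beta>. (\<Sum>q\<in>subcube D z. g q) - u * real_of_int D ^ CARD('d))"
    unfolding sum_ibox_subcubes[OF assms(1)] c sum_subtractf sum_distrib_left ..
  also have "\<bar>\<dots>\<bar> \<le> (\<Sum>z\<in>ibox \<alpha> \<beta>. \<gamma> * real_of_int D ^ CARD('d))"
    by (rule order_trans[OF sum_abs]) (intro sum_mono assms(2))
  finally show ?thesis unfolding c sum_distrib_left .
qed

text \<open>By the node law the fluxes through a patch at nearby depths differ only by the lateral
  outflow.\<close>

lemma patch_flux_depth: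
  fixes f :: "('d::finite \<Rightarrow> int) \<times> 'd \<Rightarrow> real" and M :: real
  assumes a: "a \<ge> 1" and w: "w = k * a"
    and bound: "\<And>e. e \<in> core_edges w \<Longrightarrow> \<bar>f e\<bar> \<le> M"
    and node: "\<And>p. p \<in> cube w \<Longrightarrow> flow_div f p = 0"
    and across: "\<And>j. j \<noteq> i \<Longrightarrow> 0 \<le> p j \<and> p j < w"
    and xy: "- 1 \<le> x" "x \<le> y" "y \<le> w - 1" and "M \<ge> 0"
  shows "\<bar>(\<Sum>q\<in>patch a w i (p(i := y)). f (q, i)) - (\<Sum>q\<in>patch a w i (p(i := x)). f (q, i))\<bar>
     \<le> 2 * CARD('d) * M * card (patch a w i p) * (real_of_int (y - x) / a)"
proof -
  \<comment> \<open>The box of the levels x + 1 to y: edges at level x enter it from below, and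
    edges at level y leave it.\<close>
  define lo where "lo = (\<lambda>j. patch_lo a w i j (p j))(i := x + 1)"
  define hi where "hi = (\<lambda>j. patch_hi a w i j (p j))(i := y + 1)"
  let ?R = "ibox lo hi"
  have in_w: "0 \<le> lo j" "hi j \<le> w" "hi j - lo j = a" if "j \<noteq> i" for j
    using that block_inside(1,2)[of a "p j" k] across[OF that] a
    by (auto simp: lo_def hi_def patch_lo_def patch_hi_def w)
  have R: "?R \<subseteq> cube w"
  proof -
    have "0 \<le> lo j" "hi j \<le> w" for j
      using in_w[of j] xy by (cases "j = i"; simp add: lo_def hi_def)+
    then show ?thesis unfolding cube_def by (intro ibox_mono)
  qed
  have G: "(\<Sum>q\<in>patch a w i (p(i := z)). f (q, i)) = (\<Sum>q\<in>?R \<inter> {q. q i = t}. f (q(i := z), i))"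
    if "x < t" "t \<le> y" for z t
  proof (rule sum.reindex_bij_witness[of _ "\<lambda>q. q(i := z)" "\<lambda>q. q(i := t)"])
    have *: "q \<in> patch a w i (p(i := z)) \<longleftrightarrow> q i = z \<and> (\<forall>j. j \<noteq> i \<longrightarrow> lo j \<le> q j \<and> q j < hi j)" for q
    proof -
      have "q \<in> patch a w i (p(i := z)) \<longleftrightarrow> (\<forall>j. (if j = i then q i = z else lo j \<le> q j \<and> q j < hi j))"
        unfolding patch_def cell_def ibox_def mem_Collect_eq
        by (intro all_cong1) (auto simp: lo_def hi_def patch_lo_def patch_hi_def)
      then show ?thesis by auto
    qed
    have **: "q \<in> ?R \<inter> {q. q i = t} \<longleftrightarrow> q i = t \<and> (\<forall>j. j \<noteq> i \<longrightarrow> lo j \<le> q j \<and> q j < hi j)" for q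
    proof -
      have "q \<in> ?R \<inter> {q. q i = t} \<longleftrightarrow> (\<forall>j. (if j = i then q i = t else lo j \<le> q j \<and> q j < hi j))"
        using that by (auto simp: ibox_def lo_def hi_def)
      then show ?thesis by auto
    qed
    fix q
    show "q(i := t) \<in> ?R \<inter> {q. q i = t}" "(q(i := t))(i := z) = q" if "q \<in> patch a w i (p(i := z))"
      using that unfolding * ** by auto
    show "q(i := z) \<in> patch a w i (p(i := z))" "(q(i := z))(i := t) = q" if "q \<in> ?R \<inter> {q. q i = t}"
      using that unfolding * ** by auto
    show "f ((q(i := t))(i := z), i) = f (q, i)" if "q \<in> patch a w i (p(i := z))"
      using that unfolding * by (auto simp: fun_upd_idem)
  qed
  show ?thesis
  proof (cases "x = y")
    case False
    then have "x < y" using xy by simp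
    let ?F = "\<lambda>j. (\<Sum>q\<in>?R \<inter> {q. q j = hi j - 1}. f (q, j)) - (\<Sum>q\<in>?R \<inter> {q. q j = lo j}. f (q(j := q j - 1), j))"
    have cp: "real (card (patch a w i p)) = real_of_int a ^ (CARD('d) - 1)"
      using card_patch[of a w k i p, OF a w across] a by simp
    have "(\<Sum>q\<in>?R. flow_div f q) = 0"
      using R node by (intro sum.neutral) auto
    then have "0 = ?F i + (\<Sum>j\<in>UNIV - {i}. ?F j)"
      unfolding sum_ibox_flow_div by (subst (asm) sum.remove[of _ i]) auto
    moreover have "?F i = (\<Sum>q\<in>patch a w i (p(i := y)). f (q, i)) - (\<Sum>q\<in>patch a w i (p(i := x)). f (q, i))"
    proof -
      have "(\<Sum>q\<in>?R \<inter> {q. q i = hi i - 1}. f (q, i)) = (\<Sum>q\<in>?R \<inter> {q. q i = y}. f (q(i := y), i))"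
        by (intro sum.cong) (auto simp: hi_def fun_upd_idem)
      moreover have "(\<Sum>q\<in>?R \<inter> {q. q i = lo i}. f (q(i := q i - 1), i)) = (\<Sum>q\<in>?R \<inter> {q. q i = x + 1}. f (q(i := x), i))"
        by (intro sum.cong) (auto simp: lo_def)
      ultimately show ?thesis using G[of y y] G[of "x + 1" x] \<open>x < y\<close> by simp
    qed
    moreover have "\<bar>\<Sum>j\<in>UNIV - {i}. ?F j\<bar> \<le> (\<Sum>j\<in>UNIV - {i}. 2 * M * card (patch a w i p) * (real_of_int (y - x) / a))"
    proof (rule order_trans[OF sum_abs], rule sum_mono)
      fix j assume j: "j \<in> UNIV - {i}"
      \<comment> \<open>In a lateral face one side \<open>a\<close> of the patch is replaced by the
        depth \<open>y - x\<close>.\<close>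
      have face: "real (card (?R \<inter> {q. q j = c})) \<le> card (patch a w i p) * (real_of_int (y - x) / a)" for c
      proof -
        have "?R \<inter> {q. q j = c} \<subseteq> ibox (lo(j := c)) (hi(j := c + 1))"
          by (auto simp: ibox_def)
        then have "card (?R \<inter> {q. q j = c}) \<le> card (ibox (lo(j := c)) (hi(j := c + 1)))"
          by (intro card_mono) auto
        also have "\<dots> = (\<Prod>l\<in>UNIV. if l = i then nat (y - x) else if l = j then 1 else nat a)"
          unfolding card_ibox using j in_w(3) by (intro prod.cong) (auto simp: lo_def hi_def)
        also have "\<dots> = nat (y - x) * (\<Prod>l\<in>UNIV - {i}. if l = j then 1 else nat a)"
          by (subst prod.remove[of _ i]) auto
        also have "(\<Prod>l\<in>UNIV - {i}. if l = j then 1 else nat a) = nat a ^ (CARD('d) - 2)"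
          using j by (subst prod.remove[of _ j]) (auto simp: card_Diff_singleton numeral_2_eq_2)
        finally have "real (card (?R \<inter> {q. q j = c})) \<le> real (nat (y - x) * nat a ^ (CARD('d) - 2))"
          by (simp only: of_nat_le_iff)
        also have "\<dots> = real_of_int (y - x) * real_of_int a ^ (CARD('d) - 2)"
          using a \<open>x < y\<close> by simp
        also have "real_of_int a ^ (CARD('d) - 2) = card (patch a w i p) / a"
        proof -
          have "card {i, j} \<le> CARD('d)" by (intro card_mono) auto
          then have "CARD('d) - 1 = Suc (CARD('d) - 2)" using j by simp
          then show ?thesis unfolding cp using a by simp
        qed
        finally show ?thesis by (simp add: mult_ac)
      qed
      have core: "(q, j) \<in> core_edges w" and core': "(q(j := q j - 1), j) \<in> core_edges w" if "q \<in> ?R" for q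
      proof -
        have *: "0 \<le> q l" "q l < w" for l using that R by (auto simp: cube_def ibox_def)
        have "- 1 \<le> q j" "- 1 \<le> q j - 1" "q j - 1 < w" using *[of j] by linarith+
        then show "(q, j) \<in> core_edges w" "(q(j := q j - 1), j) \<in> core_edges w"
          unfolding core_edges_def using * by simp_all
      qed
      have "\<bar>\<Sum>q\<in>?R \<inter> {q. q j = hi j - 1}. f (q, j)\<bar> \<le> (\<Sum>q\<in>?R \<inter> {q. q j = hi j - 1}. M)"
        by (intro order_trans[OF sum_abs] sum_mono bound core) auto
      moreover have "\<bar>\<Sum>q\<in>?R \<inter> {q. q j = lo j}. f (q(j := q j - 1), j)\<bar> \<le> (\<Sum>q\<in>?R \<inter> {q. q j = lo j}. M)"
        by (intro order_trans[OF sum_abs] sum_mono bound core') auto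
      ultimately have "\<bar>?F j\<bar> \<le> card (?R \<inter> {q. q j = hi j - 1}) * M + card (?R \<inter> {q. q j = lo j}) * M"
        by simp
      also have "\<dots> \<le> card (patch a w i p) * (real_of_int (y - x) / a) * M + card (patch a w i p) * (real_of_int (y - x) / a) * M"
        by (intro add_mono mult_right_mono face \<open>M \<ge> 0\<close>)
      finally show "\<bar>?F j\<bar> \<le> 2 * M * card (patch a w i p) * (real_of_int (y - x) / a)"
        by (simp add: algebra_simps)
    qed
    moreover have "(\<Sum>j\<in>UNIV - {i}. 2 * M * card (patch a w i p) * (real_of_int (y - x) / a))
        \<le> 2 * CARD('d) * M * card (patch a w i p) * (real_of_int (y - x) / a)"
    proof -
      have "real (CARD('d) - 1) * (2 * M * card (patch a w i p) * (real_of_int (y - x) / a)) \<le>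
         real CARD('d) * (2 * M * card (patch a w i p) * (real_of_int (y - x) / a))"
        using \<open>M \<ge> 0\<close> a \<open>x < y\<close> by (intro mult_right_mono mult_nonneg_nonneg) auto
      then show ?thesis by (simp add: card_Diff_singleton mult_ac)
    qed
    ultimately show ?thesis by linarith
  qed (use \<open>M \<ge> 0\<close> in simp)
qed

text \<open>The layer of subcubes next to a face gives the mean flux over \<open>D\<close>
  consecutive levels. Each of them is at most \<open>D\<close> away from the end level, and
  \<open>D / a\<close> = 1/m, so \<open>patch_flux_depth\<close> replaces all of them by the end
  level at the cost \<open>2 * CARD('d) * M / m\<close> per point.\<close>

lemma patch_flux_from_subcubes:
  fixes f :: "('d::finite \<Rightarrow> int) \<times> 'd \<Rightarrow> real" and a k m D w :: int
    and M \<gamma> :: real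
  assumes "D \<ge> 1" "m \<ge> 1" and a: "a = D * m" and "k \<ge> 1" and w: "w = k * a"
    and bound: "\<And>e. e \<in> core_edges w \<Longrightarrow> \<bar>f e\<bar> \<le> M"
    and node: "\<And>p. p \<in> cube w \<Longrightarrow> flow_div f p = 0"
    and avg: "\<And>z i. z \<in> cube (k * m) \<Longrightarrow>
       \<bar>(\<Sum>q\<in>subcube D z. f (q, i)) - u i * real_of_int D ^ CARD('d)\<bar> \<le> \<gamma> * real_of_int D ^ CARD('d)"
    and across: "\<And>j. j \<noteq> i \<Longrightarrow> 0 \<le> p j \<and> p j < w"
    and end_level: "p i = - 1 \<or> p i = w - 1" and "M \<ge> 0"
  shows "\<bar>\<Sum>q\<in>patch a w i p. f (q, i) - u i\<bar> \<le> (\<gamma> + 2 * CARD('d) * M / m) * card (patch a w i p)"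
proof -
  have a1: "a \<ge> 1" using mult_mono[of 1 D 1 m] \<open>D \<ge> 1\<close> \<open>m \<ge> 1\<close> by (simp add: a)
  have km: "k * m \<ge> 1" using mult_mono[of 1 k 1 m] \<open>k \<ge> 1\<close> \<open>m \<ge> 1\<close> by simp
  have wD: "w = D * (k * m)" by (simp add: w a)
  have wD': "w \<ge> D" using mult_left_mono[OF km, of D] \<open>D \<ge> 1\<close> by (simp add: wD)
  \<comment> \<open>The layer next to the end in question: level -1 lies just below the first layer,
    level w - 1 is the top of the last one.\<close>
  define t where "t = (if p i = - 1 then 0 else k * m - 1)"
  let ?G = "\<lambda>x. \<Sum>q\<in>patch a w i (p(i := x)). f (q, i)"
  let ?c = "real (card (patch a w i p))"
  define \<alpha> where "\<alpha> = (\<lambda>j. m * (p j div a))(i := t)"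
  define \<beta> where "\<beta> = (\<lambda>j. m * (p j div a) + m)(i := t + 1)"
  let ?B = "ibox (\<lambda>j. D * \<alpha> j) (\<lambda>j. D * \<beta> j)"
  have card_x: "card (patch a w i (p(i := x))) = card (patch a w i p)" for x
    unfolding patch_upd(1)[OF a1 w] by (rule card_image[OF patch_upd(2)[OF a1 w]])
  have level: "patch a w i (p(i := x)) = {q \<in> ?B. q i = x}" if "D * t \<le> x" "x < D * t + D" for x
  proof -
    have "q \<in> patch a w i (p(i := x)) \<longleftrightarrow> (\<forall>j. (D * \<alpha> j \<le> q j \<and> q j < D * \<beta> j) \<and> (j = i \<longrightarrow> q j = x))" for q
      unfolding patch_def cell_def ibox_def mem_Collect_eq
    proof (intro all_cong1)
      fix j
      show "patch_lo a w i j ((p(i := x)) j) \<le> q j \<and> q j < patch_hi a w i j ((p(i := x)) j) \<longleftrightarrow>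
        (D * \<alpha> j \<le> q j \<and> q j < D * \<beta> j) \<and> (j = i \<longrightarrow> q j = x)"
      proof (cases "j = i")
        case True
        then show ?thesis using that by (auto simp: patch_lo_def patch_hi_def \<alpha>_def \<beta>_def algebra_simps)
      next
        case False
        then show ?thesis using across[OF False] by (simp add: patch_lo_def patch_hi_def \<alpha>_def \<beta>_def a algebra_simps)
      qed
    qed
    then show ?thesis by (auto simp: ibox_def)
  qed
  have layers: "(\<Sum>q\<in>?B. g q) = (\<Sum>x\<in>{D * t..<D * t + D}. \<Sum>q\<in>patch a w i (p(i := x)). g q)" for g :: "_ \<Rightarrow> real"
  proof -
    have "(\<Sum>q\<in>?B. g q) = (\<Sum>x\<in>{D * t..<D * t + D}. \<Sum>q\<in>{q \<in> ?B. q i = x}. g q)"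
    proof (rule sum.group[symmetric])
      show "(\<lambda>q. q i) ` ?B \<subseteq> {D * t..<D * t + D}"
      proof
        fix y assume "y \<in> (\<lambda>q. q i) ` ?B"
        then obtain q where "q \<in> ?B" "y = q i" by blast
        then have "D * \<alpha> i \<le> y" "y < D * \<beta> i" by (auto simp: ibox_def)
        then show "y \<in> {D * t..<D * t + D}" by (simp add: \<alpha>_def \<beta>_def algebra_simps)
      qed
    qed auto
    then show ?thesis by (simp add: level)
  qed
  have card_B: "real (card ?B) = D * ?c"
    using layers[of "\<lambda>_. 1"] \<open>D \<ge> 1\<close> by (simp add: card_x)
  have "\<bar>(\<Sum>q\<in>?B. f (q, i)) - u i * card ?B\<bar> \<le> \<gamma> * card ?B"
  proof (rule sum_ibox_deviation[OF \<open>D \<ge> 1\<close>], rule avg)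
    fix z assume z: "z \<in> ibox \<alpha> \<beta>"
    have "0 \<le> \<alpha> j \<and> \<beta> j \<le> k * m" for j
    proof (cases "j = i")
      case True
      then show ?thesis using km by (auto simp: \<alpha>_def \<beta>_def t_def)
    next
      case False
      have "0 \<le> p j div a" using across[OF False] a1 by (simp add: pos_imp_zdiv_nonneg_iff)
      moreover have "p j div a < k"
        using block_inside(2)[of a "p j" k] across[OF False] a1 w
        by (smt (verit, best) mult.commute mult_le_cancel_left_pos distrib_left mult.right_neutral)
      then have "m * (p j div a + 1) \<le> m * k" using \<open>m \<ge> 1\<close> by (intro mult_left_mono) auto
      ultimately show ?thesis using False \<open>m \<ge> 1\<close> by (simp add: \<alpha>_def \<beta>_def algebra_simps)
    qed
    then have "ibox \<alpha> \<beta> \<subseteq> cube (k * m)" unfolding cube_def by (intro ibox_mono) auto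
    with z show "z \<in> cube (k * m)" by blast
  qed
  moreover have "(\<Sum>q\<in>?B. f (q, i)) = (\<Sum>x\<in>{D * t..<D * t + D}. ?G x)" by (rule layers)
  moreover have "\<bar>(\<Sum>x\<in>{D * t..<D * t + D}. ?G x) - D * ?G (p i)\<bar> \<le> D * (2 * CARD('d) * M * ?c / m)"
  proof -
    have near: "\<bar>?G x - ?G (p i)\<bar> \<le> 2 * CARD('d) * M * ?c / m" if x: "x \<in> {D * t..<D * t + D}" for x
    proof -
      have "\<bar>?G x - ?G (p i)\<bar> \<le> 2 * CARD('d) * M * ?c * (D / a)"
      proof (cases "p i = - 1")
        case True
        have "\<bar>?G x - ?G (- 1)\<bar> \<le> 2 * CARD('d) * M * ?c * (real_of_int (x - (- 1)) / a)"
          using x True wD' by (intro patch_flux_depth[OF a1 w bound node across]) (auto simp: t_def \<open>M \<ge> 0\<close>)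
        also have "\<dots> \<le> 2 * CARD('d) * M * ?c * (D / a)"
          using x True \<open>M \<ge> 0\<close> a1 by (intro mult_left_mono divide_right_mono) (auto simp: t_def)
        finally show ?thesis using True by simp
      next
        case False
        then have pi: "p i = w - 1" using end_level by simp
        have t: "D * t + D = w" using False by (simp add: t_def wD algebra_simps)
        have "\<bar>?G (w - 1) - ?G x\<bar> \<le> 2 * CARD('d) * M * ?c * (real_of_int ((w - 1) - x) / a)"
          using x t wD' by (intro patch_flux_depth[OF a1 w bound node across]) (auto simp: \<open>M \<ge> 0\<close>)
        also have "\<dots> \<le> 2 * CARD('d) * M * ?c * (D / a)"
          using x t \<open>M \<ge> 0\<close> a1 by (intro mult_left_mono divide_right_mono) auto
        finally show ?thesis by (simp add: pi abs_minus_commute)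
      qed
      then show ?thesis using \<open>D \<ge> 1\<close> by (simp add: a)
    qed
    have "(\<Sum>x\<in>{D * t..<D * t + D}. ?G x) - D * ?G (p i) = (\<Sum>x\<in>{D * t..<D * t + D}. ?G x - ?G (p i))"
      using \<open>D \<ge> 1\<close> by (simp add: sum_subtractf)
    also have "\<bar>\<dots>\<bar> \<le> (\<Sum>x\<in>{D * t..<D * t + D}. 2 * CARD('d) * M * ?c / m)"
      by (rule order_trans[OF sum_abs]) (intro sum_mono near)
    finally show ?thesis using \<open>D \<ge> 1\<close> by simp
  qed
  ultimately have "\<bar>D * ?G (p i) - u i * (D * ?c)\<bar> \<le> \<gamma> * (D * ?c) + D * (2 * CARD('d) * M * ?c / m)"
    unfolding card_B by linarith
  also have "D * ?G (p i) - u i * (D * ?c) = D * (?G (p i) - u i * ?c)" by (simp add: algebra_simps)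
  also have "\<gamma> * (D * ?c) + D * (2 * CARD('d) * M * ?c / m) = D * ((\<gamma> + 2 * CARD('d) * M / m) * ?c)"
    by (simp add: algebra_simps)
  finally have "\<bar>?G (p i) - u i * ?c\<bar> \<le> (\<gamma> + 2 * CARD('d) * M / m) * ?c"
    using \<open>D \<ge> 1\<close> by (simp add: abs_mult)
  then show ?thesis by (simp add: sum_subtractf mult.commute)
qed

section \<open>Independent capacities\<close>

lemma sets_PiM_UNIV_borel:
  assumes "sets G = sets (borel :: real measure)"
  shows "sets (\<Pi>\<^sub>M j\<in>(UNIV :: 'j::countable set). G) = sets (borel :: ('j \<Rightarrow> real) measure)"
proof -
  have "sets (\<Pi>\<^sub>M j\<in>(UNIV :: 'j set). G) = sets (\<Pi>\<^sub>M j\<in>(UNIV :: 'j set). borel)"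
    by (intro sets_PiM_cong refl assms)
  then show ?thesis by (simp add: sets_PiM_equal_borel)
qed

lemma space_PiM_UNIV:
  assumes "sets G = sets (borel :: real measure)"
  shows "space (\<Pi>\<^sub>M j\<in>(UNIV :: 'j set). G) = UNIV"
  using sets_eq_imp_space_eq[OF assms] by (simp add: space_PiM PiE_UNIV_domain)

text \<open>The capacities are indexed by geometric edges, which change with the scale. Along an
  injection their law is the product measure on integer edges, so that events at different scales
  are compared in one space.\<close>

lemma measure_iid_field:
  fixes G :: "real measure" and P :: "'w measure" and t :: "'e \<Rightarrow> 'w \<Rightarrow> real" and \<phi> :: "'j::countable \<Rightarrow> 'e"
  assumes "prob_space G" and sG: "sets G = sets borel" and "prob_space P"
    and indep: "prob_space.indep_vars P (\<lambda>_. borel) t I"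
    and distr: "\<And>e. e \<in> I \<Longrightarrow> distr P borel (t e) = G"
    and \<phi>: "inj \<phi>" "range \<phi> \<subseteq> I"
    and X: "{c. \<Phi> c} \<in> sets (borel :: ('j \<Rightarrow> real) measure)"
  shows "measure P {\<omega> \<in> space P. \<Phi> (\<lambda>j. t (\<phi> j) \<omega>)} = measure (\<Pi>\<^sub>M j\<in>(UNIV :: 'j set). G) {c. \<Phi> c}"
proof -
  interpret P: prob_space P by fact
  have I: "I \<noteq> {}" using \<phi>(2) by auto
  have rv: "t e \<in> measurable P borel" if "e \<in> I" for e
    using indep that by (simp add: P.indep_vars_def)
  have sets': "sets (\<Pi>\<^sub>M j\<in>K. G) = sets (\<Pi>\<^sub>M j\<in>K. (borel :: real measure))" for K :: "'k set"
    by (intro sets_PiM_cong refl sG)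
  have "distr P (\<Pi>\<^sub>M e\<in>I. borel) (\<lambda>\<omega>. \<lambda>e\<in>I. t e \<omega>) = (\<Pi>\<^sub>M e\<in>I. distr P borel (t e))"
    using indep P.indep_vars_iff_distr_eq_PiM'[where X=t and M'="\<lambda>_. borel", OF I rv] by blast
  also have "\<dots> = (\<Pi>\<^sub>M e\<in>I. G)" by (intro PiM_cong refl distr)
  finally have 1: "distr P (\<Pi>\<^sub>M e\<in>I. borel) (\<lambda>\<omega>. \<lambda>e\<in>I. t e \<omega>) = (\<Pi>\<^sub>M e\<in>I. G)" .
  have "(\<Pi>\<^sub>M j\<in>(UNIV :: 'j set). G) = distr (\<Pi>\<^sub>M e\<in>I. G) (\<Pi>\<^sub>M j\<in>(UNIV :: 'j set). G) (\<lambda>\<omega>. \<lambda>j\<in>UNIV. \<omega> (\<phi> j))"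
    by (rule distr_PiM_reindex[symmetric]) (use assms in \<open>auto intro: inj_on_subset\<close>)
  also have "\<dots> = distr (distr P (\<Pi>\<^sub>M e\<in>I. borel) (\<lambda>\<omega>. \<lambda>e\<in>I. t e \<omega>)) (\<Pi>\<^sub>M j\<in>(UNIV :: 'j set). borel) (\<lambda>\<omega>. \<lambda>j\<in>UNIV. \<omega> (\<phi> j))"
    unfolding 1 by (intro distr_cong refl sets')
  also have "\<dots> = distr P (\<Pi>\<^sub>M j\<in>(UNIV :: 'j set). borel) ((\<lambda>\<omega>. \<lambda>j\<in>UNIV. \<omega> (\<phi> j)) \<circ> (\<lambda>\<omega>. \<lambda>e\<in>I. t e \<omega>))"
  proof (rule distr_distr)
    show "(\<lambda>\<omega>. \<lambda>j\<in>UNIV. \<omega> (\<phi> j)) \<in> measurable (\<Pi>\<^sub>M e\<in>I. borel) (\<Pi>\<^sub>M j\<in>(UNIV :: 'j set). (borel :: real measure))"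
      using \<phi>(2) by (intro measurable_restrict measurable_component_singleton) auto
    show "(\<lambda>\<omega>. \<lambda>e\<in>I. t e \<omega>) \<in> measurable P (\<Pi>\<^sub>M e\<in>I. borel)"
      by (intro measurable_restrict rv)
  qed
  also have "((\<lambda>\<omega>. \<lambda>j\<in>UNIV. \<omega> (\<phi> j)) \<circ> (\<lambda>\<omega>. \<lambda>e\<in>I. t e \<omega>)) = (\<lambda>\<omega> j. t (\<phi> j) \<omega>)"
    using \<phi>(2) by (auto simp: fun_eq_iff restrict_def)
  finally have D: "(\<Pi>\<^sub>M j\<in>(UNIV :: 'j set). G) = distr P (\<Pi>\<^sub>M j\<in>(UNIV :: 'j set). borel) (\<lambda>\<omega> j. t (\<phi> j) \<omega>)" .
  have m: "(\<lambda>\<omega> j. t (\<phi> j) \<omega>) \<in> measurable P (\<Pi>\<^sub>M j\<in>(UNIV :: 'j set). borel)"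
  proof -
    have "(\<lambda>\<omega>. \<lambda>j\<in>UNIV. t (\<phi> j) \<omega>) \<in> measurable P (\<Pi>\<^sub>M j\<in>(UNIV :: 'j set). borel)"
      using \<phi>(2) by (intro measurable_restrict rv) auto
    then show ?thesis by (simp add: restrict_def)
  qed
  show ?thesis
    unfolding D using X
    by (subst measure_distr[OF m]) (auto simp: sets_PiM_equal_borel vimage_def Int_def conj_commute intro!: arg_cong[where f="measure P"])
qed

text \<open>Used with translations: a core event has the same probability at the origin, at its
  place in the unit cube, and in every tile.\<close>

lemma measure_PiM_reindex:
  fixes G :: "real measure" and \<sigma> :: "'j::countable \<Rightarrow> 'j"
  assumes G: "prob_space G" and sG: "sets G = sets borel" and "inj \<sigma>"
    and X: "{c. \<Phi> c} \<in> sets (borel :: ('j \<Rightarrow> real) measure)"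
  shows "{c. \<Phi> (\<lambda>j. c (\<sigma> j))} \<in> sets (borel :: ('j \<Rightarrow> real) measure)"
    and "measure (\<Pi>\<^sub>M j\<in>(UNIV :: 'j set). G) {c. \<Phi> (\<lambda>j. c (\<sigma> j))} = measure (\<Pi>\<^sub>M j\<in>(UNIV :: 'j set). G) {c. \<Phi> c}"
proof -
  let ?O = "\<Pi>\<^sub>M j\<in>(UNIV :: 'j set). G"
  have m: "(\<lambda>c j. c (\<sigma> j)) \<in> measurable ?O ?O"
  proof -
    have "(\<lambda>c. \<lambda>j\<in>UNIV. c (\<sigma> j)) \<in> measurable ?O ?O"
      by (intro measurable_restrict measurable_component_singleton) auto
    then show ?thesis by (simp add: restrict_def)
  qed
  have X': "{c. \<Phi> c} \<in> sets ?O" using X by (simp add: sets_PiM_UNIV_borel[OF sG])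
  have eq: "(\<lambda>c j. c (\<sigma> j)) -` {c. \<Phi> c} \<inter> space ?O = {c. \<Phi> (\<lambda>j. c (\<sigma> j))}"
    by (simp add: space_PiM_UNIV[OF sG] vimage_def)
  show "{c. \<Phi> (\<lambda>j. c (\<sigma> j))} \<in> sets (borel :: ('j \<Rightarrow> real) measure)"
    using measurable_sets[OF m X'] by (simp only: eq sets_PiM_UNIV_borel[OF sG])
  have "distr ?O ?O (\<lambda>c. \<lambda>j\<in>UNIV. c (\<sigma> j)) = ?O"
    by (rule distr_PiM_reindex) (use assms in \<open>auto intro: inj_on_subset\<close>)
  then have D: "distr ?O ?O (\<lambda>c j. c (\<sigma> j)) = ?O" by (simp add: restrict_def)
  have "measure ?O {c. \<Phi> c} = measure (distr ?O ?O (\<lambda>c j. c (\<sigma> j))) {c. \<Phi> c}" by (simp only: D)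
  also have "\<dots> = measure ?O {c. \<Phi> (\<lambda>j. c (\<sigma> j))}"
    by (subst measure_distr[OF m X']) (simp only: eq)
  finally show "measure ?O {c. \<Phi> (\<lambda>j. c (\<sigma> j))} = measure ?O {c. \<Phi> c}" ..
qed

text \<open>Independence for disjoint sets of coordinates. That \<open>\<Phi> b\<close> depends on
  \<open>J b\<close> only is expressed by insensitivity to the other coordinates, which is easy to
  check for events that quantify over flows.\<close>

lemma measure_PiM_blocks:
  fixes G :: "real measure" and J :: "'b \<Rightarrow> 'j::countable set" and \<Phi> :: "'b \<Rightarrow> ('j \<Rightarrow> real) \<Rightarrow> bool"
  assumes G: "prob_space G" and sG: "sets G = sets borel"
    and B: "finite B" and J: "disjoint_family_on J B"
    and X: "\<And>b. b \<in> B \<Longrightarrow> {c. \<Phi> b c} \<in> sets (borel :: ('j \<Rightarrow> real) measure)"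
    and local: "\<And>b c c'. b \<in> B \<Longrightarrow> (\<And>j. j \<in> J b \<Longrightarrow> c j = c' j) \<Longrightarrow> \<Phi> b c \<longleftrightarrow> \<Phi> b c'"
  shows "measure (\<Pi>\<^sub>M j\<in>(UNIV :: 'j set). G) {c. \<forall>b\<in>B. \<Phi> b c} =
    (\<Prod>b\<in>B. measure (\<Pi>\<^sub>M j\<in>(UNIV :: 'j set). G) {c. \<Phi> b c})"
proof (cases "B = {}")
  case True
  interpret \<Omega>: prob_space "\<Pi>\<^sub>M j\<in>(UNIV :: 'j set). G" by (intro prob_space_PiM G)
  show ?thesis using \<Omega>.prob_space by (simp add: True space_PiM_UNIV[OF sG])
next
  case False
  let ?O = "\<Pi>\<^sub>M j\<in>(UNIV :: 'j set). G"
  interpret \<Omega>: prob_space ?O by (intro prob_space_PiM G)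
  have sp: "space ?O = UNIV" by (rule space_PiM_UNIV[OF sG])
  have "\<Omega>.indep_vars (\<lambda>_. G) (\<lambda>j c. c j) UNIV"
  proof (subst \<Omega>.indep_vars_iff_distr_eq_PiM')
    have "distr ?O ?O (\<lambda>x. \<lambda>i\<in>UNIV. x i) = distr ?O ?O (\<lambda>x. x)"
      by (simp add: restrict_def)
    also have "\<dots> = ?O" by (rule distr_id)
    also have "\<dots> = (\<Pi>\<^sub>M i\<in>UNIV. distr ?O G (\<lambda>c. c i))"
      by (intro PiM_cong refl distr_PiM_component[symmetric] G) auto
    finally show "distr ?O ?O (\<lambda>x. \<lambda>i\<in>UNIV. x i) = (\<Pi>\<^sub>M i\<in>UNIV. distr ?O G (\<lambda>c. c i))" .
  qed auto
  from \<Omega>.indep_vars_restrict[OF this, of B J] J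
  have ind: "\<Omega>.indep_vars (\<lambda>b. PiM (J b) (\<lambda>_. G)) (\<lambda>b c. \<lambda>j\<in>J b. c j) B" by auto
  \<comment> \<open>Filling up with 0 outside \<open>J b\<close> makes the predicate an event on the
    coordinates in \<open>J b\<close>; by locality the filling does not change its truth.\<close>
  define ext where "ext b x = (\<lambda>j. if j \<in> J b then x j else 0)" for b and x :: "'j \<Rightarrow> real"
  define A where "A b = {x \<in> space (PiM (J b) (\<lambda>_. G)). \<Phi> b (ext b x)}" for b
  have A: "A b \<in> sets (PiM (J b) (\<lambda>_. G))" if b: "b \<in> B" for b
  proof -
    have "(\<lambda>x. \<lambda>j\<in>UNIV. if j \<in> J b then x j else 0) \<in> measurable (PiM (J b) (\<lambda>_. G)) ?O"
    proof (rule measurable_restrict)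
      fix j
      show "(\<lambda>x. if j \<in> J b then x j else 0) \<in> measurable (PiM (J b) (\<lambda>_. G)) G"
      proof (cases "j \<in> J b")
        case True
        then show ?thesis by (simp add: measurable_component_singleton)
      next
        case False
        then show ?thesis using sets_eq_imp_space_eq[OF sG] by simp
      qed
    qed
    then have m: "ext b \<in> measurable (PiM (J b) (\<lambda>_. G)) ?O" by (simp add: ext_def[abs_def] restrict_def)
    have "A b = ext b -` {c. \<Phi> b c} \<inter> space (PiM (J b) (\<lambda>_. G))" by (auto simp: A_def)
    then show ?thesis
      using measurable_sets[OF m, of "{c. \<Phi> b c}"] X[OF b] by (simp add: sets_PiM_UNIV_borel[OF sG])
  qed
  have pre: "(\<lambda>c. \<lambda>j\<in>J b. c j) -` A b \<inter> space ?O = {c. \<Phi> b c}" if b: "b \<in> B" for b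
  proof -
    have "\<Phi> b (ext b (\<lambda>j\<in>J b. c j)) \<longleftrightarrow> \<Phi> b c" for c
      by (rule local[OF b]) (simp add: ext_def)
    moreover have "(\<lambda>j\<in>J b. c j) \<in> space (PiM (J b) (\<lambda>_. G))" for c
      using sets_eq_imp_space_eq[OF sG] by (simp add: space_PiM)
    ultimately show ?thesis by (auto simp: A_def sp)
  qed
  have "measure ?O (\<Inter>b\<in>B. (\<lambda>c. \<lambda>j\<in>J b. c j) -` A b \<inter> space ?O) =
      (\<Prod>b\<in>B. measure ?O ((\<lambda>c. \<lambda>j\<in>J b. c j) -` A b \<inter> space ?O))"
    by (rule \<Omega>.indep_varsD[OF ind False B order.refl]) (rule A)
  also have "(\<Inter>b\<in>B. (\<lambda>c. \<lambda>j\<in>J b. c j) -` A b \<inter> space ?O) = (\<Inter>b\<in>B. {c. \<Phi> b c})"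
    by (rule INF_cong[OF refl pre])
  also have "\<dots> = {c. \<forall>b\<in>B. \<Phi> b c}" by auto
  also have "(\<Prod>b\<in>B. measure ?O ((\<lambda>c. \<lambda>j\<in>J b. c j) -` A b \<inter> space ?O)) = (\<Prod>b\<in>B. measure ?O {c. \<Phi> b c})"
    by (intro prod.cong refl) (simp only: pre)
  finally show ?thesis .
qed

lemma measure_PiM_coordinate:
  fixes G :: "real measure"
  assumes G: "prob_space G" and sG: "sets G = sets borel" and A: "A \<in> sets borel"
  shows "{c. c j \<in> A} \<in> sets (borel :: ('j::countable \<Rightarrow> real) measure)"
    and "measure (\<Pi>\<^sub>M j\<in>(UNIV :: 'j set). G) {c. c j \<in> A} = measure G A"
proof -
  let ?O = "\<Pi>\<^sub>M j\<in>(UNIV :: 'j set). G"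
  have m: "(\<lambda>c. c j) \<in> measurable ?O G" by (rule measurable_component_singleton) simp
  have eq: "(\<lambda>c. c j) -` A \<inter> space ?O = {c. c j \<in> A}" by (simp add: space_PiM_UNIV[OF sG] vimage_def)
  show "{c. c j \<in> A} \<in> sets (borel :: ('j \<Rightarrow> real) measure)"
    using measurable_sets[OF m, of A] A by (simp only: eq sG sets_PiM_UNIV_borel[OF sG])
  have "measure G A = measure (distr ?O G (\<lambda>c. c j)) A"
    by (subst distr_PiM_component) (use G in auto)
  also have "\<dots> = measure ?O {c. c j \<in> A}"
    by (subst measure_distr[OF m]) (use A sG eq in auto)
  finally show "measure ?O {c. c j \<in> A} = measure G A" ..
qed

section \<open>Streams as flows on integer edges\<close>

text \<open>Closedness in the product topology, by compactness of the auxiliary factor.\<close>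

lemma closed_Ex_bounded:
  fixes F :: "('j::countable \<Rightarrow> real) \<Rightarrow> ('j \<Rightarrow> real) \<Rightarrow> bool"
  assumes seq: "\<And>c f c' f'. (\<And>n. F (c n) (f n)) \<Longrightarrow> (\<And>j. (\<lambda>n. c n j) \<longlonglongrightarrow> c' j) \<Longrightarrow>
      (\<And>j. (\<lambda>n. f n j) \<longlonglongrightarrow> f' j) \<Longrightarrow> F c' f'"
  shows "closed {c. \<exists>f. F c f \<and> (\<forall>j. \<bar>f j\<bar> \<le> R)}"
  unfolding closed_sequential_limits
proof (intro allI impI, elim conjE)
  fix c :: "nat \<Rightarrow> 'j \<Rightarrow> real" and c'
  assume c: "\<forall>n. c n \<in> {c. \<exists>f. F c f \<and> (\<forall>j. \<bar>f j\<bar> \<le> R)}" and lim: "c \<longlonglongrightarrow> c'"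
  from c obtain f where f: "F (c n) (f n)" "\<And>j. \<bar>f n j\<bar> \<le> R" for n by simp metis
  let ?K = "\<Pi>\<^sub>E j\<in>(UNIV :: 'j set). {- R..R}"
  have "compactin (product_topology (\<lambda>_. euclidean) UNIV) ?K"
    unfolding compactin_PiE by simp
  then have "compact ?K" by (simp add: euclidean_product_topology)
  then have "seq_compact ?K" by (simp add: compact_eq_seq_compact_metric)
  moreover have "f n \<in> ?K" for n using f(2)[of n] by (auto simp: abs_le_iff minus_le_iff)
  ultimately obtain l r where l: "l \<in> ?K" "strict_mono r" "(f \<circ> r) \<longlonglongrightarrow> l"
    unfolding seq_compact_def by metis
  have comp: "(\<lambda>n. g n j) \<longlonglongrightarrow> g' j" if "g \<longlonglongrightarrow> g'" for g :: "nat \<Rightarrow> 'j \<Rightarrow> real" and g' j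
    by (rule continuous_on_tendsto_compose[OF continuous_on_product_coordinates that]) simp_all
  have "F c' l"
  proof (rule seq)
    show "F ((c \<circ> r) n) ((f \<circ> r) n)" for n by (simp add: f)
    show "(\<lambda>n. (c \<circ> r) n j) \<longlonglongrightarrow> c' j" for j
      by (rule comp[OF LIMSEQ_subseq_LIMSEQ[OF lim l(2)]])
    show "(\<lambda>n. (f \<circ> r) n j) \<longlonglongrightarrow> l j" for j by (rule comp[OF l(3)])
  qed
  moreover have "\<bar>l j\<bar> \<le> R" for j using l(1) by (auto simp: PiE_iff abs_le_iff minus_le_iff)
  ultimately show "c' \<in> {c. \<exists>f. F c f \<and> (\<forall>j. \<bar>f j\<bar> \<le> R)}" by blast
qed

section \<open>Lattice points and edges in integer coordinates\<close>

definition pt :: "nat \<Rightarrow> ('d::finite \<Rightarrow> int) \<Rightarrow> real ^ 'd" where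
  "pt n p = (\<chi> i. real_of_int (p i) / real n)"

definition edge :: "nat \<Rightarrow> ('d::finite \<Rightarrow> int) \<times> 'd \<Rightarrow> (real ^ 'd) set" where
  "edge n = (\<lambda>(p, i). {pt n p, pt n (p(i := p i + 1))})"

text \<open>\<open>- (int n div 2)\<close> is the least integer not below -n/2, so this describes
  the half-open cube for both parities of \<open>n\<close>.\<close>

definition base :: "nat \<Rightarrow> ('d \<Rightarrow> int) set" where
  "base n = ibox (\<lambda>_. - (int n div 2)) (\<lambda>_. - (int n div 2) + int n)"

lemma pt_nth [simp]: "pt n p $ i = real_of_int (p i) / real n"
  by (simp add: pt_def)

lemma pt_eq_iff [simp]: "n \<ge> 1 \<Longrightarrow> pt n p = pt n q \<longleftrightarrow> p = q"
  by (auto simp: vec_eq_iff fun_eq_iff)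

lemma lattice_eq: "lattice n = range (pt n :: ('d::finite \<Rightarrow> int) \<Rightarrow> real ^ 'd)"
proof (intro equalityI subsetI)
  fix x :: "real ^ 'd" assume "x \<in> lattice n"
  then obtain z where z: "x = z /\<^sub>R real n" "\<And>i. z $ i \<in> \<int>"
    by (auto simp: lattice_def int_vectors_def)
  from z(2) have "\<exists>k. z $ i = real_of_int k" for i by (metis Ints_cases)
  then obtain p where p: "\<And>i. z $ i = real_of_int (p i)" by metis
  have "x = pt n p" by (simp add: z(1) vec_eq_iff p field_simps)
  then show "x \<in> range (pt n)" by blast
next
  fix x :: "real ^ 'd" assume "x \<in> range (pt n)"
  then obtain p where p: "x = pt n p" by blast
  have "x = (\<chi> i. real_of_int (p i)) /\<^sub>R real n" by (simp add: p vec_eq_iff field_simps)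
  moreover have "(\<chi> i. real_of_int (p i)) \<in> int_vectors" by (simp add: int_vectors_def)
  ultimately show "x \<in> lattice n" by (auto simp: lattice_def)
qed

lemma pt_in_unit_cube:
  assumes "n \<ge> 1"
  shows "pt n p \<in> unit_cube \<longleftrightarrow> p \<in> base n"
proof -
  have "- 1 / 2 \<le> real_of_int x / real n \<and> real_of_int x / real n < 1 / 2 \<longleftrightarrow>
      - (int n div 2) \<le> x \<and> x < - (int n div 2) + int n" for x
  proof -
    have "- 1 / 2 \<le> real_of_int x / real n \<longleftrightarrow> - real n \<le> 2 * real_of_int x"
      "real_of_int x / real n < 1 / 2 \<longleftrightarrow> 2 * real_of_int x < real n"
      using assms by (auto simp: field_simps)
    moreover have "- real n \<le> 2 * real_of_int x \<longleftrightarrow> - int n \<le> 2 * x"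
      "2 * real_of_int x < real n \<longleftrightarrow> 2 * x < int n" by linarith+
    moreover have "- int n \<le> 2 * x \<longleftrightarrow> - (int n div 2) \<le> x"
      "2 * x < int n \<longleftrightarrow> x < - (int n div 2) + int n" by presburger+
    ultimately show ?thesis by simp
  qed
  then show ?thesis by (simp add: unit_cube_def base_def ibox_def)
qed

lemma pt_up: "n \<ge> 1 \<Longrightarrow> pt n (p(i := p i + 1)) = pt n p + (1 / real n) *\<^sub>R axis i 1"
  by (simp add: vec_eq_iff axis_def field_simps)

lemma pt_down: "n \<ge> 1 \<Longrightarrow> pt n (p(i := p i - 1)) = pt n p - (1 / real n) *\<^sub>R axis i 1"
  by (simp add: vec_eq_iff axis_def field_simps)

lemma int_unit_vector:
  fixes x :: "'d::finite \<Rightarrow> int"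
  assumes "(\<Sum>i\<in>UNIV. (x i)\<^sup>2) = 1"
  obtains i where "x i = 1 \<or> x i = - 1" "\<And>j. j \<noteq> i \<Longrightarrow> x j = 0"
proof -
  have "\<exists>i. x i \<noteq> 0"
  proof (rule ccontr)
    assume "\<not> (\<exists>i. x i \<noteq> 0)"
    then show False using assms by simp
  qed
  then obtain i where i: "x i \<noteq> 0" by blast
  have "(x i)\<^sup>2 \<ge> 1" using i by (simp add: int_one_le_iff_zero_less)
  moreover have split: "(\<Sum>j\<in>UNIV. (x j)\<^sup>2) = (x i)\<^sup>2 + (\<Sum>j\<in>UNIV - {i}. (x j)\<^sup>2)"
    by (rule sum.remove) auto
  moreover have "(\<Sum>j\<in>UNIV - {i}. (x j)\<^sup>2) \<ge> 0" by (intro sum_nonneg) simp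
  ultimately have *: "(x i)\<^sup>2 = 1" "(\<Sum>j\<in>UNIV - {i}. (x j)\<^sup>2) = 0" using assms by linarith+
  show ?thesis
  proof (rule that[of i])
    show "x i = 1 \<or> x i = - 1" using *(1) by (simp add: power2_eq_1_iff)
    show "x j = 0" if "j \<noteq> i" for j
      using *(2) that by (subst (asm) sum_nonneg_eq_0_iff) auto
  qed
qed

lemma dist_pt:
  fixes p q :: "'d::finite \<Rightarrow> int"
  assumes "n \<ge> 1"
  shows "dist (pt n p) (pt n q) = 1 / real n \<longleftrightarrow> (\<exists>i. q = p(i := p i + 1) \<or> q = p(i := p i - 1))"
proof
  assume "dist (pt n p) (pt n q) = 1 / real n"
  then have "(dist (pt n p) (pt n q))\<^sup>2 = (1 / real n)\<^sup>2" by simp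
  then have "(\<Sum>i\<in>UNIV. (real_of_int (p i) / real n - real_of_int (q i) / real n)\<^sup>2) = (1 / real n)\<^sup>2"
    by (simp add: dist_vec_def L2_set_def dist_real_def sum_nonneg)
  then have "(\<Sum>i\<in>UNIV. (real_of_int (q i - p i))\<^sup>2) / (real n)\<^sup>2 = 1 / (real n)\<^sup>2"
    by (simp add: diff_divide_distrib[symmetric] power_divide sum_divide_distrib[symmetric] power2_commute)
  then have "(\<Sum>i\<in>UNIV. (real_of_int (q i - p i))\<^sup>2) = 1" using assms by simp
  then have "real_of_int (\<Sum>i\<in>UNIV. (q i - p i)\<^sup>2) = 1" by simp
  then have "(\<Sum>i\<in>UNIV. (q i - p i)\<^sup>2) = 1" by linarith
  then obtain i where i: "q i - p i = 1 \<or> q i - p i = - 1" "\<And>j. j \<noteq> i \<Longrightarrow> q j - p j = 0"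
    by (rule int_unit_vector) blast
  have "q = p(i := q i)" using i(2) by (auto simp: fun_eq_iff)
  moreover have "q i = p i + 1 \<or> q i = p i - 1" using i(1) by linarith
  ultimately show "\<exists>i. q = p(i := p i + 1) \<or> q = p(i := p i - 1)" by metis
next
  assume "\<exists>i. q = p(i := p i + 1) \<or> q = p(i := p i - 1)"
  then show "dist (pt n p) (pt n q) = 1 / real n"
    using assms by (auto simp: pt_up pt_down dist_norm norm_axis_1)
qed

lemma pair_in_edges:
  fixes p :: "'d::finite \<Rightarrow> int"
  assumes "n \<ge> 1"
  shows "{pt n p, y} \<in> edges n \<longleftrightarrow> (\<exists>i. y = pt n (p(i := p i + 1)) \<or> y = pt n (p(i := p i - 1)))"
proof
  assume "{pt n p, y} \<in> edges n"
  then obtain x' y' where *: "{pt n p, y} = {x', y'}" "x' \<in> lattice n" "y' \<in> lattice n" "dist x' y' = 1 / real n"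
    by (auto simp: edges_def)
  have "y \<in> lattice n \<and> dist (pt n p) y = 1 / real n"
    using * by (auto simp: doubleton_eq_iff dist_commute)
  then obtain q where "y = pt n q" "dist (pt n p) (pt n q) = 1 / real n"
    by (auto simp: lattice_eq)
  then obtain i where "q = p(i := p i + 1) \<or> q = p(i := p i - 1)"
    using dist_pt[OF assms, of p q] by blast
  then show "\<exists>i. y = pt n (p(i := p i + 1)) \<or> y = pt n (p(i := p i - 1))"
    using \<open>y = pt n q\<close> by blast
next
  assume "\<exists>i. y = pt n (p(i := p i + 1)) \<or> y = pt n (p(i := p i - 1))"
  then obtain q where q: "y = pt n q" "\<exists>i. q = p(i := p i + 1) \<or> q = p(i := p i - 1)" by metis
  then have "dist (pt n p) (pt n q) = 1 / real n" using dist_pt[OF assms] by blast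
  then show "{pt n p, y} \<in> edges n"
    unfolding edges_def using q(1) by (auto simp: lattice_eq)
qed

lemma edge_down: "edge n (p(i := p i - 1), i) = {pt n p, pt n (p(i := p i - 1))}"
  by (auto simp: edge_def)

lemma edges_eq:
  assumes "n \<ge> 1"
  shows "edges n = range (edge n :: ('d::finite \<Rightarrow> int) \<times> 'd \<Rightarrow> (real ^ 'd) set)"
proof (intro equalityI subsetI)
  fix e :: "(real ^ 'd) set" assume e: "e \<in> edges n"
  then obtain p y where py: "e = {pt n p, y}" by (auto simp: edges_def lattice_eq)
  then obtain i where "y = pt n (p(i := p i + 1)) \<or> y = pt n (p(i := p i - 1))"
    using e pair_in_edges[OF assms, of p y] by auto
  then have "e = edge n (p, i) \<or> e = edge n (p(i := p i - 1), i)"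
    unfolding edge_down by (auto simp: py edge_def)
  then show "e \<in> range (edge n)" by blast
next
  fix e :: "(real ^ 'd) set" assume "e \<in> range (edge n)"
  then obtain p i where "e = {pt n p, pt n (p(i := p i + 1))}" by (auto simp: edge_def)
  then show "e \<in> edges n" using pair_in_edges[OF assms] by blast
qed

lemma inj_edge:
  assumes "n \<ge> 1"
  shows "inj (edge n :: ('d::finite \<Rightarrow> int) \<times> 'd \<Rightarrow> (real ^ 'd) set)"
proof (rule injI)
  fix e e' :: "('d \<Rightarrow> int) \<times> 'd" assume eq: "edge n e = edge n e'"
  obtain p i q j where e: "e = (p, i)" "e' = (q, j)" by force
  have "p = q \<and> p(i := p i + 1) = q(j := q j + 1) \<or> p = q(j := q j + 1) \<and> p(i := p i + 1) = q"
    using eq assms by (auto simp: e edge_def doubleton_eq_iff)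
  then show "e = e'"
  proof
    assume *: "p = q \<and> p(i := p i + 1) = q(j := q j + 1)"
    then have "p i + 1 = (p(j := p j + 1)) i" by (metis fun_upd_same)
    then have "i = j" by (auto simp: fun_upd_def split: if_splits)
    with * show ?thesis by (simp add: e)
  next
    assume *: "p = q(j := q j + 1) \<and> p(i := p i + 1) = q"
    then have "p i + 1 = q i" "q i \<le> p i" by (metis fun_upd_same, auto)
    then show ?thesis by simp
  qed
qed

lemma center_edge:
  assumes "n \<ge> 1"
  shows "center (edge n (p, i)) = pt n p + (1 / (2 * real n)) *\<^sub>R axis i 1"
proof -
  have "p \<noteq> p(i := p i + 1)" by (metis fun_upd_same add_cancel_left_right zero_neq_one)
  then have "pt n p \<noteq> pt n (p(i := p i + 1))" using assms by simp
  then have "center (edge n (p, i)) = (1 / 2) *\<^sub>R (pt n p + pt n (p(i := p i + 1)))"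
    by (simp add: center_def edge_def)
  then show ?thesis using assms by (simp add: pt_up vec_eq_iff axis_def field_simps)
qed

definition visible_edges :: "nat \<Rightarrow> (('d::finite \<Rightarrow> int) \<times> 'd) set" where
  "visible_edges n = {e. center (edge n e) \<in> unit_cube}"

text \<open>For odd \<open>n\<close> an edge from level - (n div 2) - 1 in its own direction can
  have its center exactly on the closed lower face; this is the additional layer.\<close>

lemma visible_edges_subset:
  assumes "n \<ge> 1"
  shows "(visible_edges n :: (('d::finite \<Rightarrow> int) \<times> 'd) set) \<subseteq> ibox (\<lambda>_. - (int n div 2) - 1) (\<lambda>_. - (int n div 2) + int n) \<times> UNIV"
proof
  fix e :: "('d \<Rightarrow> int) \<times> 'd" assume "e \<in> visible_edges n"
  moreover obtain p i where e: "e = (p, i)" by force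
  ultimately have v: "- 1 / 2 \<le> center (edge n (p, i)) $ j" "center (edge n (p, i)) $ j < 1 / 2" for j
    by (auto simp: visible_edges_def unit_cube_def)
  have "- (int n div 2) - 1 \<le> p j \<and> p j < - (int n div 2) + int n" for j
  proof -
    have "center (edge n (p, i)) $ j = (2 * real_of_int (p j) + (if i = j then 1 else 0)) / (2 * real n)"
      using assms by (simp add: center_edge axis_def field_simps)
    with v[of j] have "- real n \<le> 2 * real_of_int (p j) + (if i = j then 1 else 0)"
      "2 * real_of_int (p j) + (if i = j then 1 else 0) < real n"
      using assms by (auto simp: field_simps split: if_splits)
    then have "- int n \<le> 2 * p j + 1" "2 * p j < int n" by (auto split: if_splits)
    moreover have "2 * (int n div 2) \<le> int n" "int n \<le> 2 * (int n div 2) + 1" by simp_all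
    ultimately show ?thesis by linarith
  qed
  then show "e \<in> ibox (\<lambda>_. - (int n div 2) - 1) (\<lambda>_. - (int n div 2) + int n) \<times> UNIV"
    by (simp add: e ibox_def)
qed

lemma finite_visible_edges: "n \<ge> 1 \<Longrightarrow> finite (visible_edges n :: (('d::finite \<Rightarrow> int) \<times> 'd) set)"
  by (rule finite_subset[OF visible_edges_subset]) auto

section \<open>Streams as scalar flows: measure, node law, admissibility\<close>

definition flow_measure ::
    "nat \<Rightarrow> (('d::finite \<Rightarrow> int) \<times> 'd \<Rightarrow> real) \<Rightarrow> (real ^ 'd) set \<Rightarrow> real ^ 'd" where
  "flow_measure n f A = (1 / real n ^ CARD('d)) *\<^sub>R
     (\<Sum>e\<in>visible_edges n. (indicator A (center (edge n e)) * f e) *\<^sub>R axis (snd e) 1)"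

text \<open>The node law is imposed where all lower neighbours lie in \<open>base n\<close>; there
  every edge at the node starts in \<open>base n\<close> and has a capacity constraint.\<close>

definition admissible_flow ::
    "nat \<Rightarrow> (('d::finite \<Rightarrow> int) \<times> 'd \<Rightarrow> real) \<Rightarrow> (('d \<Rightarrow> int) \<times> 'd \<Rightarrow> real) \<Rightarrow> bool" where
  "admissible_flow n c f \<longleftrightarrow> (\<forall>p\<in>base n. \<forall>i. \<bar>f (p, i)\<bar> \<le> c (p, i)) \<and>
     (\<forall>p\<in>base n. (\<forall>i. p(i := p i - 1) \<in> base n) \<longrightarrow> flow_div f p = 0)"

lemma stream_measure_flow:
  fixes f :: "('d::finite \<Rightarrow> int) \<times> 'd \<Rightarrow> real"
  assumes n: "n \<ge> 1" and F: "\<And>e. F (edge n e) = f e *\<^sub>R axis (snd e) 1"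
  shows "restrict_vmeasure (stream_measure n F) unit_cube = flow_measure n f"
proof
  fix A :: "(real ^ 'd) set"
  have "(\<Sum>\<^sub>\<infinity>e\<in>edges n. indicator (A \<inter> unit_cube) (center e) *\<^sub>R F e) =
      (\<Sum>\<^sub>\<infinity>e\<in>edge n ` visible_edges n. indicator (A \<inter> unit_cube) (center e) *\<^sub>R F e)"
  proof (rule infsum_cong_neutral)
    fix e :: "(real ^ 'd) set" assume "e \<in> edges n - edge n ` visible_edges n"
    then have "center e \<notin> unit_cube" by (auto simp: edges_eq[OF n] visible_edges_def)
    then show "indicator (A \<inter> unit_cube) (center e) *\<^sub>R F e = 0" by simp
  qed (auto simp: edges_eq[OF n])
  also have "\<dots> = (\<Sum>e\<in>edge n ` visible_edges n. indicator (A \<inter> unit_cube) (center e) *\<^sub>R F e)"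
    by (rule infsum_finite) (use finite_visible_edges[OF n] in auto)
  also have "\<dots> = (\<Sum>e\<in>visible_edges n. indicator (A \<inter> unit_cube) (center (edge n e)) *\<^sub>R F (edge n e))"
    by (subst sum.reindex[OF inj_on_subset[OF inj_edge[OF n] subset_UNIV]]) simp
  also have "\<dots> = (\<Sum>e\<in>visible_edges n. (indicator A (center (edge n e)) * f e) *\<^sub>R axis (snd e) 1)"
    by (intro sum.cong refl) (auto simp: F visible_edges_def indicator_def)
  finally show "restrict_vmeasure (stream_measure n F) unit_cube A = flow_measure n f A"
    by (simp add: restrict_vmeasure_def stream_measure_def flow_measure_def)
qed

lemma node_law_flow:
  fixes f :: "('d::finite \<Rightarrow> int) \<times> 'd \<Rightarrow> real"
  assumes n: "n \<ge> 1" and F: "\<And>e. F (edge n e) = f e *\<^sub>R axis (snd e) 1"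
  shows "node_law n F (pt n p) \<longleftrightarrow> flow_div f p = 0"
proof -
  let ?u = "\<lambda>i. pt n (p(i := p i + 1))" and ?d = "\<lambda>i. pt n (p(i := p i - 1))"
  have S: "{y. {pt n p, y} \<in> edges n} = range ?u \<union> range ?d"
    using pair_in_edges[OF n, of p] by auto
  have upd: "p(i := x) = p(j := y) \<longleftrightarrow> i = j \<and> x = y" if "x \<noteq> p i" "y \<noteq> p j" for i j x y
    using that by (metis fun_upd_apply)
  have disj: "range ?u \<inter> range ?d = {}" using n by (auto simp: upd)
  have inj: "inj ?u" "inj ?d" using n by (auto intro!: injI simp: upd)
  have "(\<Sum>y | {pt n p, y} \<in> edges n. F {pt n p, y} \<bullet> (y - pt n p)) =
     (\<Sum>i\<in>UNIV. F {pt n p, ?u i} \<bullet> (?u i - pt n p)) + (\<Sum>i\<in>UNIV. F {pt n p, ?d i} \<bullet> (?d i - pt n p))"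
    unfolding S by (subst sum.union_disjoint[OF _ _ disj]) (simp_all add: sum.reindex[OF inj(1)] sum.reindex[OF inj(2)])
  also have "\<dots> = (\<Sum>i\<in>UNIV. f (p, i) / real n) + (\<Sum>i\<in>UNIV. - f (p(i := p i - 1), i) / real n)"
  proof (intro arg_cong2[where f="(+)"] sum.cong refl)
    fix i
    show "F {pt n p, ?u i} \<bullet> (?u i - pt n p) = f (p, i) / real n"
      using F[of "(p, i)"] n by (simp add: edge_def pt_up inner_axis_axis)
    show "F {pt n p, ?d i} \<bullet> (?d i - pt n p) = - f (p(i := p i - 1), i) / real n"
      using F[of "(p(i := p i - 1), i)"] n unfolding edge_down by (simp add: pt_down inner_axis_axis)
  qed
  also have "\<dots> = flow_div f p / real n"
    by (simp add: flow_div_def sum_divide_distrib sum.distrib[symmetric] diff_divide_distrib)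
  finally show ?thesis using n by (simp add: node_law_def)
qed

lemma admissible_streams_flow:
  fixes f :: "('d::finite \<Rightarrow> int) \<times> 'd \<Rightarrow> real"
  assumes n: "n \<ge> 1" and F: "\<And>e. F (edge n e) = f e *\<^sub>R axis (snd e) 1"
  shows "F \<in> admissible_streams n unit_cube t \<longleftrightarrow> admissible_flow n (\<lambda>e. t (edge n e)) f"
proof -
  have stream: "is_stream n F"
    unfolding is_stream_def
  proof (intro allI impI)
    fix x y :: "real ^ 'd" assume xy: "{x, y} \<in> edges n"
    then obtain p i where e: "{x, y} = edge n (p, i)" by (auto simp: edges_eq[OF n])
    then have "F {x, y} = f (p, i) *\<^sub>R axis i 1" by (simp add: F)
    moreover have "y - x = (1 / real n) *\<^sub>R axis i 1 \<or> y - x = - (1 / real n) *\<^sub>R axis i 1"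
      using e n by (auto simp: edge_def doubleton_eq_iff pt_up)
    ultimately show "\<exists>c. F {x, y} = c *\<^sub>R (y - x)"
      using n by (elim disjE) (auto intro: exI[of _ "real n * f (p, i)"] exI[of _ "- (real n * f (p, i))"])
  qed
  have cap: "(\<forall>x y i. {x, y} \<in> edges n \<and> x \<in> unit_cube \<and> y - x = (1 / real n) *\<^sub>R axis i 1
        \<longrightarrow> norm (F {x, y}) \<le> t {x, y}) \<longleftrightarrow> (\<forall>p\<in>base n. \<forall>i. \<bar>f (p, i)\<bar> \<le> t (edge n (p, i)))" (is "?L = ?R")
  proof
    assume L: ?L
    show ?R
    proof (intro ballI allI)
      fix p :: "'d \<Rightarrow> int" and i assume p: "p \<in> base n"
      have "{pt n p, pt n (p(i := p i + 1))} \<in> edges n" using pair_in_edges[OF n] by blast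
      moreover have "pt n (p(i := p i + 1)) - pt n p = (1 / real n) *\<^sub>R axis i 1" using n by (simp add: pt_up)
      moreover have "pt n p \<in> unit_cube" using p n by (simp add: pt_in_unit_cube)
      ultimately have "norm (F {pt n p, pt n (p(i := p i + 1))}) \<le> t {pt n p, pt n (p(i := p i + 1))}"
        using L by blast
      then have "norm (F (edge n (p, i))) \<le> t (edge n (p, i))"
        by (simp add: edge_def)
      then show "\<bar>f (p, i)\<bar> \<le> t (edge n (p, i))" by (simp add: F norm_axis_1)
    qed
  next
    assume R: ?R
    show ?L
    proof (intro allI impI, elim conjE)
      fix x y :: "real ^ 'd" and i
      assume xy: "{x, y} \<in> edges n" "x \<in> unit_cube" "y - x = (1 / real n) *\<^sub>R axis i 1"
      from xy(1) have "x \<in> lattice n" by (auto simp: edges_def doubleton_eq_iff)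
      then obtain p where p: "x = pt n p" by (auto simp: lattice_eq)
      have "y = pt n p + (1 / real n) *\<^sub>R axis i 1" using xy(3) by (simp add: p algebra_simps)
      then have "y = pt n (p(i := p i + 1))" by (simp only: pt_up[OF n])
      then have "{x, y} = edge n (p, i)" by (simp add: edge_def p)
      moreover have "p \<in> base n" using xy(2) n by (simp add: p pt_in_unit_cube)
      ultimately show "norm (F {x, y}) \<le> t {x, y}" using R by (simp add: F norm_axis_1)
    qed
  qed
  have node: "(\<forall>x\<in>lattice n \<inter> unit_cube. (\<forall>i. x - (1 / real n) *\<^sub>R axis i 1 \<in> unit_cube) \<longrightarrow> node_law n F x)
      \<longleftrightarrow> (\<forall>p\<in>base n. (\<forall>i. p(i := p i - 1) \<in> base n) \<longrightarrow> flow_div f p = 0)"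
  proof -
    have "(\<forall>x\<in>lattice n \<inter> unit_cube. (\<forall>i. x - (1 / real n) *\<^sub>R axis i 1 \<in> unit_cube) \<longrightarrow> node_law n F x) \<longleftrightarrow>
       (\<forall>p. pt n p \<in> unit_cube \<longrightarrow> (\<forall>i. pt n p - (1 / real n) *\<^sub>R axis i 1 \<in> unit_cube) \<longrightarrow> node_law n F (pt n p))"
      unfolding lattice_eq by blast
    also have "\<dots> \<longleftrightarrow> (\<forall>p\<in>base n. (\<forall>i. p(i := p i - 1) \<in> base n) \<longrightarrow> flow_div f p = 0)"
      unfolding pt_down[OF n, symmetric] pt_in_unit_cube[OF n] node_law_flow[OF n F] by blast
    finally show ?thesis .
  qed
  show ?thesis
    unfolding admissible_streams_def mem_Collect_eq admissible_flow_def using stream cap node by blast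
qed

text \<open>By collinearity a stream is, on \<open>edges n\<close>, a scalar times the positive unit
  vector of the edge, and both sides read it only there.\<close>

lemma ex_admissible_stream_iff:
  assumes n: "n \<ge> 1"
  shows "(\<exists>F\<in>admissible_streams n unit_cube t. Q (restrict_vmeasure (stream_measure n F) unit_cube)) \<longleftrightarrow>
    (\<exists>f :: ('d::finite \<Rightarrow> int) \<times> 'd \<Rightarrow> real. admissible_flow n (\<lambda>e. t (edge n e)) f \<and> Q (flow_measure n f))"
    (is "?L = ?R")
proof
  assume ?L
  then obtain F where F: "F \<in> admissible_streams n unit_cube t"
    "Q (restrict_vmeasure (stream_measure n F) unit_cube)" by blast
  define f where "f e = F (edge n e) $ snd e" for e :: "('d \<Rightarrow> int) \<times> 'd"
  have "F (edge n e) = f e *\<^sub>R axis (snd e) 1" for e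
  proof -
    obtain p i where e: "e = (p, i)" by force
    have "is_stream n F" using F(1) by (simp add: admissible_streams_def)
    moreover have "{pt n p, pt n (p(i := p i + 1))} \<in> edges n" using pair_in_edges[OF n] by blast
    ultimately obtain c where "F (edge n e) = c *\<^sub>R (pt n (p(i := p i + 1)) - pt n p)"
      unfolding is_stream_def by (auto simp: e edge_def)
    then have "F (edge n e) = (c / real n) *\<^sub>R axis i 1" using n by (simp add: pt_up)
    then show ?thesis by (simp add: f_def e axis_def)
  qed
  from admissible_streams_flow[OF n this] stream_measure_flow[OF n this] F show ?R by metis
next
  assume ?R
  then obtain f :: "('d \<Rightarrow> int) \<times> 'd \<Rightarrow> real" where f: "admissible_flow n (\<lambda>e. t (edge n e)) f" "Q (flow_measure n f)" by blast
  define F where "F E = (let e = inv (edge n) E in f e *\<^sub>R axis (snd e) 1 :: real ^ 'd)" for E :: "(real ^ 'd) set"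
  have "F (edge n e) = f e *\<^sub>R axis (snd e) 1" for e
    by (simp add: F_def inv_f_f[OF inj_edge[OF n]])
  from admissible_streams_flow[OF n this] stream_measure_flow[OF n this] f show ?L by metis
qed

section \<open>The distance between a stream and its target\<close>

definition hbox :: "real ^ 'd \<Rightarrow> real ^ 'd \<Rightarrow> (real ^ 'd) set" where
  "hbox a b = {y. \<forall>i. a $ i \<le> y $ i \<and> y $ i < b $ i}"

lemma unit_cube_eq_hbox: "unit_cube = hbox (\<chi> i. - 1 / 2) (\<chi> i. 1 / 2)"
  by (simp add: unit_cube_def hbox_def)

lemma hbox_borel [measurable]: "hbox a (b :: real ^ 'd::finite) \<in> sets borel"
proof -
  have "hbox a b = (\<Inter>i. {y. a $ i \<le> y $ i} \<inter> {y. y $ i < b $ i})" by (auto simp: hbox_def)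
  also have "\<dots> \<in> sets borel"
    by (intro sets.countable_INT'' sets.Int borel_closed borel_open closed_halfspace_component_ge_cart open_halfspace_component_lt_cart) auto
  finally show ?thesis .
qed

lemma hbox_mono: "(\<And>i. a' $ i \<le> a $ i) \<Longrightarrow> (\<And>i. b $ i \<le> b' $ i) \<Longrightarrow> hbox a b \<subseteq> hbox a' b'"
  unfolding hbox_def by (blast intro: order.trans order.strict_trans2)

lemma emeasure_hbox:
  fixes a b :: "real ^ 'd::finite"
  assumes "\<And>i. a $ i \<le> b $ i"
  shows "emeasure lborel (hbox a b) = ennreal (\<Prod>i\<in>UNIV. b $ i - a $ i)"
proof (rule antisym)
  have le: "\<forall>c\<in>Basis. a \<bullet> c \<le> b \<bullet> c" using assms by (auto simp: Basis_vec_def inner_axis)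
  have prod: "(\<Prod>c\<in>Basis. (b - a) \<bullet> c) = (\<Prod>i\<in>UNIV. b $ i - a $ i)"
  proof -
    have "(\<Prod>c\<in>Basis. (b - a) \<bullet> c) = (\<Prod>c\<in>(\<lambda>i. axis i 1) ` UNIV. (b - a) \<bullet> c)"
      by (intro prod.cong refl) (auto simp: Basis_vec_def)
    also have "\<dots> = (\<Prod>i\<in>UNIV. b $ i - a $ i)"
      by (subst prod.reindex) (auto simp: inj_on_def axis_eq_axis inner_axis)
    finally show ?thesis .
  qed
  have "hbox a b \<subseteq> cbox a b" by (auto simp: hbox_def mem_box_cart less_imp_le)
  then have "emeasure lborel (hbox a b) \<le> emeasure lborel (cbox a b)" by (intro emeasure_mono) auto
  then show "emeasure lborel (hbox a b) \<le> ennreal (\<Prod>i\<in>UNIV. b $ i - a $ i)"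
    using le by (simp add: emeasure_lborel_cbox_eq prod)
  have "box a b \<subseteq> hbox a b" by (auto simp: hbox_def mem_box_cart less_imp_le)
  then have "emeasure lborel (box a b) \<le> emeasure lborel (hbox a b)" by (intro emeasure_mono) auto
  then show "ennreal (\<Prod>i\<in>UNIV. b $ i - a $ i) \<le> emeasure lborel (hbox a b)"
    using le by (simp add: emeasure_lborel_box_eq prod)
qed

lemma measure_hbox:
  fixes a b :: "real ^ 'd::finite"
  assumes "\<And>i. a $ i \<le> b $ i"
  shows "measure lborel (hbox a b) = (\<Prod>i\<in>UNIV. b $ i - a $ i)"
  using emeasure_hbox[OF assms] assms by (simp add: measure_def prod_nonneg)

abbreviation target :: "real ^ 'd::finite \<Rightarrow> (real ^ 'd) set \<Rightarrow> real ^ 'd" where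
  "target w \<equiv> density_vmeasure (\<lambda>x. indicator unit_cube x *\<^sub>R w)"

lemma emeasure_unit_cube_subset:
  assumes "A \<in> sets borel"
  shows "emeasure lborel (A \<inter> unit_cube :: (real ^ 'd::finite) set) < \<infinity>"
proof -
  have "emeasure lborel (A \<inter> unit_cube) \<le> emeasure lborel (unit_cube :: (real ^ 'd) set)"
    by (intro emeasure_mono) (auto simp: unit_cube_eq_hbox)
  also have "\<dots> = ennreal 1" unfolding unit_cube_eq_hbox by (subst emeasure_hbox) auto
  finally show ?thesis by (auto simp: less_top[symmetric] top_unique)
qed

lemma target_eq:
  assumes "A \<in> sets borel"
  shows "target w A = measure lborel (A \<inter> unit_cube) *\<^sub>R w"
proof -
  have "target w A = (LINT x|lborel. indicator (A \<inter> unit_cube) x *\<^sub>R w)"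
    by (simp add: density_vmeasure_def set_lebesgue_integral_def indicator_inter_arith)
  also have "\<dots> = measure lborel (A \<inter> unit_cube) *\<^sub>R w"
    by (intro has_bochner_integral_integral_eq has_bochner_integral_indicator emeasure_unit_cube_subset assms)
       (use assms in \<open>auto simp: unit_cube_eq_hbox\<close>)
  finally show ?thesis .
qed

lemma target_disjoint: "A \<inter> unit_cube = {} \<Longrightarrow> target w A = 0"
proof -
  assume *: "A \<inter> unit_cube = {}"
  have "(\<lambda>x. indicator A x *\<^sub>R indicator unit_cube x *\<^sub>R w) = (\<lambda>_. 0)"
    using * by (auto simp: indicator_def fun_eq_iff)
  then show ?thesis unfolding density_vmeasure_def set_lebesgue_integral_def by simp
qed

lemma flow_measure_disjoint: "A \<inter> unit_cube = {} \<Longrightarrow> flow_measure n f A = (0 :: real ^ 'd::finite)"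
proof -
  assume *: "A \<inter> unit_cube = {}"
  have "(indicator A (center (edge n e)) * f e) *\<^sub>R axis (snd e) 1 = (0 :: real ^ 'd)" if "e \<in> visible_edges n" for e
    using * that by (auto simp: indicator_def visible_edges_def)
  then have "(\<Sum>e\<in>visible_edges n. (indicator A (center (edge n e)) * f e) *\<^sub>R axis (snd e) 1) = (0 :: real ^ 'd)"
    by (intro sum.neutral) blast
  then show ?thesis by (simp add: flow_measure_def)
qed

section \<open>The cells of the translated grids and the distance as finite sums\<close>

definition hcell :: "real \<Rightarrow> real ^ 'd \<Rightarrow> ('d \<Rightarrow> int) \<Rightarrow> (real ^ 'd) set" where
  "hcell r x p = hbox (\<chi> i. x $ i + r * (p i - 1 / 2)) (\<chi> i. x $ i + r * (p i + 1 / 2))"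

lemma hcell_borel [measurable]: "hcell r (x :: real ^ 'd::finite) p \<in> sets borel"
  by (simp add: hcell_def)

lemma translate_dyadic_cube:
  fixes x :: "real ^ 'd::finite"
  assumes r: "r > 0"
  shows "(\<lambda>y. y + x) ` ((\<lambda>y. r *\<^sub>R (y + (\<chi> i. real_of_int (p i)))) ` unit_cube) = hcell r x p"
proof (intro equalityI subsetI)
  fix y assume "y \<in> (\<lambda>y. y + x) ` ((\<lambda>y. r *\<^sub>R (y + (\<chi> i. real_of_int (p i)))) ` unit_cube)"
  then obtain u where u: "u \<in> unit_cube" "y = r *\<^sub>R (u + (\<chi> i. real_of_int (p i))) + x" by blast
  have "x $ i + r * (p i - 1 / 2) \<le> y $ i \<and> y $ i < x $ i + r * (p i + 1 / 2)" for i
  proof -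
    have "- 1 / 2 \<le> u $ i" "u $ i < 1 / 2" using u(1) by (auto simp: unit_cube_def)
    then have "r * (- 1 / 2) \<le> r * u $ i" "r * u $ i < r * (1 / 2)"
      using r by (simp_all only: mult_less_cancel_left_pos mult_le_cancel_left_pos)
    then show ?thesis by (simp add: u(2) algebra_simps)
  qed
  then show "y \<in> hcell r x p" by (simp add: hcell_def hbox_def)
next
  fix y assume y: "y \<in> hcell r x p"
  define u where "u = (1 / r) *\<^sub>R (y - x) - (\<chi> i. real_of_int (p i))"
  have "- 1 / 2 \<le> u $ i \<and> u $ i < 1 / 2" for i
  proof -
    have "r * (p i - 1 / 2) \<le> y $ i - x $ i" "y $ i - x $ i < r * (p i + 1 / 2)"
      using y by (auto simp: hcell_def hbox_def algebra_simps)
    then have "p i - 1 / 2 \<le> (y $ i - x $ i) / r" "(y $ i - x $ i) / r < p i + 1 / 2"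
      using r by (auto simp: field_simps)
    moreover have "u $ i = (y $ i - x $ i) / r - p i" by (simp add: u_def)
    ultimately show ?thesis by linarith
  qed
  then have "u \<in> unit_cube" by (simp add: unit_cube_def)
  moreover have "y = r *\<^sub>R (u + (\<chi> i. real_of_int (p i))) + x" using r by (simp add: u_def)
  ultimately show "y \<in> (\<lambda>y. y + x) ` ((\<lambda>y. r *\<^sub>R (y + (\<chi> i. real_of_int (p i)))) ` unit_cube)" by blast
qed

lemma hcell_disjoint:
  fixes x :: "real ^ 'd::finite"
  assumes "r > 0" "p \<noteq> q"
  shows "hcell r x p \<inter> hcell r x q = {}"
proof (rule ccontr)
  assume "hcell r x p \<inter> hcell r x q \<noteq> {}"
  then obtain y where y: "y \<in> hcell r x p" "y \<in> hcell r x q" by blast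
  have "p i = q i" for i
  proof -
    have "r * (p i - 1 / 2) < r * (q i + 1 / 2)" "r * (q i - 1 / 2) < r * (p i + 1 / 2)"
      using y unfolding hcell_def hbox_def by (auto dest!: spec[of _ i])
    then have "real_of_int (p i) - 1 / 2 < q i + 1 / 2" "real_of_int (q i) - 1 / 2 < p i + 1 / 2"
      using assms(1) by (simp_all only: mult_less_cancel_left_pos)
    then show ?thesis by linarith
  qed
  with assms(2) show False by (auto simp: fun_eq_iff)
qed

lemma hcell_nonempty: "r > 0 \<Longrightarrow> hcell r (x :: real ^ 'd::finite) p \<noteq> {}"
proof -
  assume "r > 0"
  then have "(\<chi> i. x $ i + r * p i) \<in> hcell r x p"
    by (simp add: hcell_def hbox_def algebra_simps)
  then show ?thesis by blast
qed

lemma dyadic_cubes_bij: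
  assumes "l > 0"
  shows "bij_betw (\<lambda>p. (\<lambda>y. (l / 2 ^ k) *\<^sub>R (y + (\<chi> i. real_of_int (p i)))) ` unit_cube)
    (UNIV :: ('d::finite \<Rightarrow> int) set) (dyadic_cubes k l)"
  unfolding bij_betw_def
proof
  let ?Q = "\<lambda>p :: 'd \<Rightarrow> int. (\<lambda>y. (l / 2 ^ k) *\<^sub>R (y + (\<chi> i. real_of_int (p i)))) ` (unit_cube :: (real ^ 'd) set)"
  have r: "l / 2 ^ k > 0" using assms by simp
  have eq: "?Q p = hcell (l / 2 ^ k) 0 p" for p
    using translate_dyadic_cube[OF r, of 0 p] by simp
  show "inj ?Q"
  proof (rule injI)
    fix p q assume "?Q p = ?Q q"
    then have "hcell (l / 2 ^ k) 0 p \<inter> hcell (l / 2 ^ k) 0 q = hcell (l / 2 ^ k) (0 :: real ^ 'd) p"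
      unfolding eq by simp
    then show "p = q" using hcell_disjoint[OF r, of p q 0] hcell_nonempty[OF r, of 0 p] by auto
  qed
  show "range ?Q = dyadic_cubes k l"
  proof (intro equalityI subsetI)
    fix Q assume "Q \<in> range ?Q"
    then obtain p where p: "Q = ?Q p" by blast
    have "(\<chi> i. real_of_int (p i)) \<in> int_vectors" by (simp add: int_vectors_def)
    then show "Q \<in> dyadic_cubes k l" unfolding dyadic_cubes_def p by blast
  next
    fix Q :: "(real ^ 'd) set" assume "Q \<in> dyadic_cubes k l"
    then obtain z where z: "Q = (\<lambda>y. (l / 2 ^ k) *\<^sub>R (y + z)) ` unit_cube" "z \<in> int_vectors"
      unfolding dyadic_cubes_def by blast
    from z(2) have "\<exists>j. z $ i = real_of_int j" for i by (auto simp: int_vectors_def elim!: Ints_cases)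
    then obtain p where "\<And>i. z $ i = real_of_int (p i)" by metis
    then have "z = (\<chi> i. real_of_int (p i))" by (simp add: vec_eq_iff)
    then show "Q \<in> range ?Q" using z(1) by blast
  qed
qed

definition shifts :: "(real ^ 'd) set" where
  "shifts = {x. \<forall>i. - 1 \<le> x $ i \<and> x $ i < 1}"

lemma vdist_hcell:
  fixes \<mu> \<nu> :: "(real ^ 'd::finite) set \<Rightarrow> real ^ 'd"
  shows "vdist \<nu> \<mu> = (SUP x\<in>shifts. SUP l\<in>{1..2}. \<Sum>k. ennreal (1 / 2 ^ k) *
      (\<Sum>\<^sub>\<infinity>p\<in>UNIV. ennreal (norm (\<mu> (hcell (l / 2 ^ k) x p) - \<nu> (hcell (l / 2 ^ k) x p)))))"
proof -
  have "(\<Sum>\<^sub>\<infinity>Q\<in>dyadic_cubes k l. ennreal (norm (\<mu> ((\<lambda>y. y + x) ` Q) - \<nu> ((\<lambda>y. y + x) ` Q)))) =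
     (\<Sum>\<^sub>\<infinity>p\<in>UNIV. ennreal (norm (\<mu> (hcell (l / 2 ^ k) x p) - \<nu> (hcell (l / 2 ^ k) x p))))"
    if "l \<in> {1..2}" for k l x
  proof -
    have l: "l > 0" using that by simp
    then have r: "l / 2 ^ k > 0" by simp
    show ?thesis
      using infsum_reindex_bij_betw[OF dyadic_cubes_bij[OF l, where 'd='d, of k],
        of "\<lambda>Q. ennreal (norm (\<mu> ((\<lambda>y. y + x) ` Q) - \<nu> ((\<lambda>y. y + x) ` Q)))"]
      unfolding translate_dyadic_cube[OF r] by simp
  qed
  then show ?thesis unfolding vdist_def shifts_def by (intro SUP_cong refl suminf_cong) simp
qed

definition meeting :: "real \<Rightarrow> real ^ 'd \<Rightarrow> ('d \<Rightarrow> int) set" where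
  "meeting r x = {p. hcell r x p \<inter> unit_cube \<noteq> {}}"

lemma finite_meeting:
  fixes x :: "real ^ 'd::finite"
  assumes r: "r > 0"
  shows "finite (meeting r x)"
proof (rule finite_subset)
  let ?a = "\<lambda>i. \<lfloor>(- 1 / 2 - x $ i) / r - 1 / 2\<rfloor>" and ?b = "\<lambda>i. \<lceil>(1 / 2 - x $ i) / r + 1 / 2\<rceil> + 1"
  show "meeting r x \<subseteq> ibox ?a ?b"
  proof
    fix p assume "p \<in> meeting r x"
    then obtain y where y: "y \<in> hcell r x p" "y \<in> unit_cube" by (auto simp: meeting_def)
    have "?a i \<le> p i \<and> p i < ?b i" for i
    proof -
      have "x $ i + r * (p i - 1 / 2) \<le> y $ i" "y $ i < x $ i + r * (p i + 1 / 2)"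
        "- 1 / 2 \<le> y $ i" "y $ i < 1 / 2"
        using y by (auto simp: hcell_def hbox_def unit_cube_def)
      then have "r * (p i - 1 / 2) \<le> 1 / 2 - x $ i" "- 1 / 2 - x $ i \<le> r * (p i + 1 / 2)" by linarith+
      then have "p i - 1 / 2 \<le> (1 / 2 - x $ i) / r" "(- 1 / 2 - x $ i) / r \<le> p i + 1 / 2"
        using r by (simp_all only: pos_le_divide_eq pos_divide_le_eq) (simp_all add: mult.commute)
      then show ?thesis by linarith
    qed
    then show "p \<in> ibox ?a ?b" by (simp add: ibox_def)
  qed
qed simp

lemma infsum_meeting:
  fixes x :: "real ^ 'd::finite"
  assumes r: "r > 0"
    and "\<And>A. A \<inter> unit_cube = {} \<Longrightarrow> \<mu> A = (0 :: real ^ 'd)" "\<And>A. A \<inter> unit_cube = {} \<Longrightarrow> \<nu> A = (0 :: real ^ 'd)"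
  shows "(\<Sum>\<^sub>\<infinity>p\<in>UNIV. ennreal (norm (\<mu> (hcell r x p) - \<nu> (hcell r x p)))) =
    ennreal (\<Sum>p\<in>meeting r x. norm (\<mu> (hcell r x p) - \<nu> (hcell r x p)))"
proof -
  have "(\<Sum>\<^sub>\<infinity>p\<in>UNIV. ennreal (norm (\<mu> (hcell r x p) - \<nu> (hcell r x p)))) =
      (\<Sum>\<^sub>\<infinity>p\<in>meeting r x. ennreal (norm (\<mu> (hcell r x p) - \<nu> (hcell r x p))))"
    by (rule infsum_cong_neutral) (auto simp: meeting_def assms(2,3))
  also have "\<dots> = (\<Sum>p\<in>meeting r x. ennreal (norm (\<mu> (hcell r x p) - \<nu> (hcell r x p))))"
    by (rule infsum_finite[OF finite_meeting[OF r]])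
  finally show ?thesis by (simp add: sum_ennreal)
qed

text \<open>Suprema and series become inequalities between finite real sums. For flows each of them
  is a continuous condition, which gives closedness, and a single term can be read off from
  them.\<close>

lemma vdist_le_real:
  fixes \<mu> \<nu> :: "(real ^ 'd::finite) set \<Rightarrow> real ^ 'd"
  assumes "\<And>A. A \<inter> unit_cube = {} \<Longrightarrow> \<mu> A = 0" "\<And>A. A \<inter> unit_cube = {} \<Longrightarrow> \<nu> A = 0" and "\<epsilon> \<ge> 0"
  shows "vdist \<nu> \<mu> \<le> ennreal \<epsilon> \<longleftrightarrow> (\<forall>x\<in>shifts. \<forall>l\<in>{1..2}. \<forall>K.
     (\<Sum>k<K. 1 / 2 ^ k * (\<Sum>p\<in>meeting (l / 2 ^ k) x. norm (\<mu> (hcell (l / 2 ^ k) x p) - \<nu> (hcell (l / 2 ^ k) x p)))) \<le> \<epsilon>)"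
proof -
  define S where "S x l k = (\<Sum>p\<in>meeting (l / 2 ^ k) x. norm (\<mu> (hcell (l / 2 ^ k) x p) - \<nu> (hcell (l / 2 ^ k) x p)))"
    for x and l :: real and k :: nat
  have S0: "S x l k \<ge> 0" for x l k by (simp add: S_def sum_nonneg)
  have "(\<Sum>k. ennreal (1 / 2 ^ k) * (\<Sum>\<^sub>\<infinity>p\<in>UNIV. ennreal (norm (\<mu> (hcell (l / 2 ^ k) x p) - \<nu> (hcell (l / 2 ^ k) x p))))) \<le> ennreal \<epsilon>
      \<longleftrightarrow> (\<forall>K. (\<Sum>k<K. 1 / 2 ^ k * S x l k) \<le> \<epsilon>)" if l: "l \<in> {1..2}" for x l
  proof -
    have "(\<Sum>k. ennreal (1 / 2 ^ k) * (\<Sum>\<^sub>\<infinity>p\<in>UNIV. ennreal (norm (\<mu> (hcell (l / 2 ^ k) x p) - \<nu> (hcell (l / 2 ^ k) x p))))) =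
        (\<Sum>k. ennreal (1 / 2 ^ k * S x l k))"
    proof (rule suminf_cong)
      fix k :: nat
      have "l / 2 ^ k > 0" using l by simp
      note meet = infsum_meeting[where \<mu>=\<mu> and \<nu>=\<nu>, OF this assms(1,2)]
      show "ennreal (1 / 2 ^ k) * (\<Sum>\<^sub>\<infinity>p\<in>UNIV. ennreal (norm (\<mu> (hcell (l / 2 ^ k) x p) - \<nu> (hcell (l / 2 ^ k) x p)))) =
          ennreal (1 / 2 ^ k * S x l k)"
        by (simp only: meet S_def[symmetric] ennreal_mult''[OF S0])
    qed
    also have "\<dots> \<le> ennreal \<epsilon> \<longleftrightarrow> (\<forall>K. (\<Sum>k<K. ennreal (1 / 2 ^ k * S x l k)) \<le> ennreal \<epsilon>)"
      by (subst suminf_eq_SUP) (simp add: SUP_le_iff)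
    also have "\<dots> \<longleftrightarrow> (\<forall>K. (\<Sum>k<K. 1 / 2 ^ k * S x l k) \<le> \<epsilon>)"
      using \<open>\<epsilon> \<ge> 0\<close> S0 by (simp add: sum_ennreal ennreal_le_iff)
    finally show ?thesis .
  qed
  then show ?thesis unfolding vdist_hcell SUP_le_iff S_def[symmetric] by blast
qed

lemma vdist_flow_le_real:
  fixes w :: "real ^ 'd::finite"
  assumes "\<epsilon> \<ge> 0"
  shows "vdist (flow_measure n f) (target w) \<le> ennreal \<epsilon> \<longleftrightarrow> (\<forall>x\<in>shifts. \<forall>l\<in>{1..2}. \<forall>K.
     (\<Sum>k<K. 1 / 2 ^ k * (\<Sum>p\<in>meeting (l / 2 ^ k) x.
       norm (target w (hcell (l / 2 ^ k) x p) - flow_measure n f (hcell (l / 2 ^ k) x p)))) \<le> \<epsilon>)"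
  by (rule vdist_le_real[OF _ _ assms]) (simp_all add: target_disjoint flow_measure_disjoint)

lemma vdist_flow_closed:
  fixes f' :: "('d::finite \<Rightarrow> int) \<times> 'd \<Rightarrow> real"
  assumes lim: "\<And>e. (\<lambda>m. f m e) \<longlonglongrightarrow> f' e" and \<epsilon>: "\<epsilon> \<ge> 0"
    and le: "\<And>m. vdist (flow_measure n (f m)) (target w) \<le> ennreal \<epsilon>"
  shows "vdist (flow_measure n f') (target w) \<le> ennreal \<epsilon>"
  unfolding vdist_flow_le_real[OF \<epsilon>]
proof (intro ballI allI)
  fix x :: "real ^ 'd" and l :: real and K :: nat
  assume xl: "x \<in> shifts" "l \<in> {1..2}"
  have fm: "(\<lambda>m. flow_measure n (f m) A) \<longlonglongrightarrow> flow_measure n f' A" for A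
    unfolding flow_measure_def by (intro tendsto_intros lim)
  have lims: "(\<lambda>m. \<Sum>k<K. 1 / 2 ^ k * (\<Sum>p\<in>meeting (l / 2 ^ k) x.
        norm (target w (hcell (l / 2 ^ k) x p) - flow_measure n (f m) (hcell (l / 2 ^ k) x p))))
     \<longlonglongrightarrow> (\<Sum>k<K. 1 / 2 ^ k * (\<Sum>p\<in>meeting (l / 2 ^ k) x.
        norm (target w (hcell (l / 2 ^ k) x p) - flow_measure n f' (hcell (l / 2 ^ k) x p))))"
    by (intro tendsto_intros fm)
  have les: "(\<Sum>k<K. 1 / 2 ^ k * (\<Sum>p\<in>meeting (l / 2 ^ k) x.
        norm (target w (hcell (l / 2 ^ k) x p) - flow_measure n (f m) (hcell (l / 2 ^ k) x p)))) \<le> \<epsilon>" for m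
    using le[of m] xl unfolding vdist_flow_le_real[OF \<epsilon>] by blast
  show "(\<Sum>k<K. 1 / 2 ^ k * (\<Sum>p\<in>meeting (l / 2 ^ k) x.
        norm (target w (hcell (l / 2 ^ k) x p) - flow_measure n f' (hcell (l / 2 ^ k) x p)))) \<le> \<epsilon>"
    by (rule LIMSEQ_le_const2[OF lims]) (use les in blast)
qed

section \<open>The event and its measurability\<close>

definition near_flow :: "nat \<Rightarrow> real ^ 'd::finite \<Rightarrow> real \<Rightarrow> (('d \<Rightarrow> int) \<times> 'd \<Rightarrow> real) \<Rightarrow> bool" where
  "near_flow n w \<epsilon> c \<longleftrightarrow> (\<exists>f. admissible_flow n c f \<and> vdist (flow_measure n f) (target w) \<le> ennreal \<epsilon>)"

text \<open>The edges seen by the distance need not have a capacity constraint; hence the union over the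
  bounds \<open>R\<close>.\<close>

lemma near_flow_borel:
  fixes w :: "real ^ 'd::finite"
  assumes n: "n \<ge> 1" and \<epsilon>: "\<epsilon> \<ge> 0"
  shows "{c. near_flow n w \<epsilon> c} \<in> sets borel"
proof -
  let ?F = "\<lambda>c f. admissible_flow n c f \<and> vdist (flow_measure n f) (target w) \<le> ennreal \<epsilon>"
  define E where "E = visible_edges n \<union> (base n \<times> UNIV :: (('d \<Rightarrow> int) \<times> 'd) set)"
  have finE: "finite E" using finite_visible_edges[OF n] by (simp add: E_def base_def)
  \<comment> \<open>Both conditions read the flow on the finite set \<open>E\<close> only, and a
    flow that vanishes off \<open>E\<close> is bounded.\<close>
  have restr: "?F c (\<lambda>e. if e \<in> E then f e else 0)" if "?F c f" for c f
  proof -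
    have "flow_measure n (\<lambda>e. if e \<in> E then f e else 0) = flow_measure n f"
      unfolding flow_measure_def fun_eq_iff by (auto simp: E_def intro!: arg_cong2[where f=scaleR] sum.cong)
    moreover have "admissible_flow n c (\<lambda>e. if e \<in> E then f e else 0)"
      using that unfolding admissible_flow_def by (auto simp: E_def flow_div_def)
    ultimately show ?thesis using that by simp
  qed
  have "closed {c. \<exists>f. ?F c f \<and> (\<forall>j. \<bar>f j\<bar> \<le> real R)}" for R
  proof (rule closed_Ex_bounded)
    fix c f c' f'
    assume F: "\<And>m. ?F (c m) (f m)" and c: "\<And>j. (\<lambda>m. c m j) \<longlonglongrightarrow> c' j" and f: "\<And>j. (\<lambda>m. f m j) \<longlonglongrightarrow> f' j"
    have "vdist (flow_measure n f') (target w) \<le> ennreal \<epsilon>"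
      by (rule vdist_flow_closed[OF f \<epsilon>]) (use F in blast)
    moreover have "\<bar>f' (p, i)\<bar> \<le> c' (p, i)" if "p \<in> base n" for p i
      by (rule LIMSEQ_le[OF tendsto_rabs[OF f] c]) (use F that in \<open>auto simp: admissible_flow_def\<close>)
    moreover have "flow_div f' p = 0" if "p \<in> base n" "\<forall>i. p(i := p i - 1) \<in> base n" for p
    proof (rule LIMSEQ_unique)
      show "(\<lambda>m. flow_div (f m) p) \<longlonglongrightarrow> flow_div f' p" unfolding flow_div_def by (intro tendsto_intros f)
      have "flow_div (f m) p = 0" for m using F[of m] that by (auto simp: admissible_flow_def)
      then show "(\<lambda>m. flow_div (f m) p) \<longlonglongrightarrow> 0" by simp
    qed
    ultimately show "?F c' f'" by (auto simp: admissible_flow_def)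
  qed
  moreover have "{c. near_flow n w \<epsilon> c} = (\<Union>R. {c. \<exists>f. ?F c f \<and> (\<forall>j. \<bar>f j\<bar> \<le> real R)})"
  proof (intro equalityI subsetI)
    fix c assume "c \<in> {c. near_flow n w \<epsilon> c}"
    then obtain f where f: "?F c f" by (auto simp: near_flow_def)
    obtain R :: nat where R: "(\<Sum>e\<in>E. \<bar>f e\<bar>) \<le> real R" using real_arch_simple by blast
    have "\<bar>if e \<in> E then f e else 0\<bar> \<le> real R" for e
      using R member_le_sum[of e E "\<lambda>e. \<bar>f e\<bar>"] finE by auto
    with restr[OF f] show "c \<in> (\<Union>R. {c. \<exists>f. ?F c f \<and> (\<forall>j. \<bar>f j\<bar> \<le> real R)})" by blast
  qed (auto simp: near_flow_def)
  ultimately show ?thesis by (auto intro!: sets.countable_UN borel_closed)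
qed

lemma stream_prob_eq:
  fixes t :: "(real ^ 'd::finite) set \<Rightarrow> 'w \<Rightarrow> real"
  assumes "prob_space G" "sets G = sets borel" "prob_space P"
    and "prob_space.indep_vars P (\<lambda>_. borel) t (edges n)"
    and "\<And>e. e \<in> edges n \<Longrightarrow> distr P borel (t e) = G"
    and n: "n \<ge> 1" and \<epsilon>: "\<epsilon> \<ge> 0"
  shows "stream_prob P t w \<epsilon> n = measure (\<Pi>\<^sub>M e\<in>UNIV. G) {c. near_flow n w \<epsilon> c}"
proof -
  have "stream_prob P t w \<epsilon> n = measure P {\<omega> \<in> space P. near_flow n w \<epsilon> (\<lambda>e. t (edge n e) \<omega>)}"
    unfolding stream_prob_def near_flow_def 
    by (simp only: ex_admissible_stream_iff[OF n, where Q="\<lambda>\<mu>. vdist \<mu> (target w) \<le> ennreal \<epsilon>"])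
  also have "\<dots> = measure (\<Pi>\<^sub>M e\<in>UNIV. G) {c. near_flow n w \<epsilon> c}"
    by (rule measure_iid_field[OF assms(1-5) inj_edge[OF n]])
       (use edges_eq[OF n] near_flow_borel[OF n \<epsilon>] in auto)
  finally show ?thesis .
qed

section \<open>Tiles and their cores\<close>

lemma cubeD: "p \<in> cube w \<Longrightarrow> 0 \<le> p j" "p \<in> cube w \<Longrightarrow> p j < w"
  by (simp_all add: cube_def ibox_def)

text \<open>Every side \<open>r\<close> in (0, 2] has the form \<open>l / 2 ^ k\<close> with
  \<open>l\<close> in [1, 2], so the cell belongs to a grid of the distance; the weight
  \<open>1 / 2 ^ k\<close> of that grid is at least r/2.\<close>

lemma vdist_flow_single_cell:
  fixes w :: "real ^ 'd::finite"
  assumes le: "vdist (flow_measure n f) (target w) \<le> ennreal \<epsilon>" and \<epsilon>: "\<epsilon> \<ge> 0"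
    and x: "x \<in> shifts" and r: "0 < r" "r \<le> 2"
  shows "norm (target w (hcell r x p) - flow_measure n f (hcell r x p)) \<le> 2 * \<epsilon> / r"
proof -
  have "\<exists>k. 1 \<le> r * 2 ^ k"
  proof -
    obtain k where "1 / r < 2 ^ k" using real_arch_pow[of 2 "1 / r"] by auto
    then have "1 \<le> r * 2 ^ k" using r by (simp add: field_simps)
    then show ?thesis by blast
  qed
  define k where "k = (LEAST k. 1 \<le> r * 2 ^ k)"
  have k1: "1 \<le> r * 2 ^ k" unfolding k_def using \<open>\<exists>k. 1 \<le> r * 2 ^ k\<close> by (rule LeastI_ex)
  have k2: "r * 2 ^ k \<le> 2"
  proof (cases k)
    case (Suc j)
    then have "\<not> 1 \<le> r * 2 ^ j" using not_less_Least[of j "\<lambda>k. 1 \<le> r * 2 ^ k"] by (simp add: k_def)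
    then show ?thesis by (simp add: Suc)
  qed (use r in simp)
  define l where "l = r * 2 ^ k"
  have l: "l \<in> {1..2}" "l / 2 ^ k = r" using k1 k2 by (auto simp: l_def)
  let ?N = "\<lambda>p. norm (target w (hcell r x p) - flow_measure n f (hcell r x p))"
  let ?S = "\<lambda>k. 1 / 2 ^ k * (\<Sum>p\<in>meeting (l / 2 ^ k) x. norm (target w (hcell (l / 2 ^ k) x p) - flow_measure n f (hcell (l / 2 ^ k) x p)))"
  have "(\<Sum>k<Suc k. ?S k) \<le> \<epsilon>"
    using le x l(1) unfolding vdist_flow_le_real[OF \<epsilon>] by blast
  moreover have "?S k \<le> (\<Sum>k<Suc k. ?S k)"
    by (rule member_le_sum) (auto intro!: divide_nonneg_nonneg sum_nonneg)
  ultimately have "1 / 2 ^ k * (\<Sum>p\<in>meeting r x. ?N p) \<le> \<epsilon>" by (simp add: l(2))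
  then have S: "(\<Sum>p\<in>meeting r x. ?N p) \<le> 2 ^ k * \<epsilon>" by (simp add: field_simps)
  have "?N p \<le> 2 ^ k * \<epsilon>"
  proof (cases "p \<in> meeting r x")
    case True
    have "?N p \<le> (\<Sum>p\<in>meeting r x. ?N p)"
      by (rule member_le_sum[OF True]) (auto intro: finite_meeting[OF r(1)])
    with S show ?thesis by simp
  next
    case False
    then show ?thesis using \<epsilon> by (simp add: meeting_def target_disjoint flow_measure_disjoint)
  qed
  also have "2 ^ k \<le> 2 / r" using k2 r by (simp add: field_simps)
  then have "2 ^ k * \<epsilon> \<le> 2 / r * \<epsilon>" using \<epsilon> by (rule mult_right_mono)
  finally show ?thesis by simp
qed

section \<open>Averages over lattice cubes\<close>

definition phys :: "nat \<Rightarrow> ('d \<Rightarrow> int) \<Rightarrow> int \<Rightarrow> (real ^ 'd::finite) set" where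
  "phys n q T = hbox (\<chi> i. q i / n) (\<chi> i. (q i + T) / n)"

lemma phys_borel [measurable]: "phys n q T \<in> sets borel"
  by (simp add: phys_def)

text \<open>The center exceeds the starting point by half a lattice step in one coordinate and so
  stays short of the next lattice value: half-open cubes with lattice corners cannot separate the
  two.\<close>

lemma center_in_phys:
  assumes n: "n \<ge> 1"
  shows "center (edge n (p, i)) \<in> phys n q T \<longleftrightarrow> p \<in> ibox q (\<lambda>j. q j + T)"
proof -
  have "real_of_int (q j) / n \<le> center (edge n (p, i)) $ j \<and> center (edge n (p, i)) $ j < (q j + T) / n
      \<longleftrightarrow> q j \<le> p j \<and> p j < q j + T" for j
  proof -
    have c: "center (edge n (p, i)) $ j = (2 * real_of_int (p j) + (if i = j then 1 else 0)) / (2 * real n)"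
      using n by (simp add: center_edge axis_def field_simps)
    have "real_of_int (q j) / n \<le> center (edge n (p, i)) $ j \<longleftrightarrow> 2 * real_of_int (q j) \<le> 2 * real_of_int (p j) + (if i = j then 1 else 0)"
      "center (edge n (p, i)) $ j < (q j + T) / n \<longleftrightarrow> 2 * real_of_int (p j) + (if i = j then 1 else 0) < 2 * real_of_int (q j + T)"
    proof -
      have "real_of_int (q j) / n = 2 * real_of_int (q j) / (2 * real n)"
        "real_of_int (q j + T) / n = 2 * real_of_int (q j + T) / (2 * real n)"
        using n by (simp_all add: field_simps)
      then show "real_of_int (q j) / n \<le> center (edge n (p, i)) $ j \<longleftrightarrow> 2 * real_of_int (q j) \<le> 2 * real_of_int (p j) + (if i = j then 1 else 0)"
        "center (edge n (p, i)) $ j < (q j + T) / n \<longleftrightarrow> 2 * real_of_int (p j) + (if i = j then 1 else 0) < 2 * real_of_int (q j + T)"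
        unfolding c using n by (simp_all only: divide_le_cancel divide_less_cancel) simp_all
    qed
    moreover have "2 * real_of_int (q j) \<le> 2 * real_of_int (p j) + (if i = j then 1 else 0) \<longleftrightarrow> q j \<le> p j"
      "2 * real_of_int (p j) + (if i = j then 1 else 0) < 2 * real_of_int (q j + T) \<longleftrightarrow> p j < q j + T"
      by (auto split: if_splits)
    ultimately show ?thesis by simp
  qed
  then show ?thesis by (simp add: phys_def hbox_def ibox_def)
qed

lemma phys_subset_unit_cube:
  assumes "n \<ge> 1" "\<And>j. - int n \<le> 2 * q j" "\<And>j. 2 * (q j + T) \<le> int n"
  shows "phys n q T \<subseteq> (unit_cube :: (real ^ 'd::finite) set)"
  unfolding phys_def unit_cube_eq_hbox
proof (rule hbox_mono, goal_cases)
  case (1 i)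
  have "- real n \<le> 2 * real_of_int (q i)" using assms(2)[of i] by linarith
  then show ?case using assms(1) by (simp add: field_simps)
next
  case (2 i)
  have "2 * real_of_int (q i + T) \<le> real n" using assms(3)[of i] by linarith
  then show ?case using assms(1) by (simp add: field_simps)
qed

lemma ibox_visible:
  fixes q :: "'d::finite \<Rightarrow> int"
  assumes n: "n \<ge> 1" and sub: "phys n q T \<subseteq> (unit_cube :: (real ^ 'd) set)"
  shows "ibox q (\<lambda>j. q j + T) \<times> UNIV \<subseteq> visible_edges n"
proof
  fix e assume "e \<in> ibox q (\<lambda>j. q j + T) \<times> (UNIV :: 'd set)"
  then obtain p i where e: "e = (p, i)" "p \<in> ibox q (\<lambda>j. q j + T)" by auto
  then have "center (edge n e) \<in> phys n q T" using center_in_phys[OF n, of p i q T] by simp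
  then show "e \<in> visible_edges n" using sub by (auto simp: visible_edges_def)
qed

lemma flow_measure_phys:
  fixes f :: "('d::finite \<Rightarrow> int) \<times> 'd \<Rightarrow> real"
  assumes n: "n \<ge> 1" and sub: "phys n q T \<subseteq> (unit_cube :: (real ^ 'd) set)"
  shows "flow_measure n f (phys n q T) $ i = (\<Sum>p\<in>ibox q (\<lambda>j. q j + T). f (p, i)) / real n ^ CARD('d)"
proof -
  let ?I = "ibox q (\<lambda>j. q j + T)"
  note vis = ibox_visible[OF n sub]
  have "(\<Sum>e\<in>visible_edges n. (indicator (phys n q T) (center (edge n e)) * f e) *\<^sub>R axis (snd e) (1::real)) =
     (\<Sum>e\<in>?I \<times> UNIV. f e *\<^sub>R axis (snd e) 1)"
    by (rule sum.mono_neutral_cong_right[OF finite_visible_edges[OF n] vis])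
       (auto simp: indicator_def center_in_phys[OF n])
  also have "\<dots> $ i = (\<Sum>e\<in>?I \<times> UNIV. f e * (if i = snd e then 1 else 0))"
    by (simp add: axis_def)
  also have "\<dots> = (\<Sum>p\<in>?I. \<Sum>j\<in>UNIV. f (p, j) * (if i = j then 1 else 0))"
    by (simp add: sum.cartesian_product case_prod_unfold)
  also have "\<dots> = (\<Sum>p\<in>?I. f (p, i))" by (simp add: if_distrib cong: if_cong)
  finally show ?thesis by (simp add: flow_measure_def)
qed

lemma target_phys:
  fixes w :: "real ^ 'd::finite"
  assumes "n \<ge> 1" "T \<ge> 0" "phys n q T \<subseteq> (unit_cube :: (real ^ 'd) set)"
  shows "target w (phys n q T) = (real_of_int T / n) ^ CARD('d) *\<^sub>R w"
proof -
  have "phys n q T \<inter> unit_cube = (phys n q T :: (real ^ 'd) set)" using assms(3) by blast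
  then have "target w (phys n q T) = measure lborel (phys n q T) *\<^sub>R w" by (simp add: target_eq)
  also have "measure lborel (phys n q T :: (real ^ 'd) set) = (\<Prod>i\<in>(UNIV :: 'd set). (q i + T) / n - q i / n)"
    unfolding phys_def using assms(1,2) by (subst measure_hbox) (auto simp: divide_right_mono)
  also have "\<dots> = (real_of_int T / n) ^ CARD('d)" by (simp add: diff_divide_distrib[symmetric])
  finally show ?thesis .
qed

text \<open>The cube is one cell of side T/n, of the grid translated by its center, which lies in
  the unit cube and is thus an allowed shift. One factor n/T comes from the weight of the grid, the
  others from the normalization by \<open>n ^ CARD('d)\<close>.\<close>

lemma near_flow_cube_average:
  fixes w :: "real ^ 'd::finite"
  assumes n: "n \<ge> 1" and T: "T \<ge> 1" and q: "\<And>j. - int n \<le> 2 * q j" "\<And>j. 2 * (q j + T) \<le> int n"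
    and le: "vdist (flow_measure n f) (target w) \<le> ennreal \<epsilon>" and \<epsilon>: "\<epsilon> \<ge> 0"
  shows "\<bar>(\<Sum>p\<in>ibox q (\<lambda>j. q j + T). f (p, i)) - w $ i * real_of_int T ^ CARD('d)\<bar>
    \<le> 2 * (real n / T) ^ (CARD('d) + 1) * \<epsilon> * real_of_int T ^ CARD('d)"
proof -
  define x :: "real ^ 'd" where "x = (\<chi> i. q i / n + T / (2 * n))"
  have r: "0 < real_of_int T / n" "real_of_int T / n \<le> 2"
  proof -
    show "0 < real_of_int T / n" using n T by simp
    have "T \<le> int n" using q(1)[of i] q(2)[of i] by presburger
    then have "real_of_int T \<le> real n" by linarith
    then show "real_of_int T / n \<le> 2" using n by (simp add: field_simps)
  qed
  have eq: "phys n q T = hcell (T / n) x (\<lambda>_. 0)"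
    unfolding phys_def hcell_def x_def using n
    by (intro arg_cong2[where f=hbox]) (simp_all add: vec_eq_iff field_simps)
  have sub: "phys n q T \<subseteq> (unit_cube :: (real ^ 'd) set)" by (rule phys_subset_unit_cube[OF n q])
  have "x \<in> phys n q T" using n T by (auto simp: x_def phys_def hbox_def field_simps)
  with sub have "x \<in> unit_cube" by blast
  then have x: "x \<in> shifts" unfolding unit_cube_def shifts_def by (auto intro: order_trans[of _ "- 1 / 2"] less_trans[of _ "1 / 2"])
  have "norm (target w (phys n q T) - flow_measure n f (phys n q T)) \<le> 2 * \<epsilon> / (T / n)"
    unfolding eq by (rule vdist_flow_single_cell[OF le \<epsilon> x r])
  then have "\<bar>(target w (phys n q T) - flow_measure n f (phys n q T)) $ i\<bar> \<le> 2 * \<epsilon> / (T / n)"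
    using component_le_norm_cart order_trans by blast
  moreover have "(target w (phys n q T) - flow_measure n f (phys n q T)) $ i =
      (w $ i * real_of_int T ^ CARD('d) - (\<Sum>p\<in>ibox q (\<lambda>j. q j + T). f (p, i))) / real n ^ CARD('d)"
    using T by (simp add: flow_measure_phys[OF n sub] target_phys[OF n _ sub] power_divide diff_divide_distrib mult.commute)
  ultimately have "\<bar>w $ i * real_of_int T ^ CARD('d) - (\<Sum>p\<in>ibox q (\<lambda>j. q j + T). f (p, i))\<bar> \<le> 2 * \<epsilon> / (T / n) * real n ^ CARD('d)"
    using n by (simp add: pos_divide_le_eq)
  also have "\<dots> = 2 * (real n / T) ^ (CARD('d) + 1) * \<epsilon> * real_of_int T ^ CARD('d)"
    using T by (simp add: power_divide field_simps)
  finally show ?thesis by (simp add: abs_minus_commute)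
qed

section \<open>The core of a tile\<close>

text \<open>What a tile needs from a near flow, freed of the scale \<open>n\<close> and of the
  position in the unit cube. The constant bound \<open>M\<close>, which almost surely follows from
  the capacities, confines the flow to a compact set and makes the event closed.\<close>

definition core_event ::
    "('d::finite \<Rightarrow> real) \<Rightarrow> int \<Rightarrow> int \<Rightarrow> real \<Rightarrow> real \<Rightarrow> (('d \<Rightarrow> int) \<times> 'd \<Rightarrow> real) \<Rightarrow> bool" where
  "core_event u N D M \<gamma> c \<longleftrightarrow> (\<exists>f. (\<forall>e\<in>core_edges (D * N). \<bar>f e\<bar> \<le> c e \<and> \<bar>f e\<bar> \<le> M) \<and>
     (\<forall>p\<in>cube (D * N). flow_div f p = 0) \<and>
     (\<forall>z\<in>cube N. \<forall>i. \<bar>(\<Sum>q\<in>subcube D z. f (q, i)) - u i * real_of_int D ^ CARD('d)\<bar> \<le> \<gamma> * real_of_int D ^ CARD('d)))"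

lemma cube_core_edges:
  assumes "p \<in> cube w"
  shows "(p, i) \<in> core_edges w" "(p(i := p i - 1), i) \<in> core_edges w"
proof -
  have *: "0 \<le> p j" "p j < w" for j using assms by (simp_all add: cube_def ibox_def)
  have "- 1 \<le> p i" "- 1 \<le> p i - 1" "p i - 1 < w" using *[of i] by linarith+
  then show "(p, i) \<in> core_edges w" "(p(i := p i - 1), i) \<in> core_edges w"
    unfolding core_edges_def using * by simp_all
qed

lemma subcube_in_cube:
  assumes "D \<ge> 1" "z \<in> cube N"
  shows "subcube D z \<subseteq> cube (D * N)"
proof -
  have "0 \<le> D * z j" "D * z j + D \<le> D * N" for j
  proof -
    have z: "0 \<le> z j" "z j + 1 \<le> N" using cubeD[OF assms(2), of j] by simp_all
    then show "0 \<le> D * z j" using assms(1) by simp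
    have "D * (z j + 1) \<le> D * N" using z assms(1) by (intro mult_left_mono) auto
    then show "D * z j + D \<le> D * N" by (simp add: algebra_simps)
  qed
  then show ?thesis unfolding subcube_def cube_def by (intro ibox_mono)
qed

lemma core_event_local:
  assumes "\<And>e. e \<in> core_edges (D * N) \<Longrightarrow> c e = c' e"
  shows "core_event u N D M \<gamma> c \<longleftrightarrow> core_event u N D M \<gamma> c'"
  unfolding core_event_def using assms by (intro ex_cong1 conj_cong refl ball_cong) auto

lemma core_event_borel:
  fixes u :: "'d::finite \<Rightarrow> real"
  assumes "D \<ge> 1" "M \<ge> 0"
  shows "{c. core_event u N D M \<gamma> c} \<in> sets borel"
proof -
  let ?F = "\<lambda>c f. (\<forall>e\<in>core_edges (D * N). \<bar>f e\<bar> \<le> c e \<and> \<bar>f e\<bar> \<le> M) \<and>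
     (\<forall>p\<in>cube (D * N). flow_div f p = 0) \<and>
     (\<forall>z\<in>cube N. \<forall>i. \<bar>(\<Sum>q\<in>subcube D z. f (q, i)) - u i * real_of_int D ^ CARD('d)\<bar> \<le> \<gamma> * real_of_int D ^ CARD('d))"
  have "closed {c. \<exists>f. ?F c f \<and> (\<forall>j. \<bar>f j\<bar> \<le> M)}"
  proof (rule closed_Ex_bounded)
    fix c f c' f'
    assume F: "\<And>m. ?F (c m) (f m)" and c: "\<And>j. (\<lambda>m. c m j) \<longlonglongrightarrow> c' j" and f: "\<And>j. (\<lambda>m. f m j) \<longlonglongrightarrow> f' j"
    have "\<bar>f' e\<bar> \<le> c' e" "\<bar>f' e\<bar> \<le> M" if "e \<in> core_edges (D * N)" for e
      using F that by (auto intro: LIMSEQ_le[OF tendsto_rabs[OF f] c] LIMSEQ_le_const2[OF tendsto_rabs[OF f]])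
    moreover have "flow_div f' p = 0" if "p \<in> cube (D * N)" for p
    proof (rule LIMSEQ_unique)
      show "(\<lambda>m. flow_div (f m) p) \<longlonglongrightarrow> flow_div f' p" unfolding flow_div_def by (intro tendsto_intros f)
      have "flow_div (f m) p = 0" for m using F[of m] that by blast
      then show "(\<lambda>m. flow_div (f m) p) \<longlonglongrightarrow> 0" by simp
    qed
    moreover have "\<bar>(\<Sum>q\<in>subcube D z. f' (q, i)) - u i * real_of_int D ^ CARD('d)\<bar> \<le> \<gamma> * real_of_int D ^ CARD('d)"
      if "z \<in> cube N" for z i
    proof (rule LIMSEQ_le_const2)
      show "(\<lambda>m. \<bar>(\<Sum>q\<in>subcube D z. f m (q, i)) - u i * real_of_int D ^ CARD('d)\<bar>)
          \<longlonglongrightarrow> \<bar>(\<Sum>q\<in>subcube D z. f' (q, i)) - u i * real_of_int D ^ CARD('d)\<bar>"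
        by (intro tendsto_intros f)
    qed (use F that in blast)
    ultimately show "?F c' f'" by blast
  qed
  moreover have "{c. core_event u N D M \<gamma> c} = {c. \<exists>f. ?F c f \<and> (\<forall>j. \<bar>f j\<bar> \<le> M)}"
  proof (intro equalityI subsetI)
    fix c assume "c \<in> {c. core_event u N D M \<gamma> c}"
    then obtain f where f: "?F c f" by (auto simp: core_event_def)
    let ?g = "\<lambda>e. if e \<in> core_edges (D * N) then f e else 0"
    have "flow_div ?g p = flow_div f p" if "p \<in> cube (D * N)" for p
      unfolding flow_div_def using cube_core_edges[OF that] by simp
    moreover have "(\<Sum>q\<in>subcube D z. ?g (q, i)) = (\<Sum>q\<in>subcube D z. f (q, i))" if "z \<in> cube N" for z i
    proof (rule sum.cong[OF refl])
      fix q assume "q \<in> subcube D z"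
      then have "(q, i) \<in> core_edges (D * N)" using subcube_in_cube[OF assms(1) that] by (intro cube_core_edges(1)) blast
      then show "?g (q, i) = f (q, i)" by simp
    qed
    ultimately have "?F c ?g" using f by auto
    moreover have "\<bar>?g e\<bar> \<le> M" for e using f assms(2) by auto
    ultimately have "?F c ?g \<and> (\<forall>j. \<bar>?g j\<bar> \<le> M)" by blast
    then show "c \<in> {c. \<exists>f. ?F c f \<and> (\<forall>j. \<bar>f j\<bar> \<le> M)}" by (intro CollectI) (rule exI)
  qed (auto simp: core_event_def)
  ultimately show ?thesis by (simp add: borel_closed)
qed

definition shift :: "('d \<Rightarrow> int) \<Rightarrow> ('d \<Rightarrow> int) \<times> 'd \<Rightarrow> ('d \<Rightarrow> int) \<times> 'd" where
  "shift o' = (\<lambda>(p, i). (\<lambda>j. p j + o' j, i))"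

lemma inj_shift: "inj (shift o')"
  by (rule injI) (auto simp: shift_def fun_eq_iff)

lemma flow_div_shift: "flow_div (\<lambda>e. f (shift o' e)) p = flow_div f (\<lambda>j. p j + o' j)"
proof -
  have "(\<lambda>j. (p(i := p i - 1)) j + o' j) = (\<lambda>j. p j + o' j)(i := p i + o' i - 1)" for i
    by (auto simp: fun_eq_iff)
  then show ?thesis by (simp add: flow_div_def shift_def)
qed

lemma sum_ibox_shift:
  "(\<Sum>q\<in>ibox a b. g (\<lambda>j. q j + o' j)) = (\<Sum>p\<in>ibox (\<lambda>j. a j + o' j) (\<lambda>j. b j + o' j). g p)"
  by (rule sum.reindex_bij_witness[of _ "\<lambda>p j. p j - o' j" "\<lambda>q j. q j + o' j"]) (auto simp: ibox_def le_diff_eq diff_less_eq)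

lemma near_flow_core_event:
  fixes w :: "real ^ 'd::finite"
  assumes n: "n \<ge> 1" and D: "D \<ge> 1" and "N \<ge> 1" and fit: "D * N \<le> int n - 2" and \<epsilon>: "\<epsilon> \<ge> 0"
    and near: "near_flow n w \<epsilon> c" and M: "\<And>e. c e \<le> M"
  shows "core_event (($) w) N D M (2 * (real n / D) ^ (CARD('d) + 1) * \<epsilon>)
     (\<lambda>e. c (shift (\<lambda>_. - (int n div 2) + 1) e))"
proof -
  obtain f where f: "admissible_flow n c f" "vdist (flow_measure n f) (target w) \<le> ennreal \<epsilon>"
    using near by (auto simp: near_flow_def)
  \<comment> \<open>The added 1 brings the edges at level -1 into \<open>base n\<close>;
    \<open>D * N \<le> int n - 2\<close> then keeps the far side within the unit cube for odd
    \<open>n\<close> as well.\<close>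
  define o' where "o' = - (int n div 2) + 1"
  let ?s = "shift (\<lambda>_. o') :: ('d \<Rightarrow> int) \<times> 'd \<Rightarrow> _"
  have base: "(\<lambda>j. p j + o') \<in> base n" if "\<And>j. - 1 \<le> p j" "\<And>j. p j < D * N" for p :: "'d \<Rightarrow> int"
  proof -
    have "- (int n div 2) \<le> p j + o' \<and> p j + o' < - (int n div 2) + int n" for j
      using that(1,2)[of j] fit by (simp add: o'_def)
    then show ?thesis by (simp add: base_def ibox_def)
  qed
  show ?thesis
    unfolding core_event_def o'_def[symmetric]
  proof (intro exI[of _ "\<lambda>e. f (?s e)"] conjI ballI allI)
    fix e :: "('d \<Rightarrow> int) \<times> 'd" assume e: "e \<in> core_edges (D * N)"
    obtain p i where pi: "e = (p, i)" by force
    have "- 1 \<le> p j \<and> p j < D * N" for j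
      using e by (cases "j = i") (auto simp: pi core_edges_def)
    then have "(\<lambda>j. p j + o') \<in> base n" using base by blast
    then show "\<bar>f (?s e)\<bar> \<le> c (?s e)" using f(1) by (simp add: admissible_flow_def pi shift_def)
    with M[of "?s e"] show "\<bar>f (?s e)\<bar> \<le> M" by linarith
  next
    fix p :: "'d \<Rightarrow> int" assume p: "p \<in> cube (D * N)"
    then have *: "0 \<le> p j" "p j < D * N" for j by (auto simp: cube_def ibox_def)
    have "(\<lambda>j. p j + o') \<in> base n" using * by (intro base) (auto intro: order_trans[of "-1" 0])
    moreover have "(\<lambda>j. p j + o')(i := (\<lambda>j. p j + o') i - 1) \<in> base n" for i
    proof -
      have "(\<lambda>j. (p(i := p i - 1)) j + o') \<in> base n"
      proof (rule base)
        show "- 1 \<le> (p(i := p i - 1)) j" for j using *(1)[of j] by auto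
        show "(p(i := p i - 1)) j < D * N" for j using *(2)[of j] by auto
      qed
      moreover have "(\<lambda>j. (p(i := p i - 1)) j + o') = (\<lambda>j. p j + o')(i := (\<lambda>j. p j + o') i - 1)"
        by (auto simp: fun_eq_iff)
      ultimately show ?thesis by simp
    qed
    ultimately have "flow_div f (\<lambda>j. p j + o') = 0" using f(1) by (auto simp: admissible_flow_def)
    then show "flow_div (\<lambda>e. f (?s e)) p = 0" by (simp add: flow_div_shift)
  next
    fix z :: "'d \<Rightarrow> int" and i assume z: "z \<in> cube N"
    let ?q = "\<lambda>j. D * z j + o'"
    have sum: "(\<Sum>q\<in>subcube D z. f (?s (q, i))) = (\<Sum>p\<in>ibox ?q (\<lambda>j. ?q j + D). f (p, i))"
      using sum_ibox_shift[of "\<lambda>p. f (p, i)" "\<lambda>_. o'" "\<lambda>j. D * z j" "\<lambda>j. D * z j + D"]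
      by (simp add: shift_def subcube_def algebra_simps)
    have bounds: "0 \<le> D * z j" "D * z j + D \<le> D * N" for j
    proof -
      have z: "0 \<le> z j" "z j + 1 \<le> N" using cubeD[OF z, of j] by simp_all
      then show "0 \<le> D * z j" using D by simp
      have "D * (z j + 1) \<le> D * N" using z D by (intro mult_left_mono) auto
      then show "D * z j + D \<le> D * N" by (simp add: algebra_simps)
    qed
    have half: "2 * (int n div 2) \<le> int n" "int n \<le> 2 * (int n div 2) + 1" by simp_all
    have "- int n \<le> 2 * ?q j" for j
      using bounds(1)[of j] half unfolding o'_def by simp
    moreover have "2 * (?q j + D) \<le> int n" for j
      using bounds(2)[of j] fit half unfolding o'_def by simp
    ultimately show "\<bar>(\<Sum>q\<in>subcube D z. f (?s (q, i))) - w $ i * real_of_int D ^ CARD('d)\<bar>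
        \<le> 2 * (real n / D) ^ (CARD('d) + 1) * \<epsilon> * real_of_int D ^ CARD('d)"
      unfolding sum by (intro near_flow_cube_average[OF n D _ _ f(2) \<epsilon>])
  qed
qed

text \<open>Capacities are at most \<open>M\<close> almost surely, and moving the core to the origin
  does not change the law.\<close>

lemma measure_near_flow_le_core_event:
  fixes w :: "real ^ 'd::finite" and G :: "real measure"
  assumes G: "prob_space G" and sG: "sets G = sets borel" and M: "AE x in G. x \<le> M" and M0: "M \<ge> 0"
    and n: "n \<ge> 1" and D: "D \<ge> 1" and N: "N \<ge> 1" and fit: "D * N \<le> int n - 2" and \<epsilon>: "\<epsilon> \<ge> 0"
  shows "measure (\<Pi>\<^sub>M e\<in>UNIV. G) {c. near_flow n w \<epsilon> c} \<le>
    measure (\<Pi>\<^sub>M e\<in>UNIV. G) {c. core_event (($) w) N D M (2 * (real n / D) ^ (CARD('d) + 1) * \<epsilon>) c}"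
proof -
  let ?O = "\<Pi>\<^sub>M e\<in>(UNIV :: (('d \<Rightarrow> int) \<times> 'd) set). G"
  let ?E = "core_event (($) w) N D M (2 * (real n / D) ^ (CARD('d) + 1) * \<epsilon>)"
  let ?s = "shift (\<lambda>_. - (int n div 2) + 1) :: ('d \<Rightarrow> int) \<times> 'd \<Rightarrow> _"
  interpret prob_space ?O by (intro prob_space_PiM G)
  have "AE c in ?O. \<forall>e. c e \<le> M"
    unfolding AE_all_countable by (intro allI AE_PiM_component G M) auto
  then have "AE c in ?O. c \<in> {c. near_flow n w \<epsilon> c} \<longrightarrow> c \<in> {c. ?E (\<lambda>e. c (?s e))}"
    by eventually_elim (use near_flow_core_event[OF n D N fit \<epsilon>] in blast)
  moreover note reindex = measure_PiM_reindex[where \<Phi>="?E", OF G sG inj_shift core_event_borel[OF D M0]]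
  ultimately have "measure ?O {c. near_flow n w \<epsilon> c} \<le> measure ?O {c. ?E (\<lambda>e. c (?s e))}"
    by (intro finite_measure_mono_AE) (simp_all add: sets_PiM_UNIV_borel[OF sG])
  then show ?thesis by (simp only: reindex(2))
qed

text \<open>One subcube suffices: it averages values bounded by \<open>M\<close>. With \<gamma>
  tending to 0 this shows that a target approached with positive probability has components of size
  at most \<open>M\<close>.\<close>

lemma core_event_average_le:
  assumes "core_event u N D M \<gamma> c" "D \<ge> 1" "N \<ge> 1"
  shows "\<bar>u i\<bar> \<le> M + \<gamma>"
proof -
  obtain f where f: "\<And>e. e \<in> core_edges (D * N) \<Longrightarrow> \<bar>f e\<bar> \<le> M"
    "\<And>z i. z \<in> cube N \<Longrightarrow> \<bar>(\<Sum>q\<in>subcube D z. f (q, i)) - u i * real_of_int D ^ CARD('a)\<bar> \<le> \<gamma> * real_of_int D ^ CARD('a)"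
    using assms(1) unfolding core_event_def by blast
  have z: "(\<lambda>_. 0) \<in> cube N" using assms by (simp add: cube_def ibox_def)
  let ?S = "subcube D (\<lambda>_. 0) :: ('a \<Rightarrow> int) set"
  have "\<bar>\<Sum>q\<in>?S. f (q, i)\<bar> \<le> (\<Sum>q\<in>?S. M)"
  proof (rule order_trans[OF sum_abs], rule sum_mono)
    fix q assume "q \<in> ?S"
    then have "q \<in> cube (D * N)" using subcube_in_cube[OF assms(2) z] by blast
    then show "\<bar>f (q, i)\<bar> \<le> M" by (intro f(1) cube_core_edges(1))
  qed
  also have "\<dots> = M * real_of_int D ^ CARD('a)" using assms(2) by (simp add: card_subcube)
  finally have "\<bar>u i * real_of_int D ^ CARD('a)\<bar> \<le> (M + \<gamma>) * real_of_int D ^ CARD('a)"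
    using f(2)[OF z, of i] by (simp add: algebra_simps)
  then show ?thesis using assms(2) by (simp add: abs_mult)
qed

text \<open>Multiplying the core flow by \<open>1 - \<eta>\<close> before the extension leaves
  \<open>\<eta> * M\<close> of capacity in the shell for the transports and costs at most
  \<open>\<eta> * M\<close> in the mean over the core.\<close>

lemma core_to_tile:
  fixes u :: "'d::finite \<Rightarrow> real" and D m k b a w l :: int and M \<gamma> \<eta> \<kappa> :: real
  assumes d: "CARD('d) \<ge> 2" and D: "D \<ge> 1" and m: "m \<ge> 1" and k: "k \<ge> 1" and b: "b \<ge> 1"
    and a: "a = D * m" and w: "w = k * a" and l: "l = b * a"
    and core: "core_event u (k * m) D M \<gamma> c"
    and \<eta>: "0 \<le> \<eta>" "\<eta> \<le> 1" and M: "M \<ge> 0" and \<gamma>: "\<gamma> \<ge> 0" and u: "\<And>i. \<bar>u i\<bar> \<le> M"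
    and kappa: "\<kappa> = (real_of_int (w + 2 * l) / l) ^ CARD('d)"
  obtains h where
    "\<And>e. e \<in> core_edges w \<Longrightarrow> \<bar>h e\<bar> \<le> c e"
    "\<And>e. e \<in> core_edges w \<Longrightarrow> \<bar>h e\<bar> \<le> M"
    "\<And>p i. p \<notin> tile w l \<or> p i + 1 \<ge> w + l \<Longrightarrow> h (p, i) = (1 - \<eta>) * u i"
    "\<And>p. flow_div h p = 0"
    "\<And>e. e \<notin> core_edges w \<Longrightarrow> \<bar>h e\<bar> \<le> (1 - \<eta>) * M + CARD('d) * (4 * M / b)
        + 4 * CARD('d) * (\<gamma> + 2 * CARD('d) * M / m) * (1 + \<kappa>)\<^sup>2 * (real_of_int (w + 2 * l) / l)"
    "\<And>i. \<bar>(\<Sum>p\<in>cube w. h (p, i)) - u i * real_of_int w ^ CARD('d)\<bar> \<le> (\<gamma> + \<eta> * M) * real_of_int w ^ CARD('d)"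
proof -
  have a1: "a \<ge> 1" using mult_mono[of 1 D 1 m] D m by (simp add: a)
  have km: "k * m \<ge> 1" using mult_mono[of 1 k 1 m] k m by simp
  have wD: "w = D * (k * m)" by (simp add: w a)
  have w1: "w \<ge> 1" using mult_mono[of 1 D 1 "k * m"] D km by (simp add: wD)
  obtain f where f: "\<And>e. e \<in> core_edges w \<Longrightarrow> \<bar>f e\<bar> \<le> c e" "\<And>e. e \<in> core_edges w \<Longrightarrow> \<bar>f e\<bar> \<le> M"
    "\<And>p. p \<in> cube w \<Longrightarrow> flow_div f p = 0"
    "\<And>z i. z \<in> cube (k * m) \<Longrightarrow> \<bar>(\<Sum>q\<in>subcube D z. f (q, i)) - u i * real_of_int D ^ CARD('d)\<bar> \<le> \<gamma> * real_of_int D ^ CARD('d)"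
    using core unfolding core_event_def wD[symmetric] by blast
  let ?\<gamma> = "\<gamma> + 2 * CARD('d) * M / m"
  define g where "g e = (1 - \<eta>) * f e" for e
  have g_f: "\<bar>g e\<bar> \<le> (1 - \<eta>) * B" if "\<bar>f e\<bar> \<le> B" for e B
    using that \<eta> by (simp add: g_def abs_mult mult_left_mono)
  have flux: "\<bar>\<Sum>q\<in>patch a w i p. g (q, i) - (1 - \<eta>) * u i\<bar> \<le> ?\<gamma> * card (patch a w i p)"
    if "p i = - 1 \<or> p i = w - 1" "\<And>j. j \<noteq> i \<Longrightarrow> 0 \<le> p j \<and> p j < w" for p i
  proof -
    have "\<bar>\<Sum>q\<in>patch a w i p. f (q, i) - u i\<bar> \<le> ?\<gamma> * card (patch a w i p)"
      by (rule patch_flux_from_subcubes[where f=f and u=u and \<gamma>=\<gamma> and i=i and p=p and M=M, OF D m a k w f(2,3,4) that(2,1) M])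
    moreover have "(\<Sum>q\<in>patch a w i p. g (q, i) - (1 - \<eta>) * u i) = (1 - \<eta>) * (\<Sum>q\<in>patch a w i p. f (q, i) - u i)"
      by (simp add: g_def sum_distrib_left right_diff_distrib)
    moreover have "(1 - \<eta>) * \<bar>X\<bar> \<le> \<bar>X\<bar>" for X :: real using \<eta> by (simp add: mult_left_le_one_le)
    ultimately show ?thesis using \<eta> by (simp add: abs_mult) (meson order_trans)
  qed
  have A: "(1 - \<eta>) * M \<le> M" using \<eta> M by (simp add: mult_left_le_one_le)
  have \<gamma>0: "?\<gamma> \<ge> 0" using \<gamma> M m by simp
  obtain h where h: "\<And>e. e \<in> core_edges w \<Longrightarrow> h e = g e"
    "\<And>p i. p \<notin> tile w l \<or> p i + 1 \<ge> w + l \<Longrightarrow> h (p, i) = (1 - \<eta>) * u i"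
    "\<And>p. flow_div h p = 0"
    "\<And>e. e \<notin> core_edges w \<Longrightarrow> \<bar>h e\<bar> \<le> (1 - \<eta>) * M + CARD('d) * (4 * ((1 - \<eta>) * M) / b)
       + 4 * CARD('d) * ?\<gamma> * (1 + \<kappa>)\<^sup>2 * (real_of_int (w + 2 * l) / l)"
  proof (rule tile_extension[where f=g and u="\<lambda>i. (1 - \<eta>) * u i" and A="(1 - \<eta>) * M" and \<gamma>="?\<gamma>", OF d a1 k b w l _ _ _ _ \<gamma>0 kappa])
    show "\<bar>g e\<bar> \<le> (1 - \<eta>) * M" if "e \<in> core_edges w" for e by (rule g_f[OF f(2)[OF that]])
    show "\<bar>(1 - \<eta>) * u i\<bar> \<le> (1 - \<eta>) * M" for i using u[of i] \<eta> by (simp add: abs_mult mult_left_mono)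
    show "flow_div g p = 0" if "p \<in> cube w" for p
      unfolding g_def[abs_def] using f(3)[OF that] by (simp add: flow_div_scale)
  qed (use flux that in \<open>blast+\<close>)
  show ?thesis
  proof (rule that[of h])
    show "\<bar>h e\<bar> \<le> c e" "\<bar>h e\<bar> \<le> M" if e: "e \<in> core_edges w" for e
    proof -
      have "\<bar>g e\<bar> \<le> \<bar>f e\<bar>" using \<eta> by (simp add: g_def abs_mult mult_left_le_one_le)
      then show "\<bar>h e\<bar> \<le> c e" "\<bar>h e\<bar> \<le> M" using f(1,2)[OF e] h(1)[OF e] by linarith+
    qed
    show "\<bar>h e\<bar> \<le> (1 - \<eta>) * M + CARD('d) * (4 * M / b)
        + 4 * CARD('d) * ?\<gamma> * (1 + \<kappa>)\<^sup>2 * (real_of_int (w + 2 * l) / l)" if e: "e \<notin> core_edges w" for e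
    proof -
      have "real CARD('d) * (4 * ((1 - \<eta>) * M) / b) \<le> real CARD('d) * (4 * M / b)"
        using A b by (intro mult_left_mono divide_right_mono) auto
      then show ?thesis using h(4)[OF e] by linarith
    qed
    show "\<bar>(\<Sum>p\<in>cube w. h (p, i)) - u i * real_of_int w ^ CARD('d)\<bar> \<le> (\<gamma> + \<eta> * M) * real_of_int w ^ CARD('d)" for i
    proof -
      have cube: "ibox (\<lambda>_. D * 0) (\<lambda>_. D * (k * m)) = (cube w :: ('d \<Rightarrow> int) set)" by (simp add: cube_def wD)
      have card: "real (card (cube w :: ('d \<Rightarrow> int) set)) = real_of_int w ^ CARD('d)"
        using w1 by (simp add: cube_def card_ibox)
      have "\<bar>(\<Sum>q\<in>cube w. f (q, i)) - u i * real_of_int w ^ CARD('d)\<bar> \<le> \<gamma> * real_of_int w ^ CARD('d)"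
        using sum_ibox_deviation[OF D, of "\<lambda>_. 0" "\<lambda>_. k * m" "\<lambda>q. f (q, i)" "u i" \<gamma>] f(4)
        unfolding cube card by (simp add: cube_def)
      moreover have "(\<Sum>q\<in>cube w. h (q, i)) = (1 - \<eta>) * (\<Sum>q\<in>cube w. f (q, i))"
        unfolding sum_distrib_left by (intro sum.cong refl) (simp add: h(1) cube_core_edges(1) g_def)
      ultimately have "\<bar>(\<Sum>q\<in>cube w. h (q, i)) - u i * real_of_int w ^ CARD('d)\<bar>
          \<le> (1 - \<eta>) * (\<gamma> * real_of_int w ^ CARD('d)) + \<eta> * (\<bar>u i\<bar> * real_of_int w ^ CARD('d))"
      proof -
        let ?F = "\<Sum>q\<in>cube w. f (q, i)" and ?W = "real_of_int w ^ CARD('d)"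
        assume F: "\<bar>?F - u i * ?W\<bar> \<le> \<gamma> * ?W" and H: "(\<Sum>q\<in>cube w. h (q, i)) = (1 - \<eta>) * ?F"
        have "(\<Sum>q\<in>cube w. h (q, i)) - u i * ?W = (1 - \<eta>) * (?F - u i * ?W) - \<eta> * (u i * ?W)"
          by (simp add: H algebra_simps)
        also have "\<bar>\<dots>\<bar> \<le> \<bar>(1 - \<eta>) * (?F - u i * ?W)\<bar> + \<bar>\<eta> * (u i * ?W)\<bar>" by (rule abs_triangle_ineq4)
        also have "\<dots> \<le> (1 - \<eta>) * (\<gamma> * ?W) + \<eta> * (\<bar>u i\<bar> * ?W)"
          using F \<eta> w1 by (simp add: abs_mult mult_left_mono)
        finally show ?thesis .
      qed
      also have "\<dots> \<le> \<gamma> * real_of_int w ^ CARD('d) + \<eta> * (M * real_of_int w ^ CARD('d))"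
        using u[of i] \<eta> w1 \<gamma> by (intro add_mono mult_left_mono mult_right_mono mult_left_le_one_le) auto
      finally show ?thesis by (simp add: algebra_simps)
    qed
  qed (use h in auto)
qed

section \<open>Placing and gluing the tiles\<close>

definition tile_corner :: "int \<Rightarrow> int \<Rightarrow> ('d \<Rightarrow> int) \<Rightarrow> 'd \<Rightarrow> int" where
  "tile_corner s T b = (\<lambda>j. s + T * b j)"

definition tile_index :: "int \<Rightarrow> int \<Rightarrow> ('d \<Rightarrow> int) \<Rightarrow> 'd \<Rightarrow> int" where
  "tile_index s T p = (\<lambda>j. (p j - s) div T)"

lemma tile_index_eq_iff:
  assumes "T \<ge> 1"
  shows "tile_index s T p = b \<longleftrightarrow> p \<in> ibox (tile_corner s T b) (\<lambda>j. tile_corner s T b j + T)"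
proof -
  have "(p j - s) div T = b j \<longleftrightarrow> tile_corner s T b j \<le> p j \<and> p j < tile_corner s T b j + T" for j
    unfolding div_eq_iff_bounds[OF assms] tile_corner_def by linarith
  then show ?thesis by (simp add: tile_index_def ibox_def fun_eq_iff)
qed

text \<open>The origin of a tile is the corner of its core; the added \<open>l\<close> puts the
  lower corner of the tile itself at \<open>tile_corner\<close>.\<close>

definition core_shift :: "int \<Rightarrow> int \<Rightarrow> int \<Rightarrow> ('d \<Rightarrow> int) \<Rightarrow> ('d \<Rightarrow> int) \<times> 'd \<Rightarrow> ('d \<Rightarrow> int) \<times> 'd" where
  "core_shift s T l b = shift (\<lambda>j. tile_corner s T b j + l)"

lemma tile_index_core_shift:
  assumes "T = w + 2 * l" "T \<ge> 1"
  shows "tile_index s T (\<lambda>j. p j + (tile_corner s T b j + l)) = b \<longleftrightarrow> p \<in> tile w l"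
proof -
  have "tile_corner s T b j \<le> p j + (tile_corner s T b j + l) \<and> p j + (tile_corner s T b j + l) < tile_corner s T b j + T
     \<longleftrightarrow> - l \<le> p j \<and> p j < w + l" for j
    unfolding assms(1) by linarith
  then show ?thesis unfolding tile_index_eq_iff[OF assms(2)] by (simp add: ibox_def tile_def)
qed

text \<open>Each edge takes its value from the tile of its starting point. Every tile flow equals
  the same constant \<open>u\<close> across its boundary, so at each node the glued flow agrees with
  a single tile flow or with \<open>u\<close>, and the node law is inherited.\<close>

lemma glue_tiles:
  fixes u :: "'d::finite \<Rightarrow> real" and hb :: "('d \<Rightarrow> int) \<Rightarrow> ('d \<Rightarrow> int) \<times> 'd \<Rightarrow> real"
  assumes T: "T = w + 2 * l" "T \<ge> 1"
    and out: "\<And>b p i. b \<in> I \<Longrightarrow> p \<notin> tile w l \<or> p i + 1 \<ge> w + l \<Longrightarrow> hb b (p, i) = u i"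
    and div: "\<And>b p. b \<in> I \<Longrightarrow> flow_div (hb b) p = 0"
  obtains h where "\<And>p. flow_div h p = 0"
    "\<And>b p i. b \<in> I \<Longrightarrow> p \<in> tile w l \<Longrightarrow> h (core_shift s T l b (p, i)) = hb b (p, i)"
    "\<And>p i. tile_index s T p \<notin> I \<Longrightarrow> h (p, i) = u i"
proof -
  define loc where "loc p = (\<lambda>j. p j - (tile_corner s T (tile_index s T p) j + l))" for p :: "'d \<Rightarrow> int"
  define h where "h e = (case e of (p, i) \<Rightarrow>
    if tile_index s T p \<in> I then hb (tile_index s T p) (loc p, i) else u i)" for e
  have loc_tile: "loc p \<in> tile w l" for p
    using tile_index_core_shift[OF T, of s "loc p" "tile_index s T p"] by (simp add: loc_def)
  \<comment> \<open>Such an edge is the last one of the lower tile in direction \<open>i\<close>,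
    where \<open>hb\<close> equals \<open>u i\<close>; if it starts outside the tiles, it has this
    value by definition.\<close>
  have cross: "h (p(i := p i - 1), i) = u i" if ne: "tile_index s T (p(i := p i - 1)) \<noteq> tile_index s T p" for p i
  proof (cases "tile_index s T (p(i := p i - 1)) \<in> I")
    case True
    let ?p' = "p(i := p i - 1)"
    let ?b = "tile_index s T ?p'"
    have in': "?p' \<in> ibox (tile_corner s T ?b) (\<lambda>j. tile_corner s T ?b j + T)"
      using tile_index_eq_iff[OF T(2), of s ?p' ?b] by blast
    have "p i \<ge> tile_corner s T ?b i + T"
    proof (rule ccontr)
      assume n: "\<not> ?thesis"
      have "tile_corner s T ?b j \<le> p j \<and> p j < tile_corner s T ?b j + T" for j
      proof (cases "j = i")
        case True
        have "tile_corner s T ?b i \<le> ?p' i" using in' unfolding ibox_def by blast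
        then show ?thesis using n True by simp
      next
        case False
        have "tile_corner s T ?b j \<le> ?p' j \<and> ?p' j < tile_corner s T ?b j + T" using in' unfolding ibox_def by blast
        then show ?thesis using False by simp
      qed
      then have "tile_index s T p = ?b" unfolding tile_index_eq_iff[OF T(2)] ibox_def by blast
      with ne show False by simp
    qed
    then have "loc ?p' i + 1 \<ge> w + l" by (simp add: loc_def T(1))
    then show ?thesis using out[OF True] True by (simp add: h_def)
  qed (simp add: h_def)
  show ?thesis
  proof (rule that[of h])
    show "h (p, i) = u i" if "tile_index s T p \<notin> I" for p i using that by (simp add: h_def)
    show "h (core_shift s T l b (p, i)) = hb b (p, i)" if "b \<in> I" "p \<in> tile w l" for b p i
    proof -
      have eq: "tile_index s T (\<lambda>j. p j + (tile_corner s T b j + l)) = b"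
        using tile_index_core_shift[OF T] that(2) by blast
      have "loc (\<lambda>j. p j + (tile_corner s T b j + l)) = p" unfolding loc_def eq by simp
      then show ?thesis using that(1) by (simp add: h_def core_shift_def shift_def eq)
    qed
    show "flow_div h p = 0" for p
    proof (cases "tile_index s T p \<in> I")
      case True
      let ?b = "tile_index s T p"
      have "h (p(i := p i - 1), i) = hb ?b ((loc p)(i := loc p i - 1), i)" for i
      proof (cases "tile_index s T (p(i := p i - 1)) = ?b")
        case eq: True
        have "loc (p(i := p i - 1)) = (loc p)(i := loc p i - 1)" by (auto simp: loc_def eq fun_eq_iff)
        then show ?thesis using True by (simp add: h_def eq)
      next
        case False
        \<comment> \<open>Seen from the upper tile, the edge starts outside that tile, where its
          flow equals \<open>u i\<close> too.\<close>
        have "(loc p)(i := loc p i - 1) \<notin> tile w l"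
        proof
          assume "(loc p)(i := loc p i - 1) \<in> tile w l"
          then have "tile_index s T (\<lambda>j. ((loc p)(i := loc p i - 1)) j + (tile_corner s T ?b j + l)) = ?b"
            using tile_index_core_shift[OF T] by blast
          moreover have "(\<lambda>j. ((loc p)(i := loc p i - 1)) j + (tile_corner s T ?b j + l)) = p(i := p i - 1)"
            by (auto simp: loc_def fun_eq_iff)
          ultimately show False using False by simp
        qed
        then show ?thesis using out[OF True] cross[OF False] by simp
      qed
      then have "flow_div h p = flow_div (hb ?b) (loc p)"
        using True by (simp add: flow_div_def h_def)
      then show ?thesis using div[OF True] by simp
    next
      case False
      have "h (p(i := p i - 1), i) = u i" for i
      proof (cases "tile_index s T (p(i := p i - 1)) = tile_index s T p")
        case True
        then show ?thesis using False by (simp add: h_def)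
      qed (rule cross)
      then show ?thesis using False by (simp add: flow_div_def h_def)
    qed
  qed
qed

section \<open>Distance estimates from tile averages\<close>

definition borel_additive :: "((real ^ 'd::finite) set \<Rightarrow> 'b::ab_group_add) \<Rightarrow> bool" where
  "borel_additive \<mu> \<longleftrightarrow> (\<forall>A B. A \<in> sets borel \<longrightarrow> B \<in> sets borel \<longrightarrow> A \<inter> B = {} \<longrightarrow> \<mu> (A \<union> B) = \<mu> A + \<mu> B)"

lemma borel_additiveD:
  "borel_additive \<mu> \<Longrightarrow> A \<in> sets borel \<Longrightarrow> B \<in> sets borel \<Longrightarrow> A \<inter> B = {} \<Longrightarrow> \<mu> (A \<union> B) = \<mu> A + \<mu> B"
  by (simp add: borel_additive_def)

lemma borel_additive_empty: "borel_additive \<mu> \<Longrightarrow> \<mu> {} = 0"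
  using borel_additiveD[of \<mu> "{}" "{}"] by simp

lemma borel_additive_diff: "borel_additive \<mu> \<Longrightarrow> borel_additive \<nu> \<Longrightarrow> borel_additive (\<lambda>A. \<mu> A - \<nu> A)"
  by (simp add: borel_additive_def)

lemma borel_additive_UN:
  assumes "borel_additive \<mu>" "finite I" "disjoint_family_on B I" "\<And>i. i \<in> I \<Longrightarrow> B i \<in> sets borel"
  shows "\<mu> (\<Union>i\<in>I. B i) = (\<Sum>i\<in>I. \<mu> (B i))"
  using assms(2-4)
proof (induction I)
  case empty
  then show ?case by (simp add: borel_additive_empty[OF assms(1)])
next
  case (insert i I)
  have "B i \<inter> (\<Union>j\<in>I. B j) = {}" using insert.hyps(2) insert.prems(1) by (force simp: disjoint_family_on_def)
  then have "\<mu> (B i \<union> (\<Union>j\<in>I. B j)) = \<mu> (B i) + \<mu> (\<Union>j\<in>I. B j)"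
    using insert.prems(2) insert.hyps(1) by (intro borel_additiveD[OF assms(1)] sets.finite_UN) auto
  moreover have "\<mu> (\<Union>j\<in>I. B j) = (\<Sum>j\<in>I. \<mu> (B j))"
    using insert by (intro insert.IH) (auto intro: disjoint_family_on_mono)
  ultimately show ?case using insert.hyps by simp
qed

lemma borel_additive_split:
  assumes "borel_additive \<mu>" "finite I" "disjoint_family_on B I" "\<And>i. i \<in> I \<Longrightarrow> B i \<in> sets borel" "A \<in> sets borel"
  shows "\<mu> A = (\<Sum>i\<in>I. \<mu> (A \<inter> B i)) + \<mu> (A - (\<Union>i\<in>I. B i))"
proof -
  have U: "(\<Union>i\<in>I. B i) \<in> sets borel" using assms(2,4) by (intro sets.finite_UN) auto
  have "\<mu> A = \<mu> ((\<Union>i\<in>I. A \<inter> B i) \<union> (A - (\<Union>i\<in>I. B i)))" by (rule arg_cong[where f=\<mu>]) blast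
  also have "\<dots> = \<mu> (\<Union>i\<in>I. A \<inter> B i) + \<mu> (A - (\<Union>i\<in>I. B i))"
    using assms U by (intro borel_additiveD[OF assms(1)] sets.finite_UN) auto
  also have "\<mu> (\<Union>i\<in>I. A \<inter> B i) = (\<Sum>i\<in>I. \<mu> (A \<inter> B i))"
    using assms by (intro borel_additive_UN) (auto simp: disjoint_family_on_def)
  finally show ?thesis .
qed

text \<open>A majorant, uniform over all flows bounded by \<open>M\<close>, of the total variation
  of stream minus target. Unlike the norm of the difference it is monotone, so it controls cut tiles
  and leftovers.\<close>

definition variation :: "nat \<Rightarrow> real ^ 'd::finite \<Rightarrow> real \<Rightarrow> (real ^ 'd) set \<Rightarrow> real" where
  "variation n w M A = (\<Sum>e\<in>visible_edges n. indicator A (center (edge n e)) * M) / real n ^ CARD('d)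
     + measure lborel (A \<inter> unit_cube) * norm w"

lemma borel_additive_variation: "borel_additive (variation n (w :: real ^ 'd::finite) M)"
  unfolding borel_additive_def
proof (intro allI impI)
  fix A B :: "(real ^ 'd) set" assume *: "A \<in> sets borel" "B \<in> sets borel" "A \<inter> B = {}"
  have "measure lborel ((A \<union> B) \<inter> unit_cube) = measure lborel (A \<inter> unit_cube) + measure lborel (B \<inter> unit_cube)"
    using * emeasure_unit_cube_subset[OF *(1)] emeasure_unit_cube_subset[OF *(2)]
    by (subst Int_Un_distrib2, intro measure_Union)
       (auto simp: unit_cube_eq_hbox)
  moreover have "indicator (A \<union> B) x = (indicator A x + indicator B x :: real)" for x
    using *(3) by (auto simp: indicator_def)
  ultimately show "variation n w M (A \<union> B) = variation n w M A + variation n w M B"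
    by (simp add: variation_def distrib_right sum.distrib add_divide_distrib)
qed

lemma variation_nonneg: "M \<ge> 0 \<Longrightarrow> variation n w M A \<ge> 0"
  by (simp add: variation_def sum_nonneg)

lemma variation_mono:
  assumes "M \<ge> 0" "A \<subseteq> B" "A \<in> sets borel" "B \<in> sets borel"
  shows "variation n w M A \<le> variation n w M B"
proof -
  have "B = A \<union> (B - A)" using assms(2) by blast
  then have "variation n w M B = variation n w M A + variation n w M (B - A)"
    using borel_additiveD[OF borel_additive_variation, of A "B - A" n w M] assms by auto
  then show ?thesis using variation_nonneg[OF assms(1)] by simp
qed

lemma variation_Int_unit_cube: "variation n w M (A \<inter> unit_cube) = variation n w M A"
proof -
  have "(\<Sum>e\<in>visible_edges n. indicator (A \<inter> unit_cube) (center (edge n e)) * M) =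
      (\<Sum>e\<in>visible_edges n. indicator A (center (edge n e)) * M)"
    by (intro sum.cong refl) (auto simp: visible_edges_def indicator_def)
  then show ?thesis by (simp add: variation_def Int_assoc)
qed

definition defect :: "nat \<Rightarrow> real ^ 'd::finite \<Rightarrow> (('d \<Rightarrow> int) \<times> 'd \<Rightarrow> real) \<Rightarrow> (real ^ 'd) set \<Rightarrow> real ^ 'd" where
  "defect n w f A = target w A - flow_measure n f A"

lemma borel_additive_defect: "borel_additive (defect n (w :: real ^ 'd::finite) f)"
  unfolding defect_def[abs_def]
proof (rule borel_additive_diff)
  show "borel_additive (target w)"
    unfolding borel_additive_def
  proof (intro allI impI)
    fix A B :: "(real ^ 'd) set" assume *: "A \<in> sets borel" "B \<in> sets borel" "A \<inter> B = {}"
    have "measure lborel ((A \<union> B) \<inter> unit_cube) = measure lborel (A \<inter> unit_cube) + measure lborel (B \<inter> unit_cube)"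
      using * emeasure_unit_cube_subset[OF *(1)] emeasure_unit_cube_subset[OF *(2)]
      by (subst Int_Un_distrib2, intro measure_Union)
         (auto simp: unit_cube_eq_hbox)
    then show "target w (A \<union> B) = target w A + target w B"
      using *(1,2) by (simp add: target_eq scaleR_left_distrib)
  qed
  show "borel_additive (flow_measure n f)"
    unfolding borel_additive_def
  proof (intro allI impI)
    fix A B :: "(real ^ 'd) set" assume "A \<inter> B = {}"
    then have "indicator (A \<union> B) x = (indicator A x + indicator B x :: real)" for x
      by (auto simp: indicator_def)
    then show "flow_measure n f (A \<union> B) = flow_measure n f A + flow_measure n f B"
      by (simp add: flow_measure_def distrib_right scaleR_left_distrib sum.distrib scaleR_right_distrib)
  qed
qed

lemma norm_defect_le:
  fixes w :: "real ^ 'd::finite" and M :: real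
  assumes A: "A \<in> sets borel" and f: "\<And>e. \<bar>f e\<bar> \<le> M"
  shows "norm (defect n w f A) \<le> variation n w M A"
proof -
  have "norm (flow_measure n f A) \<le> (1 / real n ^ CARD('d)) *
      norm (\<Sum>e\<in>visible_edges n. (indicator A (center (edge n e)) * f e) *\<^sub>R (axis (snd e) 1 :: real ^ 'd))"
    by (simp add: flow_measure_def)
  also have "\<dots> \<le> (1 / real n ^ CARD('d)) * (\<Sum>e\<in>visible_edges n. indicator A (center (edge n e)) * M)"
  proof (intro mult_left_mono order_trans[OF norm_sum] sum_mono)
    fix e :: "('d \<Rightarrow> int) \<times> 'd"
    show "norm ((indicator A (center (edge n e)) * f e) *\<^sub>R (axis (snd e) 1 :: real ^ 'd)) \<le> indicator A (center (edge n e)) * M"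
      using f[of e] by (auto simp: indicator_def)
  qed simp
  finally have "norm (flow_measure n f A) \<le> (\<Sum>e\<in>visible_edges n. indicator A (center (edge n e)) * M) / real n ^ CARD('d)"
    by simp
  moreover have "norm (target w A) = measure lborel (A \<inter> unit_cube) * norm w"
    using A by (simp add: target_eq)
  ultimately show ?thesis
    unfolding defect_def variation_def by (intro order_trans[OF norm_triangle_ineq4]) simp
qed

text \<open>The factor 1 + 1/n pays for the additional layer in
  \<open>visible_edges_subset\<close>.\<close>

lemma variation_unit_cube_le:
  fixes w :: "real ^ 'd::finite" and M :: real
  assumes n: "n \<ge> 1" and M: "M \<ge> 0"
  shows "variation n w M unit_cube \<le> CARD('d) * M * (1 + 1 / real n) ^ CARD('d) + norm w"
proof -
  let ?B = "ibox (\<lambda>_. - (int n div 2) - 1) (\<lambda>_. - (int n div 2) + int n) :: ('d \<Rightarrow> int) set"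
  have "card (visible_edges n :: (('d \<Rightarrow> int) \<times> 'd) set) \<le> card (?B \<times> (UNIV :: 'd set))"
    by (intro card_mono visible_edges_subset[OF n]) auto
  also have "\<dots> = (n + 1) ^ CARD('d) * CARD('d)"
  proof -
    have "nat (- (int n div 2) + int n - (- (int n div 2) - 1)) = n + 1" by simp
    then show ?thesis unfolding card_cartesian_product card_ibox by simp
  qed
  finally have "real (card (visible_edges n :: (('d \<Rightarrow> int) \<times> 'd) set)) \<le> real ((n + 1) ^ CARD('d) * CARD('d))"
    by (simp only: of_nat_le_iff)
  then have "(\<Sum>e\<in>(visible_edges n :: (('d \<Rightarrow> int) \<times> 'd) set). indicator unit_cube (center (edge n e)) * M)
      \<le> real ((n + 1) ^ CARD('d) * CARD('d)) * M"
    using M by (simp add: visible_edges_def mult_right_mono)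
  then have "(\<Sum>e\<in>(visible_edges n :: (('d \<Rightarrow> int) \<times> 'd) set). indicator unit_cube (center (edge n e)) * M) / real n ^ CARD('d)
      \<le> real ((n + 1) ^ CARD('d) * CARD('d)) * M / real n ^ CARD('d)"
    by (rule divide_right_mono) simp
  also have "\<dots> = CARD('d) * M * ((real n + 1) / real n) ^ CARD('d)" by (simp add: power_divide add.commute)
  also have "(real n + 1) / real n = 1 + 1 / real n" using n by (simp add: field_simps)
  finally have "(\<Sum>e\<in>(visible_edges n :: (('d \<Rightarrow> int) \<times> 'd) set). indicator unit_cube (center (edge n e)) * M) / real n ^ CARD('d)
      \<le> CARD('d) * M * (1 + 1 / real n) ^ CARD('d)" .
  moreover have "measure lborel (unit_cube :: (real ^ 'd) set) = 1"
    unfolding unit_cube_eq_hbox by (subst measure_hbox) auto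
  ultimately show ?thesis by (simp add: variation_def)
qed

lemma variation_phys:
  fixes w :: "real ^ 'd::finite" and M :: real
  assumes n: "n \<ge> 1" and T: "T \<ge> 0" and sub: "phys n q T \<subseteq> (unit_cube :: (real ^ 'd) set)"
  shows "variation n w M (phys n q T) = (CARD('d) * M + norm w) * (real_of_int T / n) ^ CARD('d)"
proof -
  let ?I = "ibox q (\<lambda>j. q j + T)"
  note vis = ibox_visible[OF n sub]
  have "(\<Sum>e\<in>visible_edges n. indicator (phys n q T) (center (edge n e)) * M) = (\<Sum>e\<in>?I \<times> (UNIV :: 'd set). M)"
    by (rule sum.mono_neutral_cong_right[OF finite_visible_edges[OF n] vis])
       (auto simp: indicator_def center_in_phys[OF n])
  also have "\<dots> = CARD('d) * M * real_of_int T ^ CARD('d)"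
    using T by (simp add: card_cartesian_product card_ibox)
  finally have 1: "(\<Sum>e\<in>visible_edges n. indicator (phys n q T) (center (edge n e)) * M) = CARD('d) * M * real_of_int T ^ CARD('d)" .
  have "phys n q T \<inter> unit_cube = (phys n q T :: (real ^ 'd) set)" using sub by blast
  also have "measure lborel (phys n q T :: (real ^ 'd) set) = (\<Prod>i\<in>(UNIV :: 'd set). (q i + T) / n - q i / n)"
    unfolding phys_def using n T by (subst measure_hbox) (auto simp: divide_right_mono)
  also have "\<dots> = (real_of_int T / n) ^ CARD('d)" by (simp add: diff_divide_distrib[symmetric])
  finally have m: "measure lborel (phys n q T \<inter> unit_cube :: (real ^ 'd) set) = (real_of_int T / n) ^ CARD('d)" .
  have "CARD('d) * M * real_of_int T ^ CARD('d) / real n ^ CARD('d) = CARD('d) * M * (real_of_int T / n) ^ CARD('d)"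
    by (simp add: power_divide)
  then show ?thesis unfolding variation_def 1 m by (simp only: distrib_right mult.commute)
qed

section \<open>Tiles against the grids of the distance\<close>

lemma card_int_open_interval_le:
  fixes a b :: real
  assumes "a < b"
  shows "finite {j :: int. a < j \<and> j < b}" "real (card {j :: int. a < j \<and> j < b}) \<le> b - a + 1"
proof -
  have eq: "{j :: int. a < j \<and> j < b} = {\<lfloor>a\<rfloor> + 1..\<lceil>b\<rceil> - 1}"
    by (auto simp: floor_less_iff less_ceiling_iff) linarith+
  show "finite {j :: int. a < j \<and> j < b}" unfolding eq by simp
  have "real_of_int (\<lceil>b\<rceil> - 1 - \<lfloor>a\<rfloor>) \<le> b - a + 1" by linarith
  then have "real (nat (\<lceil>b\<rceil> - 1 - \<lfloor>a\<rfloor>)) \<le> b - a + 1"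
    using assms by (cases "\<lceil>b\<rceil> - 1 - \<lfloor>a\<rfloor> \<ge> 0") auto
  then show "real (card {j :: int. a < j \<and> j < b}) \<le> b - a + 1" unfolding eq by simp
qed

text \<open>A tile that lies in no cell of the grid is cut, in some direction, by one of the at most
  \<open>1/r + 1\<close> grid hyperplanes that meet the unit cube.\<close>

lemma card_straddling_tiles:
  fixes x :: "real ^ 'd::finite" and s T K :: int
  assumes n: "n \<ge> 1" and T: "T \<ge> 1" and K: "K \<ge> 1" and r: "r > 0"
    and fit: "- int n \<le> 2 * s" "2 * (s + T * K) \<le> int n"
  shows "real (card {b \<in> cube K. \<forall>p. \<not> phys n (\<lambda>j. s + T * b j) T \<subseteq> hcell r x p})
     \<le> CARD('d) * (1 / r + 1) * real_of_int K ^ (CARD('d) - 1)"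
proof -
  \<comment> \<open>The wall between the cells \<open>j\<close> and \<open>j + 1\<close> in
    direction \<open>i\<close>.\<close>
  define cut where "cut i j = x $ i + r * (real_of_int j + 1 / 2)" for i j
  define bad where "bad i = {t \<in> {0..<K}. \<exists>j. (s + T * t) / n < cut i j \<and> cut i j < (s + T * t + T) / n}" for i
  have fin_bad: "finite (bad i)" for i
    by (rule finite_subset[of _ "{0..<K}"]) (auto simp: bad_def)
  have card_bad: "real (card (bad i)) \<le> 1 / r + 1" for i
  proof -
    let ?J = "{j :: int. (- 1 / 2 - x $ i) / r - 1 / 2 < j \<and> j < (1 / 2 - x $ i) / r - 1 / 2}"
    have lt: "(- 1 / 2 - x $ i) / r - 1 / 2 < (1 / 2 - x $ i) / r - 1 / 2" using r by (simp add: divide_strict_right_mono)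
    have "\<exists>j. (s + T * t) / n < cut i j \<and> cut i j < (s + T * t + T) / n" if "t \<in> bad i" for t
      using that by (simp add: bad_def)
    then obtain g where g: "\<And>t. t \<in> bad i \<Longrightarrow> (s + T * t) / n < cut i (g t) \<and> cut i (g t) < (s + T * t + T) / n" by metis
    \<comment> \<open>A wall lies strictly inside at most one of the disjoint tile intervals, so the
      cut positions are counted by the walls.\<close>
    have "inj_on g (bad i)"
    proof (rule inj_onI)
      fix t t' assume t: "t \<in> bad i" "t' \<in> bad i" "g t = g t'"
      have "real_of_int (s + T * t) / n < real_of_int (s + T * t' + T) / n"
        "real_of_int (s + T * t') / n < real_of_int (s + T * t + T) / n"
        using g[OF t(1)] g[OF t(2)] t(3) by auto
      then have "s + T * t < s + T * t' + T" "s + T * t' < s + T * t + T"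
        using n by (simp_all add: divide_less_cancel del: of_int_add of_int_mult)
      then have "T * t < T * (t' + 1)" "T * t' < T * (t + 1)" by (simp_all add: algebra_simps)
      then have "t < t' + 1" "t' < t + 1" using T by (simp_all only: mult_less_cancel_left_pos[of T])
      then show "t = t'" by linarith
    qed
    moreover have "g ` bad i \<subseteq> ?J"
    proof
      fix j assume "j \<in> g ` bad i"
      then obtain t where t: "t \<in> bad i" "j = g t" by blast
      have t01: "0 \<le> t" "t + 1 \<le> K" using t(1) by (auto simp: bad_def)
      have "0 \<le> T * t" "T * (t + 1) \<le> T * K" using t01 T by (auto intro: mult_left_mono)
      then have "- int n \<le> 2 * (s + T * t)" "2 * (s + T * t + T) \<le> int n" using fit by (simp_all add: algebra_simps)
      then have "- real n \<le> 2 * real_of_int (s + T * t)" "2 * real_of_int (s + T * t + T) \<le> real n" by linarith+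
      then have "- 1 / 2 \<le> real_of_int (s + T * t) / n" "real_of_int (s + T * t + T) / n \<le> 1 / 2"
        using n by (simp_all add: field_simps)
      then have "- 1 / 2 < cut i j" "cut i j < 1 / 2" using g[OF t(1)] unfolding t(2) by linarith+
      then have "- 1 / 2 - x $ i < (j + 1 / 2) * r" "(j + 1 / 2) * r < 1 / 2 - x $ i"
        by (simp_all add: cut_def mult.commute)
      then have "(- 1 / 2 - x $ i) / r < j + 1 / 2" "j + 1 / 2 < (1 / 2 - x $ i) / r"
        using r by (simp_all only: pos_divide_less_eq pos_less_divide_eq)
      then show "j \<in> ?J" by simp
    qed
    then have "card (g ` bad i) \<le> card ?J"
      by (rule card_mono[OF card_int_open_interval_le(1)[OF lt]])
    ultimately have "card (bad i) \<le> card ?J" by (simp add: card_image)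
    then have "real (card (bad i)) \<le> real (card ?J)" by (simp only: of_nat_le_iff)
    also have "\<dots> \<le> (1 / 2 - x $ i) / r - 1 / 2 - ((- 1 / 2 - x $ i) / r - 1 / 2) + 1"
      by (rule card_int_open_interval_le(2)[OF lt])
    also have "\<dots> = 1 / r + 1" using r by (simp add: field_simps)
    finally show ?thesis .
  qed
  have sub: "{b \<in> cube K. \<forall>p. \<not> phys n (\<lambda>j. s + T * b j) T \<subseteq> hcell r x p} \<subseteq> (\<Union>i\<in>UNIV. {b \<in> cube K. b i \<in> bad i})"
  proof
    fix b assume b: "b \<in> {b \<in> cube K. \<forall>p. \<not> phys n (\<lambda>j. s + T * b j) T \<subseteq> hcell r x p}"
    show "b \<in> (\<Union>i\<in>UNIV. {b \<in> cube K. b i \<in> bad i})"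
    proof (rule ccontr)
      assume n': "b \<notin> (\<Union>i\<in>UNIV. {b \<in> cube K. b i \<in> bad i})"
      have good: "b i \<notin> bad i" for i using n' b by blast
      \<comment> \<open>The cell that contains the lower corner of the tile; as no wall cuts the
        tile, it contains the whole tile.\<close>
      define p where "p i = \<lfloor>(real_of_int (s + T * b i) / n - x $ i) / r + 1 / 2\<rfloor>" for i
      have "phys n (\<lambda>j. s + T * b j) T \<subseteq> hcell r x p"
      proof -
        have cell: "x $ i + r * (p i - 1 / 2) \<le> real_of_int (s + T * b i) / n \<and>
          real_of_int (s + T * b i + T) / n \<le> x $ i + r * (p i + 1 / 2)" for i
        proof -
          let ?\<alpha> = "real_of_int (s + T * b i) / n"
          have "real_of_int (p i) \<le> (?\<alpha> - x $ i) / r + 1 / 2" "(?\<alpha> - x $ i) / r + 1 / 2 < p i + 1"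
            unfolding p_def by linarith+
          then have "p i - 1 / 2 \<le> (?\<alpha> - x $ i) / r" "(?\<alpha> - x $ i) / r < p i + 1 / 2" by linarith+
          then have p': "(p i - 1 / 2) * r \<le> ?\<alpha> - x $ i" "?\<alpha> - x $ i < (p i + 1 / 2) * r"
            using r by (simp_all only: pos_divide_less_eq pos_le_divide_eq)
          have "b i \<in> {0..<K}" using b by (auto simp: cube_def ibox_def)
          then have "\<not> (?\<alpha> < cut i (p i) \<and> cut i (p i) < real_of_int (s + T * b i + T) / n)"
            using good[of i] by (auto simp: bad_def)
          moreover have "?\<alpha> < cut i (p i)" using p'(2) by (simp add: cut_def mult.commute)
          ultimately have "real_of_int (s + T * b i + T) / n \<le> x $ i + r * (p i + 1 / 2)"
            by (simp add: cut_def)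
          with p'(1) show ?thesis by (simp add: mult.commute)
        qed
        then show ?thesis unfolding phys_def hcell_def by (intro hbox_mono) simp_all
      qed
      with b show False by blast
    qed
  qed
  have card_i: "real (card {b \<in> cube K. b i \<in> bad i}) \<le> (1 / r + 1) * real_of_int K ^ (CARD('d) - 1)" for i
  proof -
    have "{b \<in> cube K. b i \<in> bad i} \<subseteq> (\<Pi>\<^sub>E j\<in>UNIV. if j = i then bad i else {0..<K})"
      by (auto simp: cube_def ibox_def PiE_iff)
    then have "card {b \<in> cube K. b i \<in> bad i} \<le> card (\<Pi>\<^sub>E j\<in>(UNIV :: 'd set). if j = i then bad i else {0..<K})"
      by (rule card_mono[rotated]) (auto intro!: finite_PiE fin_bad)
    also have "\<dots> = (\<Prod>j\<in>UNIV. if j = i then card (bad i) else nat K)"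
      by (subst card_PiE) (auto intro!: prod.cong)
    also have "\<dots> = card (bad i) * nat K ^ (CARD('d) - 1)"
      by (subst prod.remove[of _ i]) (simp_all add: card_Diff_singleton)
    finally have "real (card {b \<in> cube K. b i \<in> bad i}) \<le> real (card (bad i) * nat K ^ (CARD('d) - 1))"
      by (simp only: of_nat_le_iff)
    also have "\<dots> = real (card (bad i)) * real_of_int K ^ (CARD('d) - 1)" using K by simp
    also have "\<dots> \<le> (1 / r + 1) * real_of_int K ^ (CARD('d) - 1)"
      using card_bad K by (intro mult_right_mono) auto
    finally show ?thesis .
  qed
  have "card {b \<in> cube K. \<forall>p. \<not> phys n (\<lambda>j. s + T * b j) T \<subseteq> hcell r x p} \<le> card (\<Union>i\<in>(UNIV :: 'd set). {b \<in> cube K. b i \<in> bad i})"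
    by (rule card_mono[OF _ sub]) (simp add: cube_def)
  also have "\<dots> \<le> (\<Sum>i\<in>(UNIV :: 'd set). card {b \<in> cube K. b i \<in> bad i})" by (rule card_UN_le) simp
  finally have "real (card {b \<in> cube K. \<forall>p. \<not> phys n (\<lambda>j. s + T * b j) T \<subseteq> hcell r x p}) \<le>
     real (\<Sum>i\<in>(UNIV :: 'd set). card {b \<in> cube K. b i \<in> bad i})" by (simp only: of_nat_le_iff)
  also have "\<dots> \<le> (\<Sum>i\<in>(UNIV :: 'd set). (1 / r + 1) * real_of_int K ^ (CARD('d) - 1))"
    unfolding of_nat_sum by (intro sum_mono card_i)
  finally show ?thesis by simp
qed

text \<open>The cells are disjoint, so their variations add up.\<close>

lemma sum_norm_defect_le_variation:
  fixes w :: "real ^ 'd::finite" and M :: real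
  assumes r: "r > 0" and P: "finite P" and M: "M \<ge> 0" and f: "\<And>e. \<bar>f e\<bar> \<le> M" and A: "A \<in> sets borel"
  shows "(\<Sum>p\<in>P. norm (defect n w f (hcell r x p \<inter> A))) \<le> variation n w M A"
proof -
  have "(\<Sum>p\<in>P. norm (defect n w f (hcell r x p \<inter> A))) \<le> (\<Sum>p\<in>P. variation n w M (hcell r x p \<inter> A))"
    using A by (intro sum_mono norm_defect_le f) auto
  also have "\<dots> = variation n w M (\<Union>p\<in>P. hcell r x p \<inter> A)"
  proof (rule borel_additive_UN[OF borel_additive_variation P, symmetric])
    show "disjoint_family_on (\<lambda>p. hcell r x p \<inter> A) P"
      using hcell_disjoint[OF r] by (fastforce simp: disjoint_family_on_def)
  qed (use A in auto)
  also have "\<dots> \<le> variation n w M A"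
    using A P by (intro variation_mono[OF M] sets.finite_UN) auto
  finally show ?thesis .
qed

text \<open>Cut every cell along the tiles. A tile inside one cell contributes its mean error, at
  most \<open>CARD('d) * \<beta>\<close> times its volume. A tile cut by the grid contributes at
  most its variation, and \<open>card_straddling_tiles\<close> counts these. The part of the unit
  cube outside the tiles contributes its variation, which is the difference of the two
  powers.\<close>

lemma grid_defect_le:
  fixes w :: "real ^ 'd::finite" and s T K :: int and M \<beta> :: real
  assumes n: "n \<ge> 1" and T: "T \<ge> 1" and K: "K \<ge> 1" and r: "r > 0"
    and fit: "- int n \<le> 2 * s" "2 * (s + T * K) \<le> int n"
    and M: "M \<ge> 0" and f: "\<And>e. \<bar>f e\<bar> \<le> M" and "\<beta> \<ge> 0"
    and avg: "\<And>b i. b \<in> cube K \<Longrightarrow>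
      \<bar>(\<Sum>p\<in>ibox (\<lambda>j. s + T * b j) (\<lambda>j. s + T * b j + T). f (p, i)) - w $ i * real_of_int T ^ CARD('d)\<bar> \<le> \<beta> * real_of_int T ^ CARD('d)"
  shows "(\<Sum>p\<in>meeting r x. norm (defect n w f (hcell r x p))) \<le>
     CARD('d) * \<beta> + (CARD('d) * M + norm w) *
       (CARD('d) * (1 / r + 1) / K + (1 + 1 / real n) ^ CARD('d) - (real_of_int (K * T) / n) ^ CARD('d))"
proof -
  let ?d = "CARD('d)"
  define B where "B b = (phys n (\<lambda>j. s + T * b j) T :: (real ^ 'd) set)" for b
  define C where "C = ?d * M + norm w"
  define \<tau> where "\<tau> = (real_of_int T / n) ^ ?d"
  have C0: "C \<ge> 0" using M by (simp add: C_def)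
  have \<tau>0: "\<tau> \<ge> 0" using T by (simp add: \<tau>_def)
  have finK: "finite (cube K :: ('d \<Rightarrow> int) set)" by (simp add: cube_def)
  have cardK: "real (card (cube K :: ('d \<Rightarrow> int) set)) = real_of_int K ^ ?d"
    using K by (simp add: cube_def card_ibox)
  have B_borel: "B b \<in> sets borel" for b by (simp add: B_def)
  have B_sub: "B b \<subseteq> unit_cube" if b: "b \<in> cube K" for b
    unfolding B_def
  proof (rule phys_subset_unit_cube[OF n])
    fix j
    have bj: "0 \<le> b j" "b j + 1 \<le> K" using cubeD[OF b, of j] by simp_all
    have "0 \<le> T * b j" "T * (b j + 1) \<le> T * K" using bj T by (auto intro: mult_left_mono)
    then show "- int n \<le> 2 * (s + T * b j)" "2 * (s + T * b j + T) \<le> int n" using fit by (simp_all add: algebra_simps)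
  qed
  have B_disj: "disjoint_family_on B (cube K)"
    unfolding disjoint_family_on_def
  proof (intro ballI impI)
    fix b b' :: "'d \<Rightarrow> int" assume ne: "b \<noteq> b'"
    then obtain j where j: "b j \<noteq> b' j" by auto
    show "B b \<inter> B b' = {}"
    proof (rule ccontr)
      assume "B b \<inter> B b' \<noteq> {}"
      then obtain y where "y \<in> B b" "y \<in> B b'" by blast
      then have "real_of_int (s + T * b j) / n < real_of_int (s + T * b' j + T) / n"
        "real_of_int (s + T * b' j) / n < real_of_int (s + T * b j + T) / n"
        by (auto simp: B_def phys_def hbox_def intro: order.strict_trans1)
      then have "s + T * b j < s + T * b' j + T" "s + T * b' j < s + T * b j + T"
        using n by (simp_all add: divide_less_cancel del: of_int_add of_int_mult)
      then have "T * b j < T * (b' j + 1)" "T * b' j < T * (b j + 1)" by (simp_all add: algebra_simps)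
      then have "b j < b' j + 1" "b' j < b j + 1" using T by (simp_all only: mult_less_cancel_left_pos[of T])
      with j show False by linarith
    qed
  qed
  define P where "P = meeting r x"
  have finP: "finite P" unfolding P_def by (rule finite_meeting[OF r])
  define U where "U = (\<Union>b\<in>cube K. B b)"
  have U: "U \<in> sets borel" unfolding U_def using finK B_borel by (intro sets.finite_UN) auto
  have varB: "variation n w M (B b) = C * \<tau>" if "b \<in> cube K" for b
    using variation_phys[OF n _ B_sub[OF that, unfolded B_def]] T by (simp add: B_def C_def \<tau>_def)
  define bad where "bad = {b \<in> cube K. \<forall>p. \<not> B b \<subseteq> hcell r x p}"
  have tile_le: "(\<Sum>p\<in>P. norm (defect n w f (hcell r x p \<inter> B b))) \<le> ?d * \<beta> * \<tau> + (if b \<in> bad then C * \<tau> else 0)"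
    if b: "b \<in> cube K" for b
  proof (cases "b \<in> bad")
    case True
    have "(\<Sum>p\<in>P. norm (defect n w f (hcell r x p \<inter> B b))) \<le> C * \<tau>"
      using sum_norm_defect_le_variation[where A="B b" and n=n and w=w and x=x and f=f, OF r finP M f B_borel] by (simp add: varB[OF b])
    moreover have "0 \<le> ?d * \<beta> * \<tau>" using \<open>\<beta> \<ge> 0\<close> \<tau>0 by simp
    ultimately show ?thesis using True by simp
  next
    case False
    then obtain p0 where p0: "B b \<subseteq> hcell r x p0" using b by (auto simp: bad_def)
    have "norm (defect n w f (hcell r x p \<inter> B b)) \<le> (if p = p0 then norm (defect n w f (B b)) else 0)" for p
    proof (cases "p = p0")
      case True
      then show ?thesis using p0 by (simp add: Int_absorb1)
    next
      case ne: False
      then have "hcell r x p \<inter> B b = {}" using p0 hcell_disjoint[OF r ne, of x] by blast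
      then show ?thesis using borel_additive_empty[OF borel_additive_defect, of n w f] ne by simp
    qed
    then have "(\<Sum>p\<in>P. norm (defect n w f (hcell r x p \<inter> B b))) \<le> (\<Sum>p\<in>P. if p = p0 then norm (defect n w f (B b)) else 0)"
      by (rule sum_mono)
    also have "\<dots> \<le> norm (defect n w f (B b))" using finP by simp
    also have "\<dots> \<le> (\<Sum>i\<in>UNIV. \<bar>defect n w f (B b) $ i\<bar>)" by (rule norm_le_l1_cart)
    also have "\<dots> \<le> (\<Sum>i\<in>(UNIV :: 'd set). \<beta> * \<tau>)"
    proof (rule sum_mono)
      fix i
      let ?S = "\<Sum>p\<in>ibox (\<lambda>j. s + T * b j) (\<lambda>j. s + T * b j + T). f (p, i)"
      have "defect n w f (B b) $ i = (w $ i * real_of_int T ^ ?d - ?S) / real n ^ ?d"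
        using T by (simp add: defect_def B_def flow_measure_phys[OF n B_sub[OF b, unfolded B_def]]
            target_phys[OF n _ B_sub[OF b, unfolded B_def]] power_divide diff_divide_distrib mult.commute)
      then have "\<bar>defect n w f (B b) $ i\<bar> = \<bar>?S - w $ i * real_of_int T ^ ?d\<bar> / real n ^ ?d"
        by (simp add: abs_divide abs_minus_commute)
      also have "\<dots> \<le> \<beta> * real_of_int T ^ ?d / real n ^ ?d"
        by (intro divide_right_mono avg[OF b]) simp
      finally show "\<bar>defect n w f (B b) $ i\<bar> \<le> \<beta> * \<tau>" by (simp add: \<tau>_def power_divide)
    qed
    finally show ?thesis using False by simp
  qed
  have K\<tau>: "real_of_int K ^ ?d * \<tau> = (real_of_int (K * T) / n) ^ ?d"
    by (simp add: \<tau>_def power_mult_distrib[symmetric])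
  have K\<tau>0: "0 \<le> real_of_int K ^ ?d * \<tau>" using K \<tau>0 by simp
  have K\<tau>1: "real_of_int K ^ ?d * \<tau> \<le> 1"
  proof -
    have "K * T \<le> int n" using fit by (simp add: mult.commute)
    then have "real_of_int (K * T) \<le> real n" by linarith
    then have "real_of_int (K * T) / n \<le> 1" using n by (simp add: field_simps)
    then show ?thesis unfolding K\<tau> using K T n by (intro power_le_one) auto
  qed
  have "(\<Sum>p\<in>P. norm (defect n w f (hcell r x p))) \<le>
     (\<Sum>p\<in>P. (\<Sum>b\<in>cube K. norm (defect n w f (hcell r x p \<inter> B b))) + norm (defect n w f (hcell r x p - U)))"
  proof (rule sum_mono)
    fix p
    have "defect n w f (hcell r x p) = (\<Sum>b\<in>cube K. defect n w f (hcell r x p \<inter> B b)) + defect n w f (hcell r x p - U)"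
      unfolding U_def by (rule borel_additive_split[OF borel_additive_defect finK B_disj B_borel]) simp
    then show "norm (defect n w f (hcell r x p)) \<le> (\<Sum>b\<in>cube K. norm (defect n w f (hcell r x p \<inter> B b))) + norm (defect n w f (hcell r x p - U))"
      by (simp add: norm_triangle_le norm_sum add_right_mono order_trans[OF norm_triangle_ineq])
  qed
  also have "\<dots> = (\<Sum>b\<in>cube K. \<Sum>p\<in>P. norm (defect n w f (hcell r x p \<inter> B b))) + (\<Sum>p\<in>P. norm (defect n w f (hcell r x p \<inter> - U)))"
    by (simp add: sum.distrib sum.swap[of _ P] Diff_eq)
  also have "\<dots> \<le> (\<Sum>b\<in>cube K. ?d * \<beta> * \<tau> + (if b \<in> bad then C * \<tau> else 0)) + variation n w M (- U)"
    using U by (intro add_mono sum_mono tile_le sum_norm_defect_le_variation[OF r finP M f]) auto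
  also have "(\<Sum>b\<in>cube K. ?d * \<beta> * \<tau> + (if b \<in> bad then C * \<tau> else 0)) = ?d * \<beta> * (real_of_int K ^ ?d * \<tau>) + card bad * (C * \<tau>)"
  proof -
    have "(\<Sum>b\<in>cube K. if b \<in> bad then C * \<tau> else 0) = card bad * (C * \<tau>)"
    proof -
      have "cube K \<inter> bad = bad" by (auto simp: bad_def)
      then show ?thesis using finK by (simp add: sum.If_cases)
    qed
    then show ?thesis by (simp add: sum.distrib cardK)
  qed
  also have "?d * \<beta> * (real_of_int K ^ ?d * \<tau>) \<le> ?d * \<beta>"
    using K\<tau>1 \<open>\<beta> \<ge> 0\<close> by (intro mult_right_le_one_le K\<tau>0) auto
  also have "card bad * (C * \<tau>) \<le> C * (?d * (1 / r + 1) / K)"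
  proof -
    have "real (card bad) \<le> ?d * (1 / r + 1) * real_of_int K ^ (?d - 1)"
      unfolding bad_def B_def by (rule card_straddling_tiles[OF n T K r fit])
    then have "card bad * (C * \<tau>) \<le> ?d * (1 / r + 1) * real_of_int K ^ (?d - 1) * (C * \<tau>)"
      using C0 \<tau>0 by (intro mult_right_mono) auto
    also have "\<dots> = C * (?d * (1 / r + 1) / K) * (real_of_int K ^ ?d * \<tau>)"
    proof -
      have "real_of_int K ^ ?d = real_of_int K ^ (?d - 1) * K"
        by (metis One_nat_def Suc_pred mult.commute power_Suc zero_less_card_finite)
      then show ?thesis using K by simp
    qed
    also have "\<dots> \<le> C * (?d * (1 / r + 1) / K)"
      using K\<tau>1 C0 r K by (intro mult_right_le_one_le K\<tau>0) auto
    finally show ?thesis .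
  qed
  also have "variation n w M (- U) = variation n w M unit_cube - C * (real_of_int K ^ ?d * \<tau>)"
  proof -
    have Us: "U \<subseteq> unit_cube" using B_sub by (auto simp: U_def)
    have "variation n w M (- U) = variation n w M (unit_cube - U)"
      using variation_Int_unit_cube[of n w M "- U"] by (simp add: Diff_eq Int_commute)
    moreover have "variation n w M (U \<union> (unit_cube - U)) = variation n w M U + variation n w M (unit_cube - U)"
      using U by (intro borel_additiveD[OF borel_additive_variation]) (auto simp: unit_cube_eq_hbox)
    moreover have "U \<union> (unit_cube - U) = unit_cube" using Us by blast
    moreover have "variation n w M U = C * (real_of_int K ^ ?d * \<tau>)"
      unfolding U_def using borel_additive_UN[OF borel_additive_variation finK B_disj B_borel, of n w M]
      by (simp add: varB cardK)
    ultimately show ?thesis by simp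
  qed
  also have "variation n w M unit_cube \<le> C * (1 + 1 / real n) ^ ?d"
  proof -
    have "norm w * 1 \<le> norm w * (1 + 1 / real n) ^ ?d" by (intro mult_left_mono one_le_power) auto
    then show ?thesis using variation_unit_cube_le[OF n M, of w] by (simp add: C_def algebra_simps)
  qed
  finally show ?thesis unfolding P_def K\<tau> C_def[symmetric] by (simp add: algebra_simps)
qed

text \<open>Levels below \<open>k0\<close> have 1/r at most \<open>2 ^ k0\<close> and are covered by
  \<open>grid_defect_le\<close>. From \<open>k0\<close> on, the variation of the whole cube is at
  most \<open>C * 2 ^ CARD('d)\<close>, and the weights of these levels sum to at most 2 /
  2^k0.\<close>

lemma vdist_le_from_tiles:
  fixes w :: "real ^ 'd::finite" and s T K :: int and M \<beta> C \<epsilon> :: real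
  assumes n: "n \<ge> 1" and T: "T \<ge> 1" and K: "K \<ge> 1"
    and fit: "- int n \<le> 2 * s" "2 * (s + T * K) \<le> int n"
    and M: "M \<ge> 0" and f: "\<And>e. \<bar>f e\<bar> \<le> M" and \<beta>: "\<beta> \<ge> 0"
    and avg: "\<And>b i. b \<in> cube K \<Longrightarrow>
      \<bar>(\<Sum>p\<in>ibox (\<lambda>j. s + T * b j) (\<lambda>j. s + T * b j + T). f (p, i)) - w $ i * real_of_int T ^ CARD('d)\<bar> \<le> \<beta> * real_of_int T ^ CARD('d)"
    and C: "C = CARD('d) * M + norm w"
    and \<epsilon>: "2 * (CARD('d) * \<beta> + C * (CARD('d) * (2 ^ k0 + 1 :: real) / K + (1 + 1 / real n) ^ CARD('d) - (real_of_int (K * T) / n) ^ CARD('d)))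
       + 2 * (C * 2 ^ CARD('d)) / 2 ^ k0 \<le> \<epsilon>"
  shows "vdist (flow_measure n f) (target w) \<le> ennreal \<epsilon>"
proof -
  let ?d = "CARD('d)"
  define X where "X = ?d * \<beta> + C * (?d * (2 ^ k0 + 1 :: real) / K + (1 + 1 / real n) ^ ?d - (real_of_int (K * T) / n) ^ ?d)"
  define Y where "Y = C * 2 ^ ?d"
  have C0: "C \<ge> 0" using M by (simp add: C)
  have Y0: "Y \<ge> 0" using C0 by (simp add: Y_def)
  have X0: "X \<ge> 0"
  proof -
    have "K * T \<le> int n" using fit by (simp add: mult.commute)
    then have "real_of_int (K * T) \<le> real n" by linarith
    then have "real_of_int (K * T) / n \<le> 1" using n by (simp add: field_simps)
    then have "(real_of_int (K * T) / n) ^ ?d \<le> 1" using K T n by (intro power_le_one) auto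
    moreover have "1 \<le> (1 + 1 / real n) ^ ?d" by (intro one_le_power) auto
    moreover have "0 \<le> ?d * (2 ^ k0 + 1 :: real) / K" using K by simp
    ultimately have "0 \<le> ?d * (2 ^ k0 + 1 :: real) / K + (1 + 1 / real n) ^ ?d - (real_of_int (K * T) / n) ^ ?d"
      by linarith
    then show ?thesis unfolding X_def using C0 \<beta> by (intro add_nonneg_nonneg mult_nonneg_nonneg) auto
  qed
  have \<epsilon>': "2 * X + 2 * Y / 2 ^ k0 \<le> \<epsilon>" using \<epsilon> by (simp add: X_def Y_def)
  have \<epsilon>0: "\<epsilon> \<ge> 0" using \<epsilon>' X0 Y0 by (smt (verit) divide_nonneg_nonneg zero_le_power)
  show ?thesis
    unfolding vdist_flow_le_real[OF \<epsilon>0]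
  proof (intro ballI allI)
    fix x :: "real ^ 'd" and l :: real and m :: nat
    assume l: "l \<in> {1..2}"
    define S where "S k = (\<Sum>p\<in>meeting (l / 2 ^ k) x. norm (target w (hcell (l / 2 ^ k) x p) - flow_measure n f (hcell (l / 2 ^ k) x p)))" for k :: nat
    have r: "l / 2 ^ k > 0" for k :: nat using l by simp
    have S1: "S k \<le> X" if "k < k0" for k
    proof -
      have "S k \<le> ?d * \<beta> + C * (?d * (1 / (l / 2 ^ k) + 1) / K + (1 + 1 / real n) ^ ?d - (real_of_int (K * T) / n) ^ ?d)"
        unfolding S_def C defect_def[symmetric] by (rule grid_defect_le[OF n T K r fit M f \<beta> avg])
      moreover have "1 / (l / 2 ^ k) \<le> 2 ^ k0"
      proof -
        have "1 / (l / 2 ^ k) = 2 ^ k / l" by simp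
        also have "\<dots> \<le> 2 ^ k / 1" using l by (intro divide_left_mono) auto
        also have "\<dots> \<le> 2 ^ k0" using that by (simp add: power_increasing)
        finally show ?thesis .
      qed
      then have "?d * (1 / (l / 2 ^ k) + 1) / K \<le> ?d * (2 ^ k0 + 1 :: real) / K"
        using K by (intro divide_right_mono mult_left_mono) auto
      then have "C * (?d * (1 / (l / 2 ^ k) + 1) / K + (1 + 1 / real n) ^ ?d - (real_of_int (K * T) / n) ^ ?d)
         \<le> C * (?d * (2 ^ k0 + 1 :: real) / K + (1 + 1 / real n) ^ ?d - (real_of_int (K * T) / n) ^ ?d)"
        using C0 by (intro mult_left_mono) auto
      ultimately show ?thesis unfolding X_def by linarith
    qed
    have S2: "S k \<le> Y" for k
    proof -
      have "S k = (\<Sum>p\<in>meeting (l / 2 ^ k) x. norm (defect n w f (hcell (l / 2 ^ k) x p \<inter> UNIV)))"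
        by (simp add: S_def defect_def)
      also have "\<dots> \<le> variation n w M UNIV"
        by (rule sum_norm_defect_le_variation[OF r finite_meeting[OF r] M f]) simp
      also have "\<dots> = variation n w M unit_cube" using variation_Int_unit_cube[of n w M UNIV] by simp
      also have "\<dots> \<le> ?d * M * (1 + 1 / real n) ^ ?d + norm w" by (rule variation_unit_cube_le[OF n M])
      also have "\<dots> \<le> ?d * M * 2 ^ ?d + norm w * 2 ^ ?d"
      proof (intro add_mono mult_left_mono power_mono)
        show "1 + 1 / real n \<le> 2" using n by (simp add: field_simps)
        have "norm w * 1 \<le> norm w * 2 ^ ?d" by (intro mult_left_mono one_le_power) auto
        then show "norm w \<le> norm w * 2 ^ ?d" by simp
      qed (use M in auto)
      finally show ?thesis by (simp add: Y_def C algebra_simps)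
    qed
    have S0: "S k \<ge> 0" for k by (simp add: S_def sum_nonneg)
    have geom: "(\<Sum>k<j. 1 / 2 ^ k) \<le> (2 :: real)" for j
      using sum_le_suminf[of "\<lambda>k. (1 / 2 :: real) ^ k" "{..<j}"] suminf_geometric[of "1 / 2 :: real"]
        summable_geometric[of "1 / 2 :: real"]
      by (simp add: power_one_over)
    \<comment> \<open>Going up to \<open>k0 + m\<close> allows a split at \<open>k0\<close> for
      every \<open>m\<close>.\<close>
    have "(\<Sum>k<m. 1 / 2 ^ k * S k) \<le> (\<Sum>k<k0 + m. 1 / 2 ^ k * S k)"
      by (rule sum_mono2) (auto intro!: divide_nonneg_nonneg S0)
    also have "\<dots> = (\<Sum>k<k0. 1 / 2 ^ k * S k) + (\<Sum>k<m. 1 / 2 ^ (k0 + k) * S (k0 + k))"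
      by (induction m) simp_all
    also have "(\<Sum>k<k0. 1 / 2 ^ k * S k) \<le> (\<Sum>k<k0. 1 / 2 ^ k * X)"
      by (intro sum_mono mult_left_mono S1) auto
    also have "(\<Sum>k<k0. 1 / 2 ^ k * X) \<le> 2 * X"
      unfolding sum_distrib_right[symmetric] by (intro mult_right_mono geom X0)
    also have "(\<Sum>k<m. 1 / 2 ^ (k0 + k) * S (k0 + k)) \<le> (\<Sum>k<m. 1 / 2 ^ k * (Y / 2 ^ k0))"
    proof (rule sum_mono)
      fix k
      have "1 / 2 ^ (k0 + k) * S (k0 + k) \<le> 1 / 2 ^ (k0 + k) * Y" by (intro mult_left_mono S2) simp
      then show "1 / 2 ^ (k0 + k) * S (k0 + k) \<le> 1 / 2 ^ k * (Y / 2 ^ k0)" by (simp add: power_add mult.commute)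
    qed
    also have "(\<Sum>k<m. 1 / 2 ^ k * (Y / 2 ^ k0)) \<le> 2 * (Y / 2 ^ k0)"
      unfolding sum_distrib_right[symmetric] using Y0 by (intro mult_right_mono geom) auto
    finally have "(\<Sum>k<m. 1 / 2 ^ k * S k) \<le> \<epsilon>" using \<epsilon>' by simp
    then show "(\<Sum>k<m. 1 / 2 ^ k * (\<Sum>p\<in>meeting (l / 2 ^ k) x. norm (target w (hcell (l / 2 ^ k) x p) - flow_measure n f (hcell (l / 2 ^ k) x p)))) \<le> \<epsilon>"
      by (simp add: S_def)
  qed
qed

section \<open>The comparison of two scales\<close>

lemma core_event_mono:
  assumes "core_event u N D M \<gamma> c" "\<gamma> \<le> \<gamma>'" "D \<ge> 1"
  shows "core_event u N D M \<gamma>' c"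
proof -
  have "\<gamma> * real_of_int D ^ CARD('a) \<le> \<gamma>' * real_of_int D ^ CARD('a)"
    using assms(2,3) by (intro mult_right_mono) auto
  then have le: "x \<le> \<gamma> * real_of_int D ^ CARD('a) \<Longrightarrow> x \<le> \<gamma>' * real_of_int D ^ CARD('a)" for x
    by linarith
  obtain f where "(\<forall>e\<in>core_edges (D * N). \<bar>f e\<bar> \<le> c e \<and> \<bar>f e\<bar> \<le> M) \<and> (\<forall>p\<in>cube (D * N). flow_div f p = 0) \<and>
     (\<forall>z\<in>cube N. \<forall>i. \<bar>(\<Sum>q\<in>subcube D z. f (q, i)) - u i * real_of_int D ^ CARD('a)\<bar> \<le> \<gamma> * real_of_int D ^ CARD('a))"
    using assms(1) unfolding core_event_def by (elim exE)
  then show ?thesis unfolding core_event_def by (intro exI[of _ f]) (simp add: le)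
qed

lemma core_edges_in_tile:
  assumes "l \<ge> 1" "(p, i) \<in> core_edges w"
  shows "p \<in> tile w l"
proof -
  have "- l \<le> p j \<and> p j < w + l" for j
    using assms by (cases "j = i") (auto simp: core_edges_def intro: order_trans[of "- l" 0])
  then show ?thesis by (simp add: tile_def ibox_def)
qed

definition core_block :: "int \<Rightarrow> int \<Rightarrow> int \<Rightarrow> int \<Rightarrow> ('d \<Rightarrow> int) \<Rightarrow> (('d \<Rightarrow> int) \<times> 'd) set" where
  "core_block s T l w b = core_shift s T l b ` core_edges w"

text \<open>All constrained edges outside the cores: the shells, and also the margin of the unit
  cube that the tiles leave free. Their capacities are the ones to be forced.\<close>

definition open_edges :: "nat \<Rightarrow> int \<Rightarrow> int \<Rightarrow> int \<Rightarrow> int \<Rightarrow> int \<Rightarrow> (('d \<Rightarrow> int) \<times> 'd) set" where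
  "open_edges n s T l w K = base n \<times> UNIV - (\<Union>b\<in>cube K. core_block s T l w b)"

lemma core_block_tile_index:
  assumes T: "T = w + 2 * l" "T \<ge> 1" and l: "l \<ge> 1" and e: "(p, i) \<in> core_block s T l w b"
  shows "tile_index s T p = b"
proof -
  obtain q where q: "(q, i) \<in> core_edges w" "p = (\<lambda>j. q j + (tile_corner s T b j + l))"
    using e by (auto simp: core_block_def core_shift_def shift_def)
  then show ?thesis using tile_index_core_shift[OF T] core_edges_in_tile[OF l q(1)] by blast
qed

lemma core_block_disjoint:
  assumes T: "T = w + 2 * l" "T \<ge> 1" and l: "l \<ge> 1" and ne: "b \<noteq> b'"
  shows "core_block s T l w b \<inter> core_block s T l w b' = {}"
proof (rule ccontr)
  assume "core_block s T l w b \<inter> core_block s T l w b' \<noteq> {}"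
  then obtain p i where "(p, i) \<in> core_block s T l w b" "(p, i) \<in> core_block s T l w b'" by auto
  from this[THEN core_block_tile_index[OF T l]] ne show False by simp
qed

text \<open>The deterministic half of the comparison. Core edges respect their own capacities
  because the extension keeps them below the original core flow; every other constrained edge
  carries at most \<open>H\<close>, which its capacity exceeds or equals.\<close>

lemma tiles_near_flow:
  fixes w :: "real ^ 'd::finite" and D m k b a W l T s K :: int and M \<gamma> \<eta> \<kappa> \<beta> H \<epsilon> C :: real
  assumes d: "CARD('d) \<ge> 2" and D: "D \<ge> 1" and m: "m \<ge> 1" and k: "k \<ge> 1" and b: "b \<ge> 1"
    and a: "a = D * m" and W: "W = k * a" and l: "l = b * a" and T: "T = W + 2 * l"
    and \<eta>: "0 \<le> \<eta>" "\<eta> \<le> 1" and M: "M \<ge> 0" and \<gamma>: "\<gamma> \<ge> 0" and w: "\<And>i. \<bar>w $ i\<bar> \<le> M"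
    and kappa: "\<kappa> = (real_of_int T / l) ^ CARD('d)"
    and H: "(1 - \<eta>) * M + CARD('d) * (4 * M / b)
        + 4 * CARD('d) * (\<gamma> + 2 * CARD('d) * M / m) * (1 + \<kappa>)\<^sup>2 * (real_of_int T / l) \<le> H" "H \<le> M"
    and n: "n \<ge> 1" and K: "K \<ge> 1" and fit: "- int n \<le> 2 * s" "2 * (s + T * K) \<le> int n"
    and \<beta>: "\<gamma> + \<eta> * M + 2 * M * (1 - (real_of_int W / T) ^ CARD('d)) \<le> \<beta>"
    and C: "C = CARD('d) * M + norm w"
    and \<epsilon>: "2 * (CARD('d) * \<beta> + C * (CARD('d) * (2 ^ k0 + 1 :: real) / K + (1 + 1 / real n) ^ CARD('d) - (real_of_int (K * T) / n) ^ CARD('d)))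
       + 2 * (C * 2 ^ CARD('d)) / 2 ^ k0 \<le> \<epsilon>"
    and core: "\<And>b. b \<in> cube K \<Longrightarrow> core_event (($) w) (k * m) D M \<gamma> (\<lambda>e. c (core_shift s T l b e))"
    and high: "\<And>e. e \<in> open_edges n s T l W K \<Longrightarrow> H \<le> c e"
  shows "near_flow n w \<epsilon> c"
proof -
  let ?d = "CARD('d)"
  have a1: "a \<ge> 1" using mult_mono[of 1 D 1 m] D m by (simp add: a)
  have W1: "W \<ge> 1" and l1: "l \<ge> 1"
    using mult_mono[of 1 k 1 a] mult_mono[of 1 b 1 a] k b a1 by (simp_all add: W l)
  have T1: "T \<ge> 1" using W1 l1 by (simp add: T)
  have WT: "W \<le> T" using l1 by (simp add: T)
  let ?bd = "(1 - \<eta>) * M + ?d * (4 * M / b) + 4 * ?d * (\<gamma> + 2 * ?d * M / m) * (1 + \<kappa>)\<^sup>2 * (real_of_int T / l)"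
  define good where "good t h \<longleftrightarrow> (\<forall>e\<in>core_edges W. \<bar>h e\<bar> \<le> c (core_shift s T l t e)) \<and> (\<forall>e\<in>core_edges W. \<bar>h e\<bar> \<le> M) \<and>
      (\<forall>p i. p \<notin> tile W l \<or> p i + 1 \<ge> W + l \<longrightarrow> h (p, i) = (1 - \<eta>) * w $ i) \<and>
      (\<forall>p. flow_div h p = 0) \<and> (\<forall>e. e \<notin> core_edges W \<longrightarrow> \<bar>h e\<bar> \<le> ?bd) \<and>
      (\<forall>i. \<bar>(\<Sum>p\<in>cube W. h (p, i)) - w $ i * real_of_int W ^ ?d\<bar> \<le> (\<gamma> + \<eta> * M) * real_of_int W ^ ?d)" for t h
  have ex: "\<exists>h. good t h" if t: "t \<in> cube K" for t
    by (rule core_to_tile[OF d D m k b a W l core[OF t] \<eta> M \<gamma> w kappa[unfolded T]])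
       (unfold good_def T, blast)
  have good: "good t (SOME h. good t h)" if "t \<in> cube K" for t
    by (rule someI_ex[OF ex[OF that]])
  define hb where "hb t = (SOME h. good t h)" for t
  note good = good[folded hb_def, unfolded good_def]
  have hb:
    "\<And>t e. t \<in> cube K \<Longrightarrow> e \<in> core_edges W \<Longrightarrow> \<bar>hb t e\<bar> \<le> c (core_shift s T l t e)"
    "\<And>t e. t \<in> cube K \<Longrightarrow> e \<in> core_edges W \<Longrightarrow> \<bar>hb t e\<bar> \<le> M"
    "\<And>t p i. t \<in> cube K \<Longrightarrow> p \<notin> tile W l \<or> p i + 1 \<ge> W + l \<Longrightarrow> hb t (p, i) = (1 - \<eta>) * w $ i"
    "\<And>t p. t \<in> cube K \<Longrightarrow> flow_div (hb t) p = 0"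
    "\<And>t e. t \<in> cube K \<Longrightarrow> e \<notin> core_edges W \<Longrightarrow> \<bar>hb t e\<bar> \<le> ?bd"
    "\<And>t i. t \<in> cube K \<Longrightarrow> \<bar>(\<Sum>p\<in>cube W. hb t (p, i)) - w $ i * real_of_int W ^ ?d\<bar> \<le> (\<gamma> + \<eta> * M) * real_of_int W ^ ?d"
    using good by blast+
  have hb_out: "\<bar>hb t e\<bar> \<le> H" if "t \<in> cube K" "e \<notin> core_edges W" for t e
    using hb(5)[OF that] H(1) by linarith
  have hb_M: "\<bar>hb t e\<bar> \<le> M" if "t \<in> cube K" for t e
    using hb(2)[OF that, of e] hb_out[OF that, of e] H(2) by (cases "e \<in> core_edges W") auto
  obtain h where h: "\<And>p. flow_div h p = 0"
    "\<And>t p i. t \<in> cube K \<Longrightarrow> p \<in> tile W l \<Longrightarrow> h (core_shift s T l t (p, i)) = hb t (p, i)"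
    "\<And>p i. tile_index s T p \<notin> cube K \<Longrightarrow> h (p, i) = (1 - \<eta>) * w $ i"
    by (rule glue_tiles[where hb=hb and I="cube K" and u="\<lambda>i. (1 - \<eta>) * w $ i" and s=s, OF T T1 hb(3,4)])
       (assumption | rule that)+
  have u_H: "\<bar>(1 - \<eta>) * w $ i\<bar> \<le> H" for i
  proof -
    have "\<bar>(1 - \<eta>) * w $ i\<bar> \<le> (1 - \<eta>) * M" using w[of i] \<eta> by (simp add: abs_mult mult_left_mono)
    also have "\<dots> \<le> ?bd" using M \<gamma> b m l1 T1 by simp
    finally show ?thesis using H(1) by linarith
  qed
  have split: "\<exists>q. q \<in> tile W l \<and> (\<forall>i. (p, i) = core_shift s T l t (q, i))" if "tile_index s T p = t" for p and t :: "'d \<Rightarrow> int"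
  proof -
    let ?q = "\<lambda>j. p j - (tile_corner s T t j + l)"
    have "?q \<in> tile W l" using tile_index_core_shift[OF T T1, of s ?q t] that by simp
    then show ?thesis by (intro exI[of _ ?q]) (simp add: core_shift_def shift_def)
  qed
  have h_M: "\<bar>h e\<bar> \<le> M" for e
  proof -
    obtain p i where e: "e = (p, i)" by force
    show ?thesis
    proof (cases "tile_index s T p \<in> cube K")
      case True
      from split[OF refl] obtain q where q: "q \<in> tile W l" "\<And>i. (p, i) = core_shift s T l (tile_index s T p) (q, i)" by blast
      show ?thesis unfolding e q(2)[of i] h(2)[OF True q(1)] by (rule hb_M[OF True])
    next
      case False
      then show ?thesis using h(3)[OF False, of i] u_H[of i] H(2) by (simp add: e)
    qed
  qed
  have adm: "admissible_flow n c h"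
    unfolding admissible_flow_def
  proof (intro conjI ballI allI impI h(1))
    fix p :: "'d \<Rightarrow> int" and i assume p: "p \<in> base n"
    show "\<bar>h (p, i)\<bar> \<le> c (p, i)"
    proof (cases "tile_index s T p \<in> cube K")
      case True
      let ?t = "tile_index s T p"
      from split[OF refl] obtain q where q: "q \<in> tile W l" "\<And>i. (p, i) = core_shift s T l ?t (q, i)" by blast
      have hq: "h (p, i) = hb ?t (q, i)" unfolding q(2)[of i] by (rule h(2)[OF True q(1)])
      show ?thesis
      proof (cases "(q, i) \<in> core_edges W")
        case core: True
        then show ?thesis using hb(1)[OF True core] by (simp only: hq q(2)[of i, symmetric])
      next
        case False
        \<comment> \<open>A core edge belongs to the tile of its starting point, so only the core of
          the tile of \<open>p\<close> has to be excluded.\<close>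
        have "(p, i) \<notin> core_block s T l W t'" for t'
        proof
          assume *: "(p, i) \<in> core_block s T l W t'"
          then have "?t = t'" by (rule core_block_tile_index[OF T T1 l1])
          moreover have "core_shift s T l ?t (q, i) \<in> core_shift s T l t' ` core_edges W"
            using * unfolding core_block_def q(2)[of i, symmetric] .
          ultimately have "core_shift s T l ?t (q, i) \<in> core_shift s T l ?t ` core_edges W"
            by (simp only:)
          then have "(q, i) \<in> core_edges W" by (simp add: core_shift_def inj_image_mem_iff[OF inj_shift])
          with False show False by simp
        qed
        then have "(p, i) \<in> open_edges n s T l W K" using p by (simp add: open_edges_def)
        then have "H \<le> c (p, i)" by (rule high)
        then show ?thesis using hb_out[OF True False] by (simp add: hq)
      qed
    next
      case False
      then have "(p, i) \<notin> core_block s T l W t'" if "t' \<in> cube K" for t'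
        using core_block_tile_index[OF T T1 l1, of p i s t'] that by auto
      then have "(p, i) \<in> open_edges n s T l W K" using p by (simp add: open_edges_def)
      then have "H \<le> c (p, i)" by (rule high)
      then show ?thesis using u_H[of i] h(3)[OF False, of i] by simp
    qed
  qed
  have card_tile: "real (card (tile W l :: ('d \<Rightarrow> int) set)) = real_of_int T ^ ?d"
    using W1 l1 by (simp add: tile_def card_ibox T algebra_simps)
  have card_cube: "real (card (cube W :: ('d \<Rightarrow> int) set)) = real_of_int W ^ ?d"
    using W1 by (simp add: cube_def card_ibox)
  have cube_sub: "cube W \<subseteq> (tile W l :: ('d \<Rightarrow> int) set)"
    unfolding cube_def tile_def using l1 by (intro ibox_mono) auto
  have avg: "\<bar>(\<Sum>p\<in>ibox (\<lambda>j. s + T * t j) (\<lambda>j. s + T * t j + T). h (p, i)) - w $ i * real_of_int T ^ ?d\<bar> \<le> \<beta> * real_of_int T ^ ?d"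
    if t: "t \<in> cube K" for t i
  proof -
    let ?S = "\<Sum>q\<in>tile W l. hb t (q, i)" and ?Tc = "tile W l - cube W :: ('d \<Rightarrow> int) set"
    have "?S = (\<Sum>q\<in>tile W l. h (core_shift s T l t (q, i)))" by (intro sum.cong refl h(2)[OF t, symmetric])
    also have "\<dots> = (\<Sum>p\<in>ibox (\<lambda>j. s + T * t j) (\<lambda>j. s + T * t j + T). h (p, i))"
    proof -
      have "(\<lambda>j. - l + (tile_corner s T t j + l)) = (\<lambda>j. s + T * t j)"
        "(\<lambda>j. W + l + (tile_corner s T t j + l)) = (\<lambda>j. s + T * t j + T)"
        by (auto simp: tile_corner_def T)
      then show ?thesis
        using sum_ibox_shift[of "\<lambda>p. h (p, i)" "\<lambda>j. tile_corner s T t j + l" "\<lambda>_. - l" "\<lambda>_. W + l"]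
        by (simp add: core_shift_def shift_def tile_def)
    qed
    finally have S: "(\<Sum>p\<in>ibox (\<lambda>j. s + T * t j) (\<lambda>j. s + T * t j + T). h (p, i)) = ?S" ..
    have split_S: "?S = (\<Sum>q\<in>cube W. hb t (q, i)) + (\<Sum>q\<in>?Tc. hb t (q, i))"
      by (subst sum.subset_diff[OF cube_sub]) (simp_all add: tile_def add.commute)
    have card_Tc: "real (card ?Tc) = real_of_int T ^ ?d - real_of_int W ^ ?d"
      using cube_sub by (simp add: card_Diff_subset cube_def card_mono of_nat_diff tile_def flip: card_tile card_cube)
    have "\<bar>(\<Sum>q\<in>?Tc. hb t (q, i)) - w $ i * card ?Tc\<bar> = \<bar>\<Sum>q\<in>?Tc. hb t (q, i) - w $ i\<bar>"
      by (simp add: sum_subtractf mult.commute)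
    \<comment> \<open>In the shell only this trivial bound is used; it enters with the volume
      fraction 1 - (W/T)^d.\<close>
    also have "\<dots> \<le> (\<Sum>q\<in>?Tc. 2 * M)"
    proof (rule order_trans[OF sum_abs], rule sum_mono)
      fix q show "\<bar>hb t (q, i) - w $ i\<bar> \<le> 2 * M" using hb_M[OF t, of "(q, i)"] w[of i] by linarith
    qed
    finally have rest: "\<bar>(\<Sum>q\<in>?Tc. hb t (q, i)) - w $ i * card ?Tc\<bar> \<le> card ?Tc * (2 * M)" by simp
    have "?S - w $ i * real_of_int T ^ ?d =
      ((\<Sum>q\<in>cube W. hb t (q, i)) - w $ i * real_of_int W ^ ?d) + ((\<Sum>q\<in>?Tc. hb t (q, i)) - w $ i * card ?Tc)"
      unfolding split_S card_Tc by (simp add: algebra_simps)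
    then have "\<bar>?S - w $ i * real_of_int T ^ ?d\<bar> \<le> (\<gamma> + \<eta> * M) * real_of_int W ^ ?d + card ?Tc * (2 * M)"
      using hb(6)[OF t, of i] rest by linarith
    also have "\<dots> \<le> (\<gamma> + \<eta> * M) * real_of_int T ^ ?d + card ?Tc * (2 * M)"
      using \<gamma> \<eta> M W1 WT by (intro add_mono mult_left_mono power_mono) auto
    also have "\<dots> = (\<gamma> + \<eta> * M + 2 * M * (1 - (real_of_int W / T) ^ ?d)) * real_of_int T ^ ?d"
      unfolding card_Tc using T1 by (simp add: power_divide field_simps)
    also have "\<dots> \<le> \<beta> * real_of_int T ^ ?d" using \<beta> T1 by (intro mult_right_mono) auto
    finally show ?thesis by (simp add: S)
  qed
  have "\<beta> \<ge> 0"
  proof -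
    have "(real_of_int W / T) ^ ?d \<le> 1" using W1 WT T1 by (intro power_le_one) auto
    then have "0 \<le> \<gamma> + \<eta> * M + 2 * M * (1 - (real_of_int W / T) ^ ?d)" using \<gamma> \<eta> M by simp
    then show ?thesis using \<beta> by linarith
  qed
  have "vdist (flow_measure n h) (target w) \<le> ennreal \<epsilon>"
    by (rule vdist_le_from_tiles[OF n T1 K fit M h_M \<open>\<beta> \<ge> 0\<close> avg C \<epsilon>])
  with adm show ?thesis by (auto simp: near_flow_def)
qed

text \<open>It is enough to remove, from the edges that start in \<open>base n\<close>, those that
  start inside a core: \<open>CARD('d) * W ^ CARD('d)\<close> for each of the
  \<open>K ^ CARD('d)\<close> tiles.\<close>

lemma card_open_edges_le:
  fixes W l T K s :: int
  assumes T: "T = W + 2 * l" and W1: "W \<ge> 1" and l1: "l \<ge> 1" and K: "K \<ge> 1"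
    and s: "s = - (int n div 2)" and fit: "T * K \<le> int n"
  shows "finite (open_edges n s T l W K :: (('d::finite \<Rightarrow> int) \<times> 'd) set)"
    and "real (card (open_edges n s T l W K :: (('d \<Rightarrow> int) \<times> 'd) set))
      \<le> CARD('d) * (real n ^ CARD('d) - real_of_int (K * W) ^ CARD('d))"
proof -
  let ?d = "CARD('d)"
  have T1: "T \<ge> 1" using W1 l1 by (simp add: T)
  have finb: "finite (base n :: ('d \<Rightarrow> int) set)" by (simp add: base_def)
  then show "finite (open_edges n s T l W K :: (('d \<Rightarrow> int) \<times> 'd) set)" by (simp add: open_edges_def)
  define Z where "Z b = core_shift s T l b ` (cube W \<times> (UNIV :: 'd set))" for b :: "'d \<Rightarrow> int"
  have Z_block: "Z b \<subseteq> core_block s T l W b" for b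
    unfolding Z_def core_block_def by (intro image_mono) (auto intro: cube_core_edges(1))
  have Z_base: "Z b \<subseteq> base n \<times> UNIV" if b: "b \<in> cube K" for b
  proof
    fix e assume "e \<in> Z b"
    then obtain q i where q: "q \<in> cube W" "e = (\<lambda>j. q j + (tile_corner s T b j + l), i)"
      by (auto simp: Z_def core_shift_def shift_def)
    have "- (int n div 2) \<le> q j + (tile_corner s T b j + l) \<and> q j + (tile_corner s T b j + l) < - (int n div 2) + int n" for j
    proof -
      have bj: "0 \<le> b j" "b j + 1 \<le> K" using cubeD[OF b, of j] by simp_all
      have "0 \<le> T * b j" "T * (b j + 1) \<le> T * K" using bj T1 by (auto intro: mult_left_mono)
      moreover have "0 \<le> q j" "q j < W" using cubeD[OF q(1), of j] by simp_all
      ultimately show ?thesis using fit l1 by (simp add: tile_corner_def s T algebra_simps)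
    qed
    then show "e \<in> base n \<times> UNIV" by (simp add: q(2) base_def ibox_def)
  qed
  have disj: "Z b \<inter> Z b' = {}" if "b \<noteq> b'" for b b'
    using core_block_disjoint[OF T T1 l1 that, of s] Z_block[of b] Z_block[of b'] by blast
  have finZ: "finite (Z b)" for b by (simp add: Z_def cube_def)
  have cardZ: "card (Z b) = nat W ^ ?d * ?d" for b
  proof -
    have "card (Z b) = card ((cube W :: ('d \<Rightarrow> int) set) \<times> (UNIV :: 'd set))"
      unfolding Z_def core_shift_def by (rule card_image) (rule inj_on_subset[OF inj_shift subset_UNIV])
    then show ?thesis by (simp add: card_cartesian_product cube_def card_ibox)
  qed
  have finK: "finite (cube K :: ('d \<Rightarrow> int) set)" by (simp add: cube_def)
  have cardU: "card (\<Union>b\<in>cube K. Z b) = nat K ^ ?d * (nat W ^ ?d * ?d)"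
    using disj finZ finK by (subst card_UN_disjoint) (auto simp: cardZ cube_def card_ibox)
  have "open_edges n s T l W K \<subseteq> base n \<times> UNIV - (\<Union>b\<in>cube K. Z b)"
    using Z_block by (auto simp: open_edges_def)
  then have "card (open_edges n s T l W K :: (('d \<Rightarrow> int) \<times> 'd) set) \<le> card (base n \<times> UNIV - (\<Union>b\<in>cube K. Z b) :: (('d \<Rightarrow> int) \<times> 'd) set)"
    using finb by (intro card_mono) auto
  also have "\<dots> = card (base n \<times> (UNIV :: 'd set) :: (('d \<Rightarrow> int) \<times> 'd) set) - card (\<Union>b\<in>cube K. Z b)"
    using Z_base finK finZ by (intro card_Diff_subset) auto
  finally have "card (open_edges n s T l W K :: (('d \<Rightarrow> int) \<times> 'd) set) \<le> n ^ ?d * ?d - nat K ^ ?d * (nat W ^ ?d * ?d)"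
    unfolding cardU by (simp add: card_cartesian_product base_def card_ibox)
  moreover have "nat K ^ ?d * (nat W ^ ?d * ?d) \<le> n ^ ?d * ?d"
  proof -
    have "K * W \<le> K * T" using K l1 by (intro mult_left_mono) (auto simp: T)
    then have "K * W \<le> int n" using fit by (simp add: mult.commute)
    then have "nat (K * W) \<le> n" by linarith
    then have "nat K * nat W \<le> n" using K by (simp add: nat_mult_distrib)
    then have "(nat K * nat W) ^ ?d \<le> n ^ ?d" by (rule power_mono) simp
    then show ?thesis by (simp add: power_mult_distrib mult.assoc[symmetric])
  qed
  ultimately have "real (card (open_edges n s T l W K :: (('d \<Rightarrow> int) \<times> 'd) set)) \<le> real (n ^ ?d * ?d) - real (nat K ^ ?d * (nat W ^ ?d * ?d))"
    by linarith
  also have "\<dots> = ?d * (real n ^ ?d - real_of_int (K * W) ^ ?d)"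
    using K W1 by (simp add: power_mult_distrib algebra_simps)
  finally show "real (card (open_edges n s T l W K :: (('d \<Rightarrow> int) \<times> 'd) set)) \<le> ?d * (real n ^ ?d - real_of_int (K * W) ^ ?d)" .
qed

text \<open>The cores and the single remaining edges occupy pairwise disjoint sets of edges, so the
  probabilities multiply; translation invariance makes all core factors equal.\<close>

lemma tiles_probability:
  fixes w :: "real ^ 'd::finite" and G :: "real measure" and W l T s K D N :: int
  assumes G: "prob_space G" and sG: "sets G = sets borel"
    and T: "T = W + 2 * l" and W: "W = D * N" and W1: "W \<ge> 1" and l1: "l \<ge> 1" and K: "K \<ge> 1"
    and D: "D \<ge> 1" and M: "M \<ge> 0"
    and s: "s = - (int n div 2)" and fit: "T * K \<le> int n"
  shows "measure (\<Pi>\<^sub>M e\<in>UNIV. G) {c. (\<forall>b\<in>cube K. core_event (($) w) N D M \<gamma> (\<lambda>e. c (core_shift s T l b e))) \<and>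
       (\<forall>e\<in>open_edges n s T l W K. H \<le> c e)} =
    measure (\<Pi>\<^sub>M e\<in>UNIV. G) {c. core_event (($) w) N D M \<gamma> c} ^ (nat K ^ CARD('d)) *
    measure G {H..} ^ card (open_edges n s T l W K :: (('d \<Rightarrow> int) \<times> 'd) set)"
proof -
  let ?O = "\<Pi>\<^sub>M e\<in>(UNIV :: (('d \<Rightarrow> int) \<times> 'd) set). G"
  have T1: "T \<ge> 1" using W1 l1 by (simp add: T)
  let ?H = "open_edges n s T l W K :: (('d \<Rightarrow> int) \<times> 'd) set"
  have finH: "finite ?H" by (rule card_open_edges_le(1)[OF T W1 l1 K s fit])
  have finK: "finite (cube K :: ('d \<Rightarrow> int) set)" by (simp add: cube_def)
  \<comment> \<open>The sum type puts both kinds of events into one family of blocks.\<close>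
  define B where "B = Inl ` (cube K :: ('d \<Rightarrow> int) set) \<union> Inr ` ?H"
  define J where "J x = (case x of Inl b \<Rightarrow> core_block s T l W b | Inr e \<Rightarrow> {e})" for x :: "('d \<Rightarrow> int) + (('d \<Rightarrow> int) \<times> 'd)"
  define \<Phi> where "\<Phi> x c = (case x of Inl b \<Rightarrow> core_event (($) w) N D M \<gamma> (\<lambda>e. c (core_shift s T l b e)) | Inr e \<Rightarrow> c e \<in> {H..})"
    for x :: "('d \<Rightarrow> int) + (('d \<Rightarrow> int) \<times> 'd)" and c :: "('d \<Rightarrow> int) \<times> 'd \<Rightarrow> real"
  have blocks: "core_block s T l W b \<inter> core_block s T l W b' = {}" if "b \<noteq> b'" for b b' :: "'d \<Rightarrow> int"
    by (rule core_block_disjoint[OF T T1 l1 that])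
  have disj: "disjoint_family_on J B"
    unfolding disjoint_family_on_def
  proof (intro ballI impI)
    fix x y assume xy: "x \<in> B" "y \<in> B" "x \<noteq> y"
    show "J x \<inter> J y = {}"
    proof (cases x)
      case x: (Inl b)
      show ?thesis
      proof (cases y)
        case (Inl b')
        with x xy(3) have "b \<noteq> b'" by simp
        then show ?thesis using blocks by (simp add: x Inl J_def)
      qed (use x xy in \<open>auto simp: B_def J_def open_edges_def\<close>)
    next
      case x: (Inr e)
      show ?thesis by (cases y) (use x xy in \<open>auto simp: B_def J_def open_edges_def\<close>)
    qed
  qed
  have shift_inj: "inj (core_shift s T l b)" for b :: "'d \<Rightarrow> int"
    unfolding core_shift_def by (rule inj_shift)
  note reindex = measure_PiM_reindex[where \<Phi>="core_event (($) w) N D M \<gamma>", OF G sG shift_inj core_event_borel[OF D M]]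
  note coord = measure_PiM_coordinate[OF G sG, where A="{H..}"]
  have meas: "{c. \<Phi> x c} \<in> sets borel" if "x \<in> B" for x
    using reindex(1) coord(1) by (cases x) (simp_all add: \<Phi>_def)
  have local: "\<Phi> x c \<longleftrightarrow> \<Phi> x c'" if "x \<in> B" "\<And>j. j \<in> J x \<Longrightarrow> c j = c' j" for x c c'
  proof (cases x)
    case (Inl b)
    have "core_event (($) w) N D M \<gamma> (\<lambda>e. c (core_shift s T l b e)) \<longleftrightarrow> core_event (($) w) N D M \<gamma> (\<lambda>e. c' (core_shift s T l b e))"
      by (rule core_event_local) (use that(2) in \<open>simp add: Inl J_def core_block_def W[symmetric]\<close>)
    then show ?thesis by (simp add: \<Phi>_def Inl)
  next
    case (Inr e)
    then show ?thesis using that(2)[of e] by (simp add: \<Phi>_def J_def)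
  qed
  have "{c. (\<forall>b\<in>cube K. core_event (($) w) N D M \<gamma> (\<lambda>e. c (core_shift s T l b e))) \<and> (\<forall>e\<in>?H. H \<le> c e)} = {c. \<forall>x\<in>B. \<Phi> x c}"
    by (simp add: B_def \<Phi>_def ball_Un)
  then have "measure ?O {c. (\<forall>b\<in>cube K. core_event (($) w) N D M \<gamma> (\<lambda>e. c (core_shift s T l b e))) \<and> (\<forall>e\<in>?H. H \<le> c e)} =
      measure ?O {c. \<forall>x\<in>B. \<Phi> x c}" by simp
  also have "\<dots> = (\<Prod>x\<in>B. measure ?O {c. \<Phi> x c})"
    using finH finK by (intro measure_PiM_blocks[OF G sG _ disj meas local]) (auto simp: B_def)
  also have "\<dots> = (\<Prod>b\<in>cube K. measure ?O {c. \<Phi> (Inl b) c}) * (\<Prod>e\<in>?H. measure ?O {c. \<Phi> (Inr e) c})"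
    unfolding B_def using finH finK by (subst prod.union_disjoint) (auto simp: prod.reindex)
  also have "\<dots> = measure ?O {c. core_event (($) w) N D M \<gamma> c} ^ card (cube K :: ('d \<Rightarrow> int) set) * measure G {H..} ^ card ?H"
    by (simp add: \<Phi>_def reindex(2) coord(2)[simplified])
  also have "card (cube K :: ('d \<Rightarrow> int) set) = nat K ^ CARD('d)" by (simp add: cube_def card_ibox)
  finally show ?thesis .
qed

section \<open>Exponential rates at two scales and the choice of constants\<close>

lemma near_flow_mono:
  "near_flow n w \<epsilon> c \<Longrightarrow> \<epsilon> \<le> \<epsilon>' \<Longrightarrow> near_flow n w \<epsilon>' c"
  unfolding near_flow_def by (meson ennreal_leI order_trans)

text \<open>\<open>(int N - 1) div T\<close> will be the number of tiles per side at scale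
  \<open>N\<close>; the subtracted 1 absorbs the rounding of N/2 for odd \<open>N\<close>.\<close>

lemma tendsto_div_quotient:
  fixes T :: int
  assumes T: "T \<ge> 1"
  shows "(\<lambda>N. real_of_int ((int N - 1) div T * T) / real N) \<longlonglongrightarrow> 1"
    and "filterlim (\<lambda>N. real_of_int ((int N - 1) div T)) at_top sequentially"
proof -
  have bounds: "real N - 1 - T \<le> real_of_int ((int N - 1) div T * T)" "real_of_int ((int N - 1) div T * T) \<le> real N" for N
  proof -
    let ?x = "int N - 1"
    have "?x div T * T + ?x mod T = ?x" "0 \<le> ?x mod T" "?x mod T < T" using T by simp_all
    then have "int N - 1 - T \<le> ?x div T * T" "?x div T * T \<le> int N" by linarith+
    then show "real N - 1 - T \<le> real_of_int (?x div T * T)" "real_of_int (?x div T * T) \<le> real N" by linarith+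
  qed
  show "(\<lambda>N. real_of_int ((int N - 1) div T * T) / real N) \<longlonglongrightarrow> 1"
  proof (rule tendsto_sandwich)
    have "(\<lambda>N. 1 - (1 + real_of_int T) / real N) \<longlonglongrightarrow> 1 - 0"
      by (intro tendsto_diff tendsto_const real_tendsto_divide_at_top[OF tendsto_const filterlim_real_sequentially])
    then show "(\<lambda>N. 1 - (1 + real_of_int T) / real N) \<longlonglongrightarrow> 1" by simp
    show "\<forall>\<^sub>F N in sequentially. 1 - (1 + real_of_int T) / real N \<le> real_of_int ((int N - 1) div T * T) / real N"
      using eventually_ge_at_top[of 1]
    proof eventually_elim
      case (elim N)
      have "1 - (1 + real_of_int T) / real N = (real N - 1 - T) / real N" using elim by (simp add: field_simps)
      also have "\<dots> \<le> real_of_int ((int N - 1) div T * T) / real N" by (intro divide_right_mono bounds) simp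
      finally show ?case .
    qed
    show "\<forall>\<^sub>F N in sequentially. real_of_int ((int N - 1) div T * T) / real N \<le> 1"
      using eventually_ge_at_top[of 1]
    proof eventually_elim
      case (elim N)
      then show ?case using bounds(2)[of N] by (simp add: pos_divide_le_eq del: of_int_mult)
    qed
  qed (rule tendsto_const)
  show "filterlim (\<lambda>N. real_of_int ((int N - 1) div T)) at_top sequentially"
  proof (rule filterlim_at_top_mono)
    have "filterlim (\<lambda>N. (- 1 - real_of_int T) + real N) at_top sequentially"
      by (rule filterlim_tendsto_add_at_top[OF tendsto_const filterlim_real_sequentially])
    then show "filterlim (\<lambda>N. 1 / real_of_int T * ((- 1 - real_of_int T) + real N)) at_top sequentially"
      using T by (intro filterlim_tendsto_pos_mult_at_top[OF tendsto_const]) auto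
    show "\<forall>\<^sub>F N in sequentially. 1 / real_of_int T * ((- 1 - real_of_int T) + real N) \<le> real_of_int ((int N - 1) div T)"
    proof (rule always_eventually, rule allI)
      fix N
      have "((- 1 - real_of_int T) + real N) / T \<le> real_of_int ((int N - 1) div T)"
        using bounds(1)[of N] T by (simp add: pos_divide_le_eq)
      then show "1 / real_of_int T * ((- 1 - real_of_int T) + real N) \<le> real_of_int ((int N - 1) div T)" by simp
    qed
  qed
qed

text \<open>Almost supermultiplicativity: a scale \<open>N\<close> is filled with tiles of side at
  least \<open>n\<close>, each of which costs no more than a near flow at scale \<open>n\<close>,
  and the forced edges cost less than \<open>\<delta>\<close> per unit of volume. Budget for
  \<open>\<epsilon>\<close>: a quarter for the fine levels of the distance, a quarter for the tile
  averages, half for cut tiles and the margin.\<close>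

lemma near_flow_lower_bound:
  fixes w :: "real ^ 'd::finite" and G :: "real measure" and M \<epsilon> \<delta> :: real
  defines "p \<equiv> \<lambda>n \<epsilon>. measure (\<Pi>\<^sub>M e\<in>UNIV. G) {c. near_flow n w \<epsilon> c}"
  assumes d: "CARD('d) \<ge> 2" and G: "prob_space G" and sG: "sets G = sets borel"
    and M: "M > 0" and AE_M: "AE x in G. x \<le> M" and pos: "\<And>y. y < M \<Longrightarrow> measure G {y..} > 0"
    and w: "\<And>i. \<bar>w $ i\<bar> \<le> M" and \<epsilon>: "\<epsilon> > 0" and \<delta>: "\<delta> > 0"
  obtains \<epsilon>' n0 where "\<epsilon>' > 0"
    "\<And>n. n \<ge> n0 \<Longrightarrow> p n \<epsilon>' > 0 \<Longrightarrow>
      \<forall>\<^sub>F N in sequentially. p N \<epsilon> > 0 \<and> ln (p n \<epsilon>') / real n ^ CARD('d) - \<delta> \<le> ln (p N \<epsilon>) / real N ^ CARD('d)"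
proof -
  let ?d = "CARD('d)"
  let ?O = "\<Pi>\<^sub>M e\<in>(UNIV :: (('d \<Rightarrow> int) \<times> 'd) set). G"
  interpret G: prob_space G by fact
  interpret O: prob_space ?O by (intro prob_space_PiM G)
  have d0: "real ?d > 0" by simp
  define C where "C = ?d * M + norm w"
  have C: "C > 0" using M d0 by (simp add: C_def add_pos_nonneg)
  obtain k0 where "8 * (C * 2 ^ ?d) / \<epsilon> < 2 ^ k0" using real_arch_pow[of 2 "8 * (C * 2 ^ ?d) / \<epsilon>"] by auto
  then have k0: "2 * (C * 2 ^ ?d) / 2 ^ k0 \<le> \<epsilon> / 4" using \<epsilon> by (simp add: field_simps)
  define \<beta> where "\<beta> = \<epsilon> / (8 * ?d)"
  have \<beta>: "\<beta> > 0" "2 * (?d * \<beta>) = \<epsilon> / 4" using \<epsilon> by (simp_all add: \<beta>_def)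
  \<comment> \<open>A third of \<open>\<beta>\<close> is reserved for each of the factor
    \<open>1 - \<eta>\<close>, the error \<gamma> of the core averages, and the shell.\<close>
  define \<eta> where "\<eta> = min 1 (\<beta> / (3 * M))"
  have \<eta>: "0 < \<eta>" "\<eta> \<le> 1" using \<beta> M by (simp_all add: \<eta>_def)
  have \<eta>M: "\<eta> * M \<le> \<beta> / 3"
  proof -
    have "\<eta> * M \<le> \<beta> / (3 * M) * M" using M by (intro mult_right_mono) (auto simp: \<eta>_def)
    then show ?thesis using M by simp
  qed
  \<comment> \<open>Half of the reserve \<open>\<eta> * M\<close> goes to the transports: a quarter
    of \<open>\<eta> * M\<close> to the moves inside patches, through \<open>b\<close>, and an
    eighth to each part of the flux error, through \<open>m\<close> and \<gamma>.\<close>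
  define H where "H = (1 - \<eta> / 2) * M"
  have H: "H < M" "H \<le> M" using \<eta> M by (simp_all add: H_def algebra_simps)
  define q where "q = measure G {H..}"
  have q: "0 < q" "q \<le> 1" using pos[OF H(1)] by (simp_all add: q_def)
  \<comment> \<open>The price of one forced edge, finite because \<open>H\<close> is below the
    essential supremum.\<close>
  define \<Lambda> where "\<Lambda> = - ln q"
  have \<Lambda>: "\<Lambda> \<ge> 0" using q by (simp add: \<Lambda>_def)
  define b where "b = \<lceil>16 * ?d / \<eta>\<rceil>"
  have b16: "16 * ?d / \<eta> \<le> b" by (simp add: b_def)
  have "16 * ?d / \<eta> > 0" using \<eta> d0 by simp
  then have b1: "b \<ge> 1" using b16 by linarith
  have b_bound: "?d * (4 * M / b) \<le> \<eta> * M / 4"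
  proof -
    have "16 * ?d \<le> b * \<eta>" using b16 \<eta> by (simp add: pos_divide_le_eq)
    then have "16 * ?d * M \<le> b * \<eta> * M" using M by (intro mult_right_mono) auto
    then show ?thesis using b1 by (simp add: field_simps)
  qed
  \<comment> \<open>Side of the core divided by side of the tile; it depends on \<open>k\<close> and
    \<open>b\<close> only and tends to 1.\<close>
  define ratio where "ratio k = real k / (2 * b + real k)" for k
  have "(\<lambda>k. (1 - real_of_int (2 * b) / (real_of_int (2 * b) + real k)) ^ ?d) \<longlonglongrightarrow> (1 - 0) ^ ?d"
    by (intro tendsto_power tendsto_diff tendsto_const real_tendsto_divide_at_top[OF tendsto_const]
        filterlim_tendsto_add_at_top[OF tendsto_const filterlim_real_sequentially])
  moreover have "1 - real_of_int (2 * b) / (real_of_int (2 * b) + real k) = ratio k" for k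
    using b1 by (simp add: ratio_def field_simps)
  ultimately have ratio_lim: "(\<lambda>k. ratio k ^ ?d) \<longlonglongrightarrow> 1" by simp
  \<comment> \<open>Allowed volume fraction of the shell: the first bound keeps its share in the
    averages below \<beta>/3, the second keeps the forced edges below \<delta>/2.\<close>
  define \<zeta> where "\<zeta> = min (\<beta> / (6 * M)) (\<delta> / (2 * (?d * \<Lambda> + 1)))"
  have \<zeta>: "\<zeta> > 0" using \<beta> M \<delta> \<Lambda> by (simp add: \<zeta>_def add_nonneg_pos)
  have "\<forall>\<^sub>F k in sequentially. 1 - \<zeta> < ratio k ^ ?d"
    using order_tendstoD(1)[OF ratio_lim, of "1 - \<zeta>"] \<zeta> by simp
  then have "\<forall>\<^sub>F k in sequentially. 1 - \<zeta> < ratio k ^ ?d \<and> k \<ge> 1"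
    using eventually_ge_at_top[of 1] by eventually_elim simp
  then obtain k' where k': "1 - \<zeta> < ratio k' ^ ?d" "k' \<ge> 1" by (auto simp: eventually_sequentially)
  define k where "k = int k'"
  have k1: "k \<ge> 1" using k'(2) by (simp add: k_def)
  have ratio01: "0 \<le> ratio k'" "ratio k' \<le> 1" using b1 by (simp_all add: ratio_def)
  have ratio: "ratio k' = real_of_int k / (k + 2 * b)" by (simp add: ratio_def k_def add.commute)
  define \<rho> where "\<rho> = real_of_int (k + 2 * b) / b"
  have \<rho>: "\<rho> > 0" using k1 b1 by (simp add: \<rho>_def)
  define \<kappa> where "\<kappa> = \<rho> ^ ?d"
  \<comment> \<open>The factor of the flux error in the bound of
    \<open>tile_extension\<close>.\<close>
  define A where "A = 4 * ?d * (1 + \<kappa>)\<^sup>2 * \<rho>"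
  have "\<kappa> > 0" using \<rho> by (simp add: \<kappa>_def)
  then have A: "A > 0" unfolding A_def using \<rho> by (intro mult_pos_pos zero_less_power) auto
  define m where "m = \<lceil>16 * ?d * A / \<eta>\<rceil>"
  have m16: "16 * ?d * A / \<eta> \<le> m" by (simp add: m_def)
  have "16 * ?d * A / \<eta> > 0" using \<eta> d0 A by simp
  then have m1: "m \<ge> 1" using m16 by linarith
  have m_bound: "A * (2 * ?d * M / m) \<le> \<eta> * M / 8"
  proof -
    have "16 * ?d * A \<le> m * \<eta>" using m16 \<eta> by (simp add: pos_divide_le_eq)
    then have "16 * ?d * A * M \<le> m * \<eta> * M" using M by (intro mult_right_mono) auto
    then show ?thesis using m1 by (simp add: field_simps)
  qed
  define \<gamma> where "\<gamma> = min (\<beta> / 3) (\<eta> * M / (8 * A))"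
  have \<gamma>: "\<gamma> > 0" "\<gamma> \<le> \<beta> / 3" using \<beta> \<eta> M A by (simp_all add: \<gamma>_def)
  have \<gamma>_bound: "A * \<gamma> \<le> \<eta> * M / 8"
  proof -
    have "A * \<gamma> \<le> A * (\<eta> * M / (8 * A))" using A by (intro mult_left_mono) (auto simp: \<gamma>_def)
    then show ?thesis using A by simp
  qed
  define N1 where "N1 = k * m"
  have N1: "N1 \<ge> 1" using mult_mono[of 1 k 1 m] k1 m1 by (simp add: N1_def)
  \<comment> \<open>Since n/D is at most \<open>4 * N1\<close>, the error of the core averages in
    \<open>near_flow_core_event\<close> is then at most \<gamma>, uniformly in
    \<open>n\<close>.\<close>
  define \<epsilon>' where "\<epsilon>' = \<gamma> / (2 * (4 * real_of_int N1) ^ (?d + 1))"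
  have \<epsilon>': "\<epsilon>' > 0" using \<gamma> N1 by (simp add: \<epsilon>'_def)
  \<comment> \<open>The quadratic term gives \<open>D \<ge> N1 + 2\<close>, hence a tile side of at
    least \<open>n\<close>; the other terms give \<open>int n \<le> 4 * (D * N1)\<close>.\<close>
  define n0 where "n0 = nat (N1 * (N1 + 2) + 4 * N1 + 12)"
  show ?thesis
  proof (rule that[OF \<epsilon>', of n0])
    fix n assume n: "n \<ge> n0" and p0: "p n \<epsilon>' > 0"
    have nN: "int n \<ge> N1 * (N1 + 2) + 4 * N1 + 12" using n by (simp add: n0_def)
    have N1sq: "0 \<le> N1 * (N1 + 2)" using N1 by simp
    have n1: "n \<ge> 1" using nN N1 N1sq by linarith
    define D where "D = (int n - 2) div N1"
    have D_mod: "N1 * D + (int n - 2) mod N1 = int n - 2" by (simp add: D_def)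
    have mod: "0 \<le> (int n - 2) mod N1" "(int n - 2) mod N1 < N1" using N1 by simp_all
    have D_big: "D \<ge> N1 + 2"
    proof -
      have "(N1 * (N1 + 2)) div N1 \<le> D" unfolding D_def using nN N1 by (intro zdiv_mono1) auto
      then show ?thesis using N1 by simp
    qed
    have D1: "D \<ge> 1" using D_big N1 by simp
    have fit_n: "D * N1 \<le> int n - 2" using D_mod mod by (simp add: mult.commute)
    have fit_n': "int n \<le> D * N1 + N1 + 2" using D_mod mod by (simp add: mult.commute)
    have nD: "real n / D \<le> 4 * real_of_int N1"
    proof -
      have "int n \<le> 4 * (D * N1)" using fit_n' nN N1 N1sq by linarith
      then have "real n \<le> real_of_int (4 * (D * N1))" by linarith
      then show ?thesis using D1 by (simp add: pos_divide_le_eq mult_ac)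
    qed
    define a where "a = D * m"
    define W where "W = k * a"
    define l where "l = b * a"
    define T where "T = W + 2 * l"
    have a1: "a \<ge> 1" using mult_mono[of 1 D 1 m] D1 m1 by (simp add: a_def)
    have WD: "W = D * N1" by (simp add: W_def a_def N1_def)
    have W1: "W \<ge> 1" using mult_mono[of 1 k 1 a] k1 a1 by (simp add: W_def)
    have lD: "l \<ge> D"
    proof -
      have "1 * (D * 1) \<le> b * (D * m)" using b1 m1 D1 by (intro mult_mono) auto
      then show ?thesis by (simp add: l_def a_def)
    qed
    have l1: "l \<ge> 1" using lD D1 by simp
    have T1: "T \<ge> 1" using W1 l1 by (simp add: T_def)
    have Tn: "int n \<le> T" using fit_n' lD D_big l1 unfolding T_def WD by linarith
    have Ta: "T = (k + 2 * b) * a" by (simp add: T_def W_def l_def algebra_simps)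
    have Tl: "real_of_int T / l = \<rho>" using a1 b1 by (simp add: Ta l_def \<rho>_def)
    have WT: "real_of_int W / T = ratio k'"
    proof -
      have "real_of_int W / T = (real_of_int k * a) / (real_of_int (k + 2 * b) * a)" by (simp add: W_def Ta)
      also have "\<dots> = real_of_int k / real_of_int (k + 2 * b)" using a1 by simp
      finally show ?thesis by (simp add: ratio)
    qed
    have WT_d: "1 - (real_of_int W / T) ^ ?d \<le> \<zeta>" using k'(1) by (simp add: WT)
    have H_cond: "(1 - \<eta>) * M + ?d * (4 * M / b) + 4 * ?d * (\<gamma> + 2 * ?d * M / m) * (1 + \<kappa>)\<^sup>2 * (real_of_int T / l) \<le> H"
    proof -
      have "4 * ?d * (\<gamma> + 2 * ?d * M / m) * (1 + \<kappa>)\<^sup>2 * (real_of_int T / l) = A * \<gamma> + A * (2 * ?d * M / m)"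
        unfolding Tl A_def by (simp add: algebra_simps)
      moreover have "(1 - \<eta>) * M = M - \<eta> * M" "H = M - \<eta> * M / 2" by (simp_all add: H_def algebra_simps)
      ultimately show ?thesis using b_bound m_bound \<gamma>_bound by linarith
    qed
    have \<beta>_cond: "\<gamma> + \<eta> * M + 2 * M * (1 - (real_of_int W / T) ^ ?d) \<le> \<beta>"
    proof -
      have "2 * M * (1 - (real_of_int W / T) ^ ?d) \<le> 2 * M * (\<beta> / (6 * M))"
        using WT_d M by (intro mult_left_mono) (auto simp: \<zeta>_def)
      also have "\<dots> = \<beta> / 3" using M by simp
      finally show ?thesis using \<gamma>(2) \<eta>M by linarith
    qed
    define g where "g = measure ?O {c. core_event (($) w) N1 D M \<gamma> c}"
    have g: "p n \<epsilon>' \<le> g"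
    proof -
      let ?\<gamma>n = "2 * (real n / D) ^ (?d + 1) * \<epsilon>'"
      have "p n \<epsilon>' \<le> measure ?O {c. core_event (($) w) N1 D M ?\<gamma>n c}"
        unfolding p_def using M \<epsilon>' by (intro measure_near_flow_le_core_event[OF G sG AE_M _ n1 D1 N1 fit_n]) auto
      also have "\<dots> \<le> g"
        unfolding g_def
      proof (rule O.finite_measure_mono)
        have "(real n / D) ^ (?d + 1) \<le> (4 * real_of_int N1) ^ (?d + 1)" using nD D1 by (intro power_mono) auto
        then have "?\<gamma>n \<le> 2 * (4 * real_of_int N1) ^ (?d + 1) * \<epsilon>'" using \<epsilon>' by (intro mult_right_mono mult_left_mono) auto
        also have "\<dots> = \<gamma>" using N1 by (simp add: \<epsilon>'_def)
        finally show "{c. core_event (($) w) N1 D M ?\<gamma>n c} \<subseteq> {c. core_event (($) w) N1 D M \<gamma> c}"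
          using core_event_mono[OF _ _ D1] by blast
        show "{c. core_event (($) w) N1 D M \<gamma> c} \<in> O.events"
          using core_event_borel[OF D1, of M] M by (simp add: sets_PiM_UNIV_borel[OF sG])
      qed
      finally show ?thesis .
    qed
    have g0: "g > 0" "p n \<epsilon>' \<le> 1" using g p0 by (simp_all add: p_def)
    have K_lim: "filterlim (\<lambda>N. real_of_int ((int N - 1) div T)) at_top sequentially"
      and KT_lim: "(\<lambda>N. real_of_int ((int N - 1) div T * T) / real N) \<longlonglongrightarrow> 1"
      using tendsto_div_quotient[OF T1] by auto
    have lim1: "(\<lambda>N. C * (?d * (2 ^ k0 + 1 :: real) / real_of_int ((int N - 1) div T) + (1 + 1 / real N) ^ ?d
        - (real_of_int ((int N - 1) div T * T) / real N) ^ ?d)) \<longlonglongrightarrow> C * (0 + (1 + 0) ^ ?d - 1 ^ ?d)"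
      by (intro tendsto_mult tendsto_const tendsto_diff tendsto_add tendsto_power KT_lim
          real_tendsto_divide_at_top[OF tendsto_const K_lim] real_tendsto_divide_at_top[OF tendsto_const filterlim_real_sequentially])
    have ev1: "\<forall>\<^sub>F N in sequentially. C * (?d * (2 ^ k0 + 1 :: real) / real_of_int ((int N - 1) div T) + (1 + 1 / real N) ^ ?d
        - (real_of_int ((int N - 1) div T * T) / real N) ^ ?d) < \<epsilon> / 4"
      using order_tendstoD(2)[OF lim1, of "\<epsilon> / 4"] \<epsilon> by simp
    have lim2: "(\<lambda>N. \<Lambda> * ?d * (1 - (real_of_int ((int N - 1) div T * T) / real N * ratio k') ^ ?d))
        \<longlonglongrightarrow> \<Lambda> * ?d * (1 - (1 * ratio k') ^ ?d)"
      by (intro tendsto_mult tendsto_const tendsto_diff tendsto_power KT_lim)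
    have "\<Lambda> * ?d * (1 - (1 * ratio k') ^ ?d) < \<delta>"
    proof -
      have "\<Lambda> * ?d * (1 - (1 * ratio k') ^ ?d) \<le> (?d * \<Lambda> + 1) * \<zeta>"
        using k'(1) \<Lambda> \<zeta> power_le_one[OF ratio01, of ?d] by (intro mult_mono) (auto simp: mult.commute)
      also have "\<dots> \<le> (?d * \<Lambda> + 1) * (\<delta> / (2 * (?d * \<Lambda> + 1)))"
        using \<Lambda> by (intro mult_left_mono) (auto simp: \<zeta>_def)
      also have "\<dots> = \<delta> / 2"
      proof -
        have "?d * \<Lambda> + 1 > 0" using \<Lambda> by (simp add: add_nonneg_pos)
        then show ?thesis by (simp add: field_simps)
      qed
      also have "\<dots> < \<delta>" using \<delta> by simp
      finally show ?thesis .
    qed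
    from order_tendstoD(2)[OF lim2 this]
    have ev2: "\<forall>\<^sub>F N in sequentially. \<Lambda> * ?d * (1 - (real_of_int ((int N - 1) div T * T) / real N * ratio k') ^ ?d) < \<delta>" .
    show "\<forall>\<^sub>F N in sequentially. p N \<epsilon> > 0 \<and> ln (p n \<epsilon>') / real n ^ ?d - \<delta> \<le> ln (p N \<epsilon>) / real N ^ ?d"
      using ev1 ev2 eventually_ge_at_top[of "nat T + 1"]
    proof eventually_elim
      case (elim N)
      define K where "K = (int N - 1) div T"
      define s where "s = - (int N div 2)"
      have N1': "N \<ge> 1" using elim(3) by simp
      have K1: "K \<ge> 1"
      proof -
        have "T div T \<le> K" unfolding K_def using elim(3) T1 by (intro zdiv_mono1) auto
        then show ?thesis using T1 by simp
      qed
      have KT: "T * K \<le> int N - 1"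
      proof -
        have "T * K + (int N - 1) mod T = int N - 1" by (simp add: K_def)
        moreover have "0 \<le> (int N - 1) mod T" using T1 by simp
        ultimately show ?thesis by linarith
      qed
      have half: "2 * (int N div 2) \<le> int N" "int N \<le> 2 * (int N div 2) + 1" by simp_all
      have fit: "- int N \<le> 2 * s" "2 * (s + T * K) \<le> int N" using half KT by (simp_all add: s_def)
      have \<epsilon>_cond: "2 * (?d * \<beta> + C * (?d * (2 ^ k0 + 1 :: real) / K + (1 + 1 / real N) ^ ?d - (real_of_int (K * T) / N) ^ ?d))
          + 2 * (C * 2 ^ ?d) / 2 ^ k0 \<le> \<epsilon>"
        using elim(1) k0 \<beta>(2) unfolding K_def[symmetric] by (simp add: distrib_left)
      let ?Op = "open_edges N s T l W K :: (('d \<Rightarrow> int) \<times> 'd) set"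
      let ?E = "{c. (\<forall>b\<in>cube K. core_event (($) w) N1 D M \<gamma> (\<lambda>e. c (core_shift s T l b e))) \<and> (\<forall>e\<in>?Op. H \<le> c e)}"
      have sub: "?E \<subseteq> {c. near_flow N w \<epsilon> c}"
      proof
        fix c assume c: "c \<in> ?E"
        have "near_flow N w \<epsilon> c"
          using c \<eta> M \<gamma> w H \<epsilon>_cond
          by (intro tiles_near_flow[where D=D and m=m and k=k and b=b and a=a and W=W and l=l and T=T and s=s and K=K
              and M=M and \<gamma>=\<gamma> and \<eta>=\<eta> and \<kappa>=\<kappa> and \<beta>=\<beta> and H=H and C=C and ?k0.0=k0,
              OF d D1 m1 k1 b1 a_def W_def l_def T_def _ _ _ _ _ _ H_cond _ N1' K1 fit \<beta>_cond C_def])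
             (auto simp: Tl \<kappa>_def N1_def)
        then show "c \<in> {c. near_flow N w \<epsilon> c}" by simp
      qed
      have fitN: "T * K \<le> int N" using KT by simp
      have prob: "measure ?O ?E = g ^ (nat K ^ ?d) * q ^ card ?Op"
        unfolding g_def q_def using M by (intro tiles_probability[OF G sG T_def WD W1 l1 K1 D1 _ s_def fitN]) auto
      have "measure ?O ?E \<le> p N \<epsilon>"
        unfolding p_def using near_flow_borel[OF N1', of \<epsilon> w] \<epsilon>
        by (intro O.finite_measure_mono sub) (simp add: sets_PiM_UNIV_borel[OF sG])
      then have pN: "g ^ (nat K ^ ?d) * q ^ card ?Op \<le> p N \<epsilon>" by (simp only: prob)
      have low_pos: "0 < g ^ (nat K ^ ?d) * q ^ card ?Op" using g0 q by simp
      then have pN0: "p N \<epsilon> > 0" using pN by linarith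
      have Op: "real (card ?Op) \<le> ?d * (real N ^ ?d - real_of_int (K * W) ^ ?d)"
        by (rule card_open_edges_le(2)[OF T_def W1 l1 K1 s_def fitN])
      have Nd: "real N ^ ?d > 0" using N1' by simp
      have "ln (p N \<epsilon>) \<ge> ln (g ^ (nat K ^ ?d) * q ^ card ?Op)" using pN low_pos pN0 by simp
      also have "ln (g ^ (nat K ^ ?d) * q ^ card ?Op) = real_of_int K ^ ?d * ln g - card ?Op * \<Lambda>"
        using g0 q K1 by (simp add: ln_mult ln_realpow \<Lambda>_def)
      finally have 1: "real_of_int K ^ ?d * ln g - card ?Op * \<Lambda> \<le> ln (p N \<epsilon>)" .
      have "real_of_int K ^ ?d * ln (p n \<epsilon>') \<le> real_of_int K ^ ?d * ln g"
        using g p0 g0 K1 by (intro mult_left_mono) auto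
      moreover have "card ?Op * \<Lambda> \<le> ?d * (real N ^ ?d - real_of_int (K * W) ^ ?d) * \<Lambda>"
        using Op \<Lambda> by (rule mult_right_mono)
      ultimately have "real_of_int K ^ ?d * ln (p n \<epsilon>') - ?d * (real N ^ ?d - real_of_int (K * W) ^ ?d) * \<Lambda> \<le> ln (p N \<epsilon>)"
        using 1 by linarith
      then have "(real_of_int K ^ ?d * ln (p n \<epsilon>') - ?d * (real N ^ ?d - real_of_int (K * W) ^ ?d) * \<Lambda>) / real N ^ ?d
          \<le> ln (p N \<epsilon>) / real N ^ ?d"
        using Nd by (intro divide_right_mono) auto
      moreover have "(real_of_int K ^ ?d * ln (p n \<epsilon>') - ?d * (real N ^ ?d - real_of_int (K * W) ^ ?d) * \<Lambda>) / real N ^ ?d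
          = (real_of_int K / N) ^ ?d * ln (p n \<epsilon>') - \<Lambda> * ?d * (1 - (real_of_int (K * W) / N) ^ ?d)"
        using Nd by (simp add: power_divide diff_divide_distrib right_diff_distrib left_diff_distrib mult_ac)
      \<comment> \<open>From \<open>int n \<le> T\<close> there are at most (N/n)^d tiles, and since
        the logarithm is not positive, fewer tiles only raise the bound.\<close>
      moreover have "ln (p n \<epsilon>') / real n ^ ?d \<le> (real_of_int K / N) ^ ?d * ln (p n \<epsilon>')"
      proof -
        have "K * int n \<le> K * T" using Tn K1 by (intro mult_left_mono) auto
        then have "K * int n \<le> int N" using KT by (simp add: mult.commute)
        then have "real_of_int (K * int n) \<le> real N" by linarith
        then have "real_of_int K / N \<le> 1 / n" using n1 N1' by (simp add: field_simps)
        then have "(real_of_int K / N) ^ ?d \<le> (1 / n) ^ ?d" using K1 by (intro power_mono) auto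
        moreover have "ln (p n \<epsilon>') \<le> 0" using g0(2) p0 by simp
        ultimately have "(1 / n) ^ ?d * ln (p n \<epsilon>') \<le> (real_of_int K / N) ^ ?d * ln (p n \<epsilon>')"
          by (rule mult_right_mono_neg)
        then show ?thesis by (simp add: power_divide)
      qed
      moreover have "\<Lambda> * ?d * (1 - (real_of_int (K * W) / N) ^ ?d) < \<delta>"
      proof -
        have eq: "real_of_int (K * T) / N * ratio k' = real_of_int (K * W) / N"
          unfolding WT[symmetric] using T1 by simp
        show ?thesis using elim(2)[folded K_def] unfolding eq .
      qed
      ultimately show ?case using pN0 by linarith
    qed
  qed
qed

section \<open>The essential supremum and the limits\<close>

text \<open>\<open>M\<close> is the infimum of the points with null open upper tail. These points
  are nonnegative because the law has no mass below 0, and the tail beyond \<open>M\<close> itself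
  is null as a countable union of null tails.\<close>

lemma ess_sup_exists:
  fixes G :: "real measure"
  assumes G: "prob_space G" and sG: "sets G = sets borel" and nonneg: "emeasure G {..<0} = 0"
    and bdd: "\<exists>M>0. emeasure G {M..} = 0"
  obtains M where "M \<ge> 0" "AE x in G. x \<le> M" "\<And>y. y < M \<Longrightarrow> measure G {y..} > 0"
proof -
  interpret prob_space G by fact
  have [measurable]: "{x<..} \<in> sets G" "{x..} \<in> sets G" for x :: real using sG by simp_all
  have sp: "space G = UNIV" using sets_eq_imp_space_eq[OF sG] by simp
  define S where "S = {x. emeasure G {x<..} = 0}"
  obtain B where B: "B > 0" "emeasure G {B..} = 0" using bdd by blast
  have "emeasure G {B<..} \<le> emeasure G {B..}" by (intro emeasure_mono) auto
  then have BS: "B \<in> S" using B(2) by (simp add: S_def)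
  have S0: "x \<ge> 0" if x: "x \<in> S" for x
  proof (rule ccontr)
    assume "\<not> x \<ge> 0"
    then have "(UNIV :: real set) = {..<0} \<union> {x<..}" by auto
    then have "emeasure G UNIV \<le> emeasure G {..<0} + emeasure G {x<..}"
      using emeasure_subadditive[of "{..<0}" G "{x<..}"] sG by simp
    then have "emeasure G UNIV = 0" using x nonneg by (simp add: S_def)
    then show False using emeasure_space_1 sp by simp
  qed
  then have bddS: "bdd_below S" by (auto simp: bdd_below_def)
  define M where "M = Inf S"
  have M0: "M \<ge> 0" unfolding M_def using BS S0 by (intro cInf_greatest) auto
  have "emeasure G {M + 1 / Suc i<..} = 0" for i
  proof -
    have "Inf S < M + 1 / Suc i" by (simp add: M_def)
    then obtain x where x: "x \<in> S" "x < M + 1 / Suc i" using cInf_lessD[of S "M + 1 / Suc i"] BS by blast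
    have "emeasure G {M + 1 / Suc i<..} \<le> emeasure G {x<..}" using x(2) by (intro emeasure_mono) auto
    then show ?thesis using x(1) by (simp add: S_def)
  qed
  then have "emeasure G (\<Union>i. {M + 1 / Suc i<..}) = 0" by (intro emeasure_UN_eq_0) auto
  moreover have "(\<Union>i. {M + 1 / Suc i<..}) = {M<..}"
  proof (intro equalityI subsetI)
    fix x assume "x \<in> {M<..}"
    then have "x - M > 0" by simp
    then obtain i where "1 / real (Suc i) < x - M" using nat_approx_posE by metis
    then have "x \<in> {M + 1 / Suc i<..}" by simp
    then show "x \<in> (\<Union>i. {M + 1 / Suc i<..})" by blast
  qed (auto intro: less_trans[rotated] simp: less_add_same_cancel1)
  ultimately have null: "emeasure G {M<..} = 0" by simp
  show ?thesis
  proof (rule that[OF M0])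
    show "AE x in G. x \<le> M"
      by (rule AE_I[of _ _ "{M<..}"]) (use null in auto)
    show "measure G {y..} > 0" if y: "y < M" for y
    proof (rule ccontr)
      assume "\<not> measure G {y..} > 0"
      then have "emeasure G {y..} = 0" by (simp add: emeasure_eq_measure zero_less_measure_iff)
      moreover have "emeasure G {y<..} \<le> emeasure G {y..}" by (intro emeasure_mono) auto
      ultimately have "y \<in> S" by (simp add: S_def)
      then have "M \<le> y" unfolding M_def by (intro cInf_lower bddS)
      with y show False by simp
    qed
  qed
qed

lemma elog_mono: "0 \<le> p \<Longrightarrow> p \<le> q \<Longrightarrow> elog p \<le> elog q"
  by (auto simp: elog_def)

lemma tendsto_INF_at_right:
  fixes f :: "real \<Rightarrow> ereal"
  assumes mono: "\<And>x y. 0 < x \<Longrightarrow> x \<le> y \<Longrightarrow> f x \<le> f y"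
  shows "(f \<longlongrightarrow> (INF x\<in>{0<..}. f x)) (at_right 0)"
proof (rule order_tendstoI)
  fix a assume a: "a < (INF x\<in>{0<..}. f x)"
  show "\<forall>\<^sub>F x in at_right 0. a < f x"
    using eventually_at_right_less[of "0 :: real"]
  proof eventually_elim
    case (elim x)
    then have "(INF x\<in>{0<..}. f x) \<le> f x" by (intro INF_lower) simp
    with a show ?case by simp
  qed
next
  fix a assume "(INF x\<in>{0<..}. f x) < a"
  then obtain x0 where x0: "x0 > 0" "f x0 < a" by (auto simp: INF_less_iff)
  have less: "\<forall>\<^sub>F x in at_right 0. x < x0"
    by (rule eventually_at_rightI[of 0 x0]) (use x0(1) in auto)
  show "\<forall>\<^sub>F x in at_right 0. f x < a"
    using eventually_at_right_less[of "0 :: real"] less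
  proof eventually_elim
    case (elim x)
    then show ?case using mono[of x x0] x0(2) by simp
  qed
qed

theorem theorem1p1:
  fixes G :: "real measure"
    and P :: "'w measure"
    and t :: "(real ^ 'd) set \<Rightarrow> 'w \<Rightarrow> real"
    and v :: "real ^ 'd"
    and s :: real
  assumes "CARD('d) \<ge> 2"
    and "prob_space G" and "sets G = sets borel" and "emeasure G {..<0} = 0"
    and "\<exists>M>0. emeasure G {M..} = 0"
    and "prob_space P"
    and "\<And>n. n \<ge> 1 \<Longrightarrow> prob_space.indep_vars P (\<lambda>_. borel) t (edges n)"
    and "\<And>n e. n \<ge> 1 \<Longrightarrow> e \<in> edges n \<Longrightarrow> distr P borel (t e) = G"
    and "v \<in> sphere 0 1"
    and "s > 0"
  shows "\<exists>I::ereal. 0 \<le> I \<and>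
    ((\<lambda>\<epsilon>. limsup (\<lambda>n. ereal (1 / real n ^ CARD('d)) * elog (stream_prob P t (s *\<^sub>R v) \<epsilon> n)))
       \<longlongrightarrow> - I) (at_right 0) \<and>
    ((\<lambda>\<epsilon>. liminf (\<lambda>n. ereal (1 / real n ^ CARD('d)) * elog (stream_prob P t (s *\<^sub>R v) \<epsilon> n)))
       \<longlongrightarrow> - I) (at_right 0)"
proof -
  let ?d = "CARD('d)"
  let ?O = "\<Pi>\<^sub>M e\<in>(UNIV :: (('d \<Rightarrow> int) \<times> 'd) set). G"
  define w where "w = s *\<^sub>R v"
  define p where "p n \<epsilon> = measure ?O {c. near_flow n w \<epsilon> c}" for n \<epsilon>
  define \<phi> where "\<phi> \<epsilon> n = ereal (1 / real n ^ ?d) * elog (p n \<epsilon>)" for \<epsilon> n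
  interpret O: prob_space ?O by (intro prob_space_PiM assms)
  have w0: "w \<noteq> 0" using assms(9,10) by (auto simp: w_def)
  have p01: "0 \<le> p n \<epsilon>" "p n \<epsilon> \<le> 1" for n \<epsilon> by (simp_all add: p_def)
  have p_mono: "p n \<epsilon> \<le> p n \<epsilon>'" if "n \<ge> 1" "0 < \<epsilon>" "\<epsilon> \<le> \<epsilon>'" for n \<epsilon> \<epsilon>'
    unfolding p_def using near_flow_mono[of n w \<epsilon> _ \<epsilon>'] near_flow_borel[of n \<epsilon>' w] that
    by (intro O.finite_measure_mono) (auto simp: sets_PiM_UNIV_borel[OF assms(3)])
  have \<phi>_pos: "\<phi> \<epsilon> n = ereal (ln (p n \<epsilon>) / real n ^ ?d)" if "p n \<epsilon> > 0" for \<epsilon> n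
    using that by (simp add: \<phi>_def elog_def)
  have \<phi>_zero: "\<phi> \<epsilon> n = - \<infinity>" if "p n \<epsilon> = 0" "n \<ge> 1" for \<epsilon> n
    using that by (simp add: \<phi>_def elog_def)
  have \<phi>_le0: "\<phi> \<epsilon> n \<le> 0" for \<epsilon> n
  proof -
    have "p n \<epsilon> \<noteq> 0 \<Longrightarrow> ln (p n \<epsilon>) \<le> 0" using p01[of n \<epsilon>] by simp
    then have "elog (p n \<epsilon>) \<le> 0" by (simp add: elog_def zero_ereal_def)
    then show ?thesis
      unfolding \<phi>_def using ereal_mult_left_mono[of "elog (p n \<epsilon>)" 0 "ereal (1 / real n ^ ?d)"] by simp
  qed
  have \<phi>_mono: "\<phi> \<epsilon> n \<le> \<phi> \<epsilon>' n" if "n \<ge> 1" "0 < \<epsilon>" "\<epsilon> \<le> \<epsilon>'" for n \<epsilon> \<epsilon>'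
    unfolding \<phi>_def by (intro ereal_mult_left_mono elog_mono p01 p_mono that) simp
  \<comment> \<open>The limit of the upper rates, to be -I. What remains is that no lower rate falls
    below \<open>J\<close>.\<close>
  define J where "J = (INF \<epsilon>\<in>{0<..}. limsup (\<phi> \<epsilon>))"
  have J_le: "J \<le> limsup (\<phi> \<epsilon>)" if "\<epsilon> > 0" for \<epsilon>
    unfolding J_def using that by (intro INF_lower) simp
  have J0: "J \<le> 0"
  proof -
    have "limsup (\<phi> 1) \<le> 0" by (rule Limsup_bounded[OF always_eventually]) (simp add: \<phi>_le0)
    with J_le[of 1] show ?thesis by simp
  qed
  have upper: "((\<lambda>\<epsilon>. limsup (\<phi> \<epsilon>)) \<longlongrightarrow> J) (at_right 0)"
    unfolding J_def
  proof (rule tendsto_INF_at_right)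
    fix x y :: real assume "0 < x" "x \<le> y"
    then show "limsup (\<phi> x) \<le> limsup (\<phi> y)"
      using \<phi>_mono by (intro Limsup_mono) (auto simp: eventually_sequentially intro!: exI[of _ 1])
  qed
  \<comment> \<open>Supplies the starting scale of the comparison. Its probability is positive
    because the rate -\<infinity> exceeds no \<open>a\<close>.\<close>
  have frequent: "\<exists>n\<ge>n0. p n \<epsilon> > 0 \<and> a < \<phi> \<epsilon> n" if "\<epsilon> > 0" "a < J" for \<epsilon> n0 a
  proof -
    have "a < limsup (\<phi> \<epsilon>)" using that J_le[of \<epsilon>] by simp
    then have "\<exists>\<^sub>F n in sequentially. a < \<phi> \<epsilon> n"
      using Limsup_bounded[where F=sequentially and X="\<phi> \<epsilon>" and C=a] unfolding frequently_def not_less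
      by (meson leD)
    then obtain n where n: "n \<ge> max 1 n0" "a < \<phi> \<epsilon> n"
      unfolding frequently_sequentially by blast
    then have "p n \<epsilon> > 0" using \<phi>_zero[of n \<epsilon>] p01(1)[of n \<epsilon>] by (cases "p n \<epsilon> = 0") auto
    with n show ?thesis by auto
  qed
  have lower: "J \<le> liminf (\<phi> \<epsilon>)" if \<epsilon>: "\<epsilon> > 0" for \<epsilon>
  proof (cases "J = - \<infinity>")
    case False
    then obtain j where j: "J = ereal j" using J0 by (cases J) auto
    obtain M where M: "M \<ge> 0" "AE x in G. x \<le> M" "\<And>y. y < M \<Longrightarrow> measure G {y..} > 0"
      by (rule ess_sup_exists[OF assms(2-5)]) (rule that)
    \<comment> \<open>A finite \<open>J\<close> makes near flows possible at every precision, and a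
      single subcube of side \<open>n - 2\<close> bounds the components of the target. The 3 in
      \<open>\<epsilon>1\<close> bounds n/(n - 2) for \<open>n \<ge> 3\<close>.\<close>
    have w_le: "\<bar>w $ i\<bar> \<le> M" for i
    proof (rule field_le_epsilon)
      fix e :: real assume e: "e > 0"
      define \<epsilon>1 where "\<epsilon>1 = e / (2 * 3 ^ (?d + 1))"
      have \<epsilon>1: "\<epsilon>1 > 0" using e by (simp add: \<epsilon>1_def)
      obtain n where n: "n \<ge> 3" "p n \<epsilon>1 > 0" using frequent[OF \<epsilon>1, of "ereal (j - 1)" 3] by (auto simp: j)
      let ?D = "int n - 2"
      let ?\<gamma> = "2 * (real n / ?D) ^ (?d + 1) * \<epsilon>1"
      have "p n \<epsilon>1 \<le> measure ?O {c. core_event (($) w) 1 ?D M ?\<gamma> c}"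
        unfolding p_def using n(1) \<epsilon>1 by (intro measure_near_flow_le_core_event[OF assms(2,3) M(2,1)]) auto
      then have "measure ?O {c. core_event (($) w) 1 ?D M ?\<gamma> c} \<noteq> 0" using n(2) by linarith
      then have "{c. core_event (($) w) 1 ?D M ?\<gamma> c} \<noteq> {}" by (metis measure_empty)
      then obtain c where "core_event (($) w) 1 ?D M ?\<gamma> c" by blast
      then have "\<bar>w $ i\<bar> \<le> M + ?\<gamma>" using n(1) by (intro core_event_average_le) auto
      also have "?\<gamma> \<le> 2 * 3 ^ (?d + 1) * \<epsilon>1"
      proof (intro mult_right_mono mult_left_mono power_mono)
        show "real n / ?D \<le> 3" using n(1) by (simp add: field_simps)
      qed (use n(1) \<epsilon>1 in auto)
      also have "2 * 3 ^ (?d + 1) * \<epsilon>1 = e" by (simp add: \<epsilon>1_def)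
      finally show "\<bar>w $ i\<bar> \<le> M + e" by simp
    qed
    have M0: "M > 0"
    proof (rule ccontr)
      assume "\<not> M > 0"
      then have "w $ i = 0" for i using w_le[of i] M(1) by simp
      then show False using w0 by (simp add: vec_eq_iff)
    qed
    show ?thesis
      unfolding j
    proof (rule ereal_le_epsilon2)
      fix e :: real assume e: "e > 0"
      then have e2: "e / 2 > 0" by simp
      obtain \<epsilon>' n0 where \<epsilon>': "\<epsilon>' > 0" and main: "\<And>n. n \<ge> n0 \<Longrightarrow> p n \<epsilon>' > 0 \<Longrightarrow>
        \<forall>\<^sub>F N in sequentially. p N \<epsilon> > 0 \<and> ln (p n \<epsilon>') / real n ^ ?d - e / 2 \<le> ln (p N \<epsilon>) / real N ^ ?d"
        using near_flow_lower_bound[where w=w, OF assms(1-3) M0 M(2,3) w_le \<epsilon> e2] unfolding p_def by blast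
      obtain n where n: "n \<ge> n0" "p n \<epsilon>' > 0" "ereal (j - e / 2) < \<phi> \<epsilon>' n"
        using frequent[OF \<epsilon>', of "ereal (j - e / 2)" n0] e by (auto simp: j)
      have "\<forall>\<^sub>F N in sequentially. ereal (j - e) \<le> \<phi> \<epsilon> N"
        using main[OF n(1,2)]
      proof eventually_elim
        case (elim N)
        then show ?case using n(2,3) by (simp add: \<phi>_pos)
      qed
      then have "ereal (j - e) \<le> liminf (\<phi> \<epsilon>)" by (rule Liminf_bounded)
      then have "ereal (j - e) + ereal e \<le> liminf (\<phi> \<epsilon>) + ereal e" by (rule add_right_mono)
      then show "ereal j \<le> liminf (\<phi> \<epsilon>) + ereal e" by simp
    qed
  qed simp
  have lower_lim: "((\<lambda>\<epsilon>. liminf (\<phi> \<epsilon>)) \<longlongrightarrow> J) (at_right 0)"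
  proof (rule tendsto_sandwich[OF _ _ tendsto_const upper])
    show "\<forall>\<^sub>F \<epsilon> in at_right 0. J \<le> liminf (\<phi> \<epsilon>)"
      using eventually_at_right_less[of "0 :: real"] by eventually_elim (rule lower)
    show "\<forall>\<^sub>F \<epsilon> in at_right 0. liminf (\<phi> \<epsilon>) \<le> limsup (\<phi> \<epsilon>)"
      by (intro always_eventually allI Liminf_le_Limsup) simp
  qed
  have eq: "\<forall>\<^sub>F n in sequentially. \<phi> \<epsilon> n = ereal (1 / real n ^ ?d) * elog (stream_prob P t (s *\<^sub>R v) \<epsilon> n)"
    if "\<epsilon> > 0" for \<epsilon>
    using eventually_ge_at_top[of 1]
  proof eventually_elim
    case (elim n)
    have "stream_prob P t w \<epsilon> n = p n \<epsilon>"
      unfolding p_def using that elim by (intro stream_prob_eq assms) auto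
    then show ?case by (simp add: \<phi>_def w_def)
  qed
  have "\<forall>\<^sub>F \<epsilon> in at_right 0. limsup (\<phi> \<epsilon>) = limsup (\<lambda>n. ereal (1 / real n ^ ?d) * elog (stream_prob P t (s *\<^sub>R v) \<epsilon> n))"
    using eventually_at_right_less[of "0 :: real"] by eventually_elim (intro Limsup_eq eq)
  with upper have "((\<lambda>\<epsilon>. limsup (\<lambda>n. ereal (1 / real n ^ ?d) * elog (stream_prob P t (s *\<^sub>R v) \<epsilon> n))) \<longlongrightarrow> J) (at_right 0)"
    by (rule Lim_transform_eventually)
  moreover have "\<forall>\<^sub>F \<epsilon> in at_right 0. liminf (\<phi> \<epsilon>) = liminf (\<lambda>n. ereal (1 / real n ^ ?d) * elog (stream_prob P t (s *\<^sub>R v) \<epsilon> n))"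
    using eventually_at_right_less[of "0 :: real"] by eventually_elim (intro Liminf_eq eq)
  with lower_lim have "((\<lambda>\<epsilon>. liminf (\<lambda>n. ereal (1 / real n ^ ?d) * elog (stream_prob P t (s *\<^sub>R v) \<epsilon> n))) \<longlongrightarrow> J) (at_right 0)"
    by (rule Lim_transform_eventually)
  ultimately show ?thesis using J0 by (intro exI[of _ "- J"]) (simp add: ereal_uminus_le_reorder)
qed

end
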